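(* There is a randomized algorithm which, given $\epsilon\in(0,1)$ and a diagonally dominant cost matrix $C\in\mathbb{S}^n$ (symmetric, with positive diagonal entries), runs in polynomial time $$\mathcal{O}\left(\frac{n^3}{\epsilon^3}\log(2n)\log\left(\frac{4n}{\epsilon}\right)\times \mathrm{mvc}\right),$$ where $\mathrm{mvc}$ is the complexity of matrix-vector multiplication with $C$, and generates a random binary vector $w\in\{-1,1\}^n$ satisfying $$\alpha_{GW}(1-\epsilon)\,\mathrm{opt}\ \leq\ \mathbb{E}[w^TCw]\ \leq\ \mathrm{opt},$$ where $\mathrm{opt}$ is the maximum of $x^TCx$ over $x\in\{-1,1\}^n$. The working memory of the algorithm is at most $3n$ numbers.
   Context: $\mathbb{S}^n$ is the space of real symmetric $n\times n$ matrices. A symmetric matrix $C$ is diagonally dominant if $|C_{ii}|\ge\sum_{j\ne i}|C_{ij}|$ for every $i$. The motivating case is MaxCut, with $C=\frac14 L_G$ for a graph Laplacian $L_G$. The constant $\alpha_{GW}=\min_{0<\theta\le\pi}\frac{2}{\pi}\frac{\theta}{1-\cos\theta}\approx 0.878$ is the Goemans-Williamson constant. The working memory of an algorithm is the total memory (here counted in stored real numbers) it uses apart from the memory required to represent the problem instance. The expectation is over all internal randomness of the algorithm. *)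

theory Defs
  imports "HOL-Probability.Probability" "Jordan_Normal_Form.Matrix"
begin

section \<open>The optimisation problem\<close>

definition diagonally_dominant :: "real mat \<Rightarrow> bool" where
  "diagonally_dominant C \<longleftrightarrow>
     (\<forall>i<dim_row C. (\<Sum>j\<in>{..<dim_col C} - {i}. \<bar>C $$ (i, j)\<bar>) \<le> \<bar>C $$ (i, i)\<bar>)"

definition sign_vecs :: "nat \<Rightarrow> real vec set" where
  "sign_vecs n = {x \<in> carrier_vec n. \<forall>i<n. x $ i \<in> {-1, 1}}"

definition quad_form :: "real mat \<Rightarrow> real vec \<Rightarrow> real" where
  "quad_form C x = scalar_prod x (C *\<^sub>v x)"

definition opt :: "nat \<Rightarrow> real mat \<Rightarrow> real" where
  "opt n C = Max (quad_form C ` sign_vecs n)"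

definition alpha_GW :: real where
  "alpha_GW = (INF \<theta>\<in>{0<..pi}. 2 / pi * (\<theta> / (1 - cos \<theta>)))"

text \<open>The infimum is attained, so \<^const>\<open>alpha_GW\<close> is indeed a minimum.\<close>

lemma alpha_GW_is_min:
  "\<exists>\<theta>\<in>{0<..pi}. alpha_GW = 2 / pi * (\<theta> / (1 - cos \<theta>)) \<and>
     (\<forall>\<phi>\<in>{0<..pi}. 2 / pi * (\<theta> / (1 - cos \<theta>)) \<le> 2 / pi * (\<phi> / (1 - cos \<phi>)))"
proof -
  define f :: "real \<Rightarrow> real" where "f \<theta> = 2 / pi * (\<theta> / (1 - cos \<theta>))" for \<theta>
  have pos: "1 - cos \<theta> > 0" if "\<theta> \<in> {0<..pi}" for \<theta>
    using cos_monotone_0_pi[of 0 \<theta>] that by simp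
  have "\<forall>\<theta>\<in>{1..pi}. 1 - cos \<theta> \<noteq> 0"
  proof
    fix \<theta> assume "\<theta> \<in> {1..pi}"
    then have "\<theta> \<in> {0<..pi}" by auto
    from pos[OF this] show "1 - cos \<theta> \<noteq> 0" by linarith
  qed
  then have "continuous_on {1..pi} (\<lambda>\<theta>. \<theta> / (1 - cos \<theta>))"
    by (intro continuous_on_divide continuous_on_diff continuous_on_cos
        continuous_on_const continuous_on_id)
  then have "continuous_on {1..pi} f"
    unfolding f_def by (rule continuous_on_mult_left)
  moreover have "{1..pi} \<noteq> {}" using pi_gt3 by auto
  ultimately obtain \<theta> where \<theta>: "\<theta> \<in> {1..pi}" and min: "\<forall>\<phi>\<in>{1..pi}. f \<theta> \<le> f \<phi>"
    using continuous_attains_inf[of "{1..pi}" f] by auto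
  have le: "f \<theta> \<le> f \<phi>" if \<phi>: "\<phi> \<in> {0<..pi}" for \<phi>
  proof (cases "\<phi> \<ge> 1")
    case True
    then show ?thesis using min \<phi> by auto
  next
    case False
    have "1 - cos \<phi> = 2 * (sin (\<phi> / 2))\<^sup>2"
      using cos_double_sin[of "\<phi> / 2"] by simp
    also have "(sin (\<phi> / 2))\<^sup>2 \<le> (\<phi> / 2)\<^sup>2"
      by (rule abs_le_square_iff[THEN iffD1, OF abs_sin_x_le_abs_x])
    finally have "1 - cos \<phi> \<le> \<phi>\<^sup>2 / 2" by (simp add: power2_eq_square)
    also have "\<dots> \<le> \<phi> / 2" using False \<phi> by (auto simp: power2_eq_square mult_left_le)
    finally have "2 \<le> \<phi> / (1 - cos \<phi>)" using pos[OF \<phi>] by (simp add: field_simps)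
    then have "2 / pi * 2 \<le> f \<phi>" unfolding f_def by (intro mult_left_mono) auto
    moreover have "1 \<le> 2 / pi * 2" using pi_less_4 by (simp add: field_simps)
    moreover have "f \<theta> \<le> f pi" using min pi_gt3 by auto
    moreover have "f pi = 1" by (simp add: f_def)
    ultimately show ?thesis by linarith
  qed
  have in0: "\<theta> \<in> {0<..pi}" using \<theta> by auto
  have "alpha_GW = f \<theta>"
    unfolding alpha_GW_def f_def[symmetric]
    by (rule cInf_eq_minimum) (use in0 le in auto)
  then show ?thesis using in0 le unfolding f_def by blast
qed


section \<open>Randomised real-number programs with matrix-vector products\<close>

text \<open>
  A program is a finite piece of syntax that works uniformly for all dimensions and inputs.
  The instance consists of the dimension \<open>n\<close>, the accuracy \<open>\<epsilon>\<close> and the matrix \<open>C\<close>; the matrix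
  is only accessible through products with vectors.  Numbers are stored in an array of real cells.

  Besides, a program has a fixed finite set of registers for natural numbers.  They serve as
  loop counters and array indices: they can only be reset, copied and incremented, so their
  values never exceed the maximum of \<open>n\<close>, the constants in the program and the running time.
  In particular they cannot be used to encode vectors of numbers.

  Real constants other than quotients of naturals are deliberately absent, since
  they could carry advice.
\<close>

datatype nexp = NConst nat | NDim | NReg nat

text \<open>\<open>RCell k e\<close> is the cell with address \<open>k * n + e\<close>, i.e. entry \<open>e\<close> of the \<open>k\<close>-th vector.\<close>

datatype rexp =
    RNat nexp
  | REps
  | RCell nat nexp
  | RAdd rexp rexp
  | RSub rexp rexp
  | RMul rexp rexp
  | RDiv rexp rexp
  | RSqrt rexp
  | RExp rexp
  | RLn rexp

datatype cond =
    NLess nexp nexp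
  | RLess rexp rexp
  | CNot cond
  | CAnd cond cond

datatype com =
    Skip
  | Seq com com
  | If cond com com
  | While cond com
  | Copy nat nexp         \<comment> \<open>index register := index expression\<close>
  | Incr nat
  | Store nat nexp rexp   \<comment> \<open>cell := value\<close>
  | Gauss nat nexp        \<comment> \<open>cell := fresh sample of the standard normal distribution\<close>
  | MatVec nat nat        \<comment> \<open>\<open>MatVec k l\<close>: \<open>l\<close>-th vector := \<open>C\<close> times \<open>k\<close>-th vector\<close>

record inst =
  dim :: nat
  acc :: real
  cost_mat :: "real mat"
  mvc :: real

record state =
  regs :: "nat \<Rightarrow> nat"
  mem :: "nat \<Rightarrow> real"
  draws :: nat

definition init_state :: state where
  "init_state = \<lparr>regs = (\<lambda>_. 0), mem = (\<lambda>_. 0), draws = 0\<rparr>"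

fun nval :: "inst \<Rightarrow> state \<Rightarrow> nexp \<Rightarrow> nat" where
  "nval I s (NConst c) = c"
| "nval I s NDim = dim I"
| "nval I s (NReg r) = regs s r"

definition addr :: "inst \<Rightarrow> state \<Rightarrow> nat \<Rightarrow> nexp \<Rightarrow> nat" where
  "addr I s k e = k * dim I + nval I s e"

fun rval :: "inst \<Rightarrow> state \<Rightarrow> rexp \<Rightarrow> real" where
  "rval I s (RNat e) = real (nval I s e)"
| "rval I s REps = acc I"
| "rval I s (RCell k e) = mem s (addr I s k e)"
| "rval I s (RAdd a b) = rval I s a + rval I s b"
| "rval I s (RSub a b) = rval I s a - rval I s b"
| "rval I s (RMul a b) = rval I s a * rval I s b"
| "rval I s (RDiv a b) = rval I s a / rval I s b"
| "rval I s (RSqrt a) = sqrt (rval I s a)"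
| "rval I s (RExp a) = exp (rval I s a)"
| "rval I s (RLn a) = ln (rval I s a)"

fun cval :: "inst \<Rightarrow> state \<Rightarrow> cond \<Rightarrow> bool" where
  "cval I s (NLess a b) \<longleftrightarrow> nval I s a < nval I s b"
| "cval I s (RLess a b) \<longleftrightarrow> rval I s a < rval I s b"
| "cval I s (CNot b) \<longleftrightarrow> \<not> cval I s b"
| "cval I s (CAnd a b) \<longleftrightarrow> cval I s a \<and> cval I s b"

text \<open>Evaluating an expression costs one time unit per node; a condition is always evaluated
  completely.\<close>

fun rcost :: "rexp \<Rightarrow> real" where
  "rcost (RNat e) = 1"
| "rcost REps = 1"
| "rcost (RCell k e) = 1"
| "rcost (RAdd a b) = 1 + rcost a + rcost b"
| "rcost (RSub a b) = 1 + rcost a + rcost b"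
| "rcost (RMul a b) = 1 + rcost a + rcost b"
| "rcost (RDiv a b) = 1 + rcost a + rcost b"
| "rcost (RSqrt a) = 1 + rcost a"
| "rcost (RExp a) = 1 + rcost a"
| "rcost (RLn a) = 1 + rcost a"

fun ccost :: "cond \<Rightarrow> real" where
  "ccost (NLess a b) = 1"
| "ccost (RLess a b) = 1 + rcost a + rcost b"
| "ccost (CNot b) = 1 + ccost b"
| "ccost (CAnd a b) = 1 + ccost a + ccost b"

fun rcells :: "inst \<Rightarrow> state \<Rightarrow> rexp \<Rightarrow> nat set" where
  "rcells I s (RNat e) = {}"
| "rcells I s REps = {}"
| "rcells I s (RCell k e) = {addr I s k e}"
| "rcells I s (RAdd a b) = rcells I s a \<union> rcells I s b"
| "rcells I s (RSub a b) = rcells I s a \<union> rcells I s b"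
| "rcells I s (RMul a b) = rcells I s a \<union> rcells I s b"
| "rcells I s (RDiv a b) = rcells I s a \<union> rcells I s b"
| "rcells I s (RSqrt a) = rcells I s a"
| "rcells I s (RExp a) = rcells I s a"
| "rcells I s (RLn a) = rcells I s a"

fun ccells :: "inst \<Rightarrow> state \<Rightarrow> cond \<Rightarrow> nat set" where
  "ccells I s (NLess a b) = {}"
| "ccells I s (RLess a b) = rcells I s a \<union> rcells I s b"
| "ccells I s (CNot b) = ccells I s b"
| "ccells I s (CAnd a b) = ccells I s a \<union> ccells I s b"

definition block :: "inst \<Rightarrow> nat \<Rightarrow> nat set" where
  "block I k = {k * dim I ..< k * dim I + dim I}"

definition read_vec :: "inst \<Rightarrow> state \<Rightarrow> nat \<Rightarrow> real vec" where
  "read_vec I s k = vec (dim I) (\<lambda>i. mem s (k * dim I + i))"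

definition write_vec :: "inst \<Rightarrow> nat \<Rightarrow> real vec \<Rightarrow> state \<Rightarrow> state" where
  "write_vec I k v s =
     s\<lparr>mem := (\<lambda>a. if a \<in> block I k then v $ (a - k * dim I) else mem s a)\<rparr>"

text \<open>
  \<open>exec I \<omega> P s t A s'\<close>: on instance \<open>I\<close> and with the infinite sequence \<open>\<omega>\<close> of random numbers,
  program \<open>P\<close> started in state \<open>s\<close> terminates in state \<open>s'\<close> after \<open>t\<close> time units, and \<open>A\<close> is the
  set of all cells that were read or written in the meantime.  Every product with the matrix costs
  \<^const>\<open>mvc\<close>, and may overwrite its argument; it is a black box belonging to the representation of
  the instance.  Every number that is kept from one instruction to the next, scalars included,
  occupies a cell, so the working memory of the run is the cardinality of \<open>A\<close>.
\<close>

inductive exec ::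
  "inst \<Rightarrow> (nat \<Rightarrow> real) \<Rightarrow> com \<Rightarrow> state \<Rightarrow> real \<Rightarrow> nat set \<Rightarrow> state \<Rightarrow> bool"
  for I :: inst and \<omega> :: "nat \<Rightarrow> real"
where
  Skip: "exec I \<omega> Skip s 1 {} s"
| Seq: "exec I \<omega> P s t A s' \<Longrightarrow> exec I \<omega> Q s' t' A' s'' \<Longrightarrow>
    exec I \<omega> (Seq P Q) s (t + t') (A \<union> A') s''"
| IfTrue: "cval I s b \<Longrightarrow> exec I \<omega> P s t A s' \<Longrightarrow>
    exec I \<omega> (If b P Q) s (ccost b + t) (ccells I s b \<union> A) s'"
| IfFalse: "\<not> cval I s b \<Longrightarrow> exec I \<omega> Q s t A s' \<Longrightarrow>
    exec I \<omega> (If b P Q) s (ccost b + t) (ccells I s b \<union> A) s'"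
| WhileFalse: "\<not> cval I s b \<Longrightarrow>
    exec I \<omega> (While b P) s (ccost b) (ccells I s b) s"
| WhileTrue: "cval I s b \<Longrightarrow> exec I \<omega> P s t A s' \<Longrightarrow> exec I \<omega> (While b P) s' t' A' s'' \<Longrightarrow>
    exec I \<omega> (While b P) s (ccost b + t + t') (ccells I s b \<union> A \<union> A') s''"
| Copy: "exec I \<omega> (Copy r e) s 1 {} (s\<lparr>regs := (regs s)(r := nval I s e)\<rparr>)"
| Incr: "exec I \<omega> (Incr r) s 1 {} (s\<lparr>regs := (regs s)(r := Suc (regs s r))\<rparr>)"
| Store: "exec I \<omega> (Store k e a) s (1 + rcost a) ({addr I s k e} \<union> rcells I s a)
    (s\<lparr>mem := (mem s)(addr I s k e := rval I s a)\<rparr>)"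
| Gauss: "exec I \<omega> (Gauss k e) s 1 {addr I s k e}
    (s\<lparr>mem := (mem s)(addr I s k e := \<omega> (draws s)), draws := Suc (draws s)\<rparr>)"
| MatVec: "exec I \<omega> (MatVec k l) s (mvc I) (block I k \<union> block I l)
    (write_vec I l (cost_mat I *\<^sub>v read_vec I s k) s)"

inductive_cases
      SkipE: "exec I \<omega> Skip s t A s'"
  and SeqE: "exec I \<omega> (Seq P Q) s t A s'"
  and IfE: "exec I \<omega> (If b P Q) s t A s'"
  and WhileE: "exec I \<omega> (While b P) s t A s'"
  and CopyE: "exec I \<omega> (Copy r e) s t A s'"
  and IncrE: "exec I \<omega> (Incr r) s t A s'"
  and StoreE: "exec I \<omega> (Store k e a) s t A s'"
  and GaussE: "exec I \<omega> (Gauss k e) s t A s'"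
  and MatVecE: "exec I \<omega> (MatVec k l) s t A s'"

lemma exec_deterministic:
  "exec I \<omega> P s t A s' \<Longrightarrow> exec I \<omega> P s t' A' s'' \<Longrightarrow> t' = t \<and> A' = A \<and> s'' = s'"
proof (induction arbitrary: t' A' s'' rule: exec.induct)
  case Skip
  then show ?case by (elim SkipE) simp
next
  case (Seq P s t A s1 Q t1 A1 s2)
  from Seq.prems show ?case by (rule SeqE) (use Seq.IH in blast)
next
  case (IfTrue s b P t A s1 Q)
  from IfTrue.prems show ?case by (rule IfE) (use IfTrue.IH IfTrue.hyps in blast)+
next
  case (IfFalse s b Q t A s1 P)
  from IfFalse.prems show ?case by (rule IfE) (use IfFalse.IH IfFalse.hyps in blast)+
next
  case (WhileFalse s b P)
  from WhileFalse.prems show ?case by (rule WhileE) (use WhileFalse.hyps in blast)+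
next
  case (WhileTrue s b P t A s1 t1 A1 s2)
  from WhileTrue.prems show ?case by (rule WhileE) (use WhileTrue.IH WhileTrue.hyps in blast)+
next
  case Copy
  then show ?case by (elim CopyE) simp
next
  case Incr
  then show ?case by (elim IncrE) simp
next
  case Store
  then show ?case by (elim StoreE) simp
next
  case Gauss
  then show ?case by (elim GaussE) simp
next
  case MatVec
  then show ?case by (elim MatVecE) simp
qed

lemma finite_rcells [simp]: "finite (rcells I s a)"
  by (induction a) auto

lemma finite_ccells [simp]: "finite (ccells I s b)"
  by (induction b) auto

lemma exec_finite_cells: "exec I \<omega> P s t A s' \<Longrightarrow> finite A"
  by (induction rule: exec.induct) (auto simp: block_def)

text \<open>A complete run starts in the initial state and leaves its output in the first \<open>n\<close> cells.\<close>

definition run ::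
  "com \<Rightarrow> inst \<Rightarrow> (nat \<Rightarrow> real) \<Rightarrow> real \<Rightarrow> nat set \<Rightarrow> real vec \<Rightarrow> bool" where
  "run P I \<omega> t A w \<longleftrightarrow> (\<exists>s. exec I \<omega> P init_state t A s \<and> w = read_vec I s 0)"

definition gaussians :: "(nat \<Rightarrow> real) measure" where
  "gaussians = (\<Pi>\<^sub>M i\<in>UNIV. std_normal_distribution)"

end

theory Submission
  imports Defs
begin

text \<open>
  The algorithm builds \<open>X = \<Sum>\<^sub>t y\<^sub>t y\<^sub>t\<^sup>T\<close> by multiplicative weights for the packing problem of maximising
  \<open>\<langle>C, X\<rangle>\<close> relative to \<open>max X\<^sub>i\<^sub>i\<close>.  With weights \<open>p\<^sub>i = exp (\<eta> X\<^sub>i\<^sub>i)\<close>, the direction \<open>y\<^sub>t\<close> is an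
  approximate top eigenvector of \<open>diag(p)\<^sup>-\<^sup>1 C\<close>, computed by the power method from the unit vector with
  the largest moment and scaled to have maximal entry 1.  Comparing with \<open>x x\<^sup>T\<close> for an optimal sign
  vector \<open>x\<close> (a feasible point of the relaxation) gives \<open>\<langle>C, X\<rangle> \<ge> (1 - \<epsilon>) opt max X\<^sub>i\<^sub>i\<close>.

  All directions are deterministic, so \<open>\<Sum>\<^sub>t \<zeta>\<^sub>t y\<^sub>t\<close> with independent Gaussians \<open>\<zeta>\<^sub>t\<close> is a Gaussian vector
  with covariance \<open>X\<close>, and after padding the diagonal its signs are a Goemans-Williamson rounding.

  Only three vectors are stored.  The power step works in place, because \<open>diag(p)\<^sup>-\<^sup>1 C x\<close> overwrites \<open>x\<close>;
  start vectors are compared through the sign of a difference of moments instead of the moments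
  themselves; and the entry 1 of a scaled direction makes room for \<open>\<zeta>\<^sub>t\<close>.
\<close>

section \<open>Log-convex sequences and the power method\<close>

text \<open>A random start would leave the power method with a failure probability. Instead every
  unit vector is tried: with M = diag(p)^-1 C, the squared Hilbert-Schmidt norm of M^q is the sum of
  the n start moments of order 2q, so the largest of them is at least 1/n of the squared operator
  norm, and taking a 2q-th root makes the factor n harmless.

  With \<eta> = \<epsilon>/4, every round adds at least 1 to the trace of X, so n ln(2n)/\<eta>^2
  rounds force max X_ii to at least ln(2n)/\<eta>^2, against which the logarithm of the initial
  potential n is negligible; ln(2n)/\<eta> power steps bring the Rayleigh quotient within a factor 1
  - \<eta>. Writing 2n inside the logarithms keeps them positive for n = 1.

  Padding only raises diagonal entries, where C is positive, so it cannot lower the objective.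
  Memory dictates the rest: weights, \<eta> and loop bounds are recomputed at every use, since a
  single stored scalar would need a cell beyond the three vectors.\<close>

lemma discriminant_le:
  fixes a b d :: real
  assumes "\<And>t. a + 2 * b * t + d * t\<^sup>2 \<ge> 0" and d: "d \<ge> 0"
  shows "b\<^sup>2 \<le> a * d"
proof (cases "d = 0")
  case True
  show ?thesis
  proof (cases "b = 0")
    case False
    \<comment> \<open>Without a quadratic term the form is affine; at the zero of
      \<open>a + 1 + 2 * b * t\<close> it would equal -1.\<close>
    have "a + 2 * b * (- (a + 1) / (2 * b)) = -1" using False by (simp add: field_simps)
    with assms(1)[of "- (a + 1) / (2 * b)"] True show ?thesis by simp
  qed (use True in simp)
next
  case False
  have "a + 2 * b * (- b / d) + d * (- b / d)\<^sup>2 = a - b\<^sup>2 / d"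
    using False by (simp add: field_simps power2_eq_square)
  with assms(1)[of "- b / d"] have "b\<^sup>2 / d \<le> a" by simp
  then show ?thesis using d False by (simp add: field_simps)
qed

context
  fixes a :: "nat \<Rightarrow> real"
  assumes a0: "a 0 > 0" and a1: "a 1 > 0"
    and log_convex: "\<And>k. (a (Suc k))\<^sup>2 \<le> a k * a (Suc (Suc k))"
begin

lemma log_convex_pos: "a k > 0 \<and> a (Suc k) > 0"
proof (induction k)
  case (Suc k)
  then have "0 < a k * a (Suc (Suc k))" using log_convex[of k] by (smt (verit) zero_less_power)
  with Suc show ?case by (simp add: zero_less_mult_iff)
qed (use a0 a1 in auto)

text \<open>Log-convexity divided by \<open>a k * a (Suc k)\<close> compares consecutive ratios. The
  two bounds that follow write \<open>a k\<close> as a product of ratios, each at least the first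
  or, respectively, at most the last.\<close>

lemma log_convex_ratio_mono: "i \<le> j \<Longrightarrow> a (Suc i) / a i \<le> a (Suc j) / a j"
proof (induction rule: dec_induct)
  case (step k)
  have "a (Suc k) / a k \<le> a (Suc (Suc k)) / a (Suc k)"
    using log_convex[of k] log_convex_pos[of k]
    by (simp add: divide_simps power2_eq_square mult.commute)
  with step.IH show ?case by simp
qed simp

lemma log_convex_lower: "(a 1 / a 0) ^ k * a 0 \<le> a k"
proof (induction k)
  case (Suc k)
  have "(a 1 / a 0) ^ Suc k * a 0 = (a 1 / a 0) * ((a 1 / a 0) ^ k * a 0)" by simp
  also have "\<dots> \<le> (a (Suc k) / a k) * a k"
    using Suc.IH log_convex_ratio_mono[of 0 k] a0 a1 log_convex_pos[of k]
    by (intro mult_mono) auto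
  finally show ?case using log_convex_pos[of k] by simp
qed simp

lemma log_convex_upper: "a k \<le> (a (Suc k) / a k) ^ k * a 0"
proof -
  have "a i \<le> (a (Suc k) / a k) ^ i * a 0" if "i \<le> k" for i
    using that
  proof (induction i)
    case (Suc i)
    have "a (Suc i) = (a (Suc i) / a i) * a i" using log_convex_pos[of i] by simp
    also have "\<dots> \<le> (a (Suc k) / a k) * ((a (Suc k) / a k) ^ i * a 0)"
      using Suc log_convex_ratio_mono[of i k] log_convex_pos[of k] log_convex_pos[of i]
      by (intro mult_mono) auto
    finally show ?case by simp
  qed simp
  then show ?thesis by blast
qed

end

text \<open>A left-to-right scan with strict improvement, so ties keep the earlier index. In this
  form the value after \<open>k\<close> entries is the loop invariant of the program, and the start
  value 0 is that of a reset register.\<close>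

primrec argmax_upto :: "(nat \<Rightarrow> real) \<Rightarrow> nat \<Rightarrow> nat" where
  "argmax_upto f 0 = 0"
| "argmax_upto f (Suc k) = (if f (argmax_upto f k) < f k then k else argmax_upto f k)"

lemma argmax_upto_less: "argmax_upto f k < k \<or> k = 0 \<and> argmax_upto f k = 0"
  by (induction k) auto

lemma argmax_upto_max: "i < k \<Longrightarrow> f i \<le> f (argmax_upto f k)"
  by (induction k) (force simp: less_Suc_eq)+

lemma exp_le_quadratic: "0 \<le> z \<Longrightarrow> z \<le> 1 \<Longrightarrow> exp z \<le> 1 + z + z\<^sup>2" for z :: real
  using exp_bound by (simp add: power2_eq_square)

section \<open>Diagonally dominant forms and the operator diag(p)^-1 C\<close>

locale dd_matrix =
  fixes n :: nat and c :: "nat \<Rightarrow> nat \<Rightarrow> real"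
  assumes n_pos: "n \<ge> 1"
    and sym: "\<And>i j. i < n \<Longrightarrow> j < n \<Longrightarrow> c i j = c j i"
    and dom: "\<And>i. i < n \<Longrightarrow> (\<Sum>j\<in>{..<n} - {i}. \<bar>c i j\<bar>) \<le> c i i"
    and diag_pos: "\<And>i. i < n \<Longrightarrow> c i i > 0"
begin

definition bf :: "(nat \<Rightarrow> real) \<Rightarrow> (nat \<Rightarrow> real) \<Rightarrow> real" where
  "bf x y = (\<Sum>i<n. \<Sum>j<n. c i j * x i * y j)"

text \<open>The inner product for which \<open>scaled_mult p\<close> is self-adjoint: the weights
  cancel the division by \<open>p\<close> and leave the symmetric form \<open>bf\<close>.\<close>

definition ip :: "(nat \<Rightarrow> real) \<Rightarrow> (nat \<Rightarrow> real) \<Rightarrow> (nat \<Rightarrow> real) \<Rightarrow> real" where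
  "ip p x y = (\<Sum>i<n. p i * x i * y i)"

definition scaled_mult :: "(nat \<Rightarrow> real) \<Rightarrow> (nat \<Rightarrow> real) \<Rightarrow> nat \<Rightarrow> real" where
  "scaled_mult p x i = (\<Sum>j<n. c i j * x j) / p i"

text \<open>The factor \<open>1 / sqrt (p j)\<close> makes these vectors an orthonormal basis for
  \<open>ip p\<close>.\<close>

definition unit_at :: "(nat \<Rightarrow> real) \<Rightarrow> nat \<Rightarrow> nat \<Rightarrow> real" where
  "unit_at p j i = (if i = j then 1 / sqrt (p j) else 0)"

lemma bf_sym: "bf x y = bf y x"
  unfolding bf_def by (subst sum.swap) (auto intro!: sum.cong simp: sym)

text \<open>Each off-diagonal term is at least
  \<open>- \<bar>c i j\<bar> * ((x i)\<^sup>2 + (x j)\<^sup>2) / 2\<close>. By symmetry both squares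
  contribute equally, so row \<open>i\<close> loses at most its off-diagonal absolute sum times
  \<open>(x i)\<^sup>2\<close>, which the diagonal entry covers.\<close>

lemma bf_nonneg: "bf x x \<ge> 0"
proof -
  have "bf x x = (\<Sum>i<n. c i i * (x i)\<^sup>2) + (\<Sum>i<n. \<Sum>j\<in>{..<n} - {i}. c i j * x i * x j)"
    unfolding bf_def sum.distrib[symmetric]
    by (intro sum.cong refl) (simp add: sum.remove[of "{..<n}"] power2_eq_square)
  moreover have "(\<Sum>i<n. \<Sum>j\<in>{..<n} - {i}. c i j * x i * x j)
      \<ge> (\<Sum>i<n. \<Sum>j\<in>{..<n} - {i}. - (\<bar>c i j\<bar> * (x i)\<^sup>2 / 2) - \<bar>c i j\<bar> * (x j)\<^sup>2 / 2)"
  proof (intro sum_mono)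
    fix i j
    have "0 \<le> \<bar>c i j\<bar> * (\<bar>x i\<bar> - \<bar>x j\<bar>)\<^sup>2" by simp
    then have "\<bar>c i j * x i * x j\<bar> \<le> \<bar>c i j\<bar> * (x i)\<^sup>2 / 2 + \<bar>c i j\<bar> * (x j)\<^sup>2 / 2"
      by (simp add: power2_eq_square algebra_simps abs_mult)
    then show "c i j * x i * x j \<ge> - (\<bar>c i j\<bar> * (x i)\<^sup>2 / 2) - \<bar>c i j\<bar> * (x j)\<^sup>2 / 2"
      by linarith
  qed
  moreover have "(\<Sum>i<n. \<Sum>j\<in>{..<n} - {i}. \<bar>c i j\<bar> * (x j)\<^sup>2 / 2)
      = (\<Sum>i<n. \<Sum>j\<in>{..<n} - {i}. \<bar>c i j\<bar> * (x i)\<^sup>2 / 2)"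
  proof -
    \<comment> \<open>A zero on the diagonal completes the index set to a square, so that the sums
      can be exchanged.\<close>
    have "(\<Sum>i<n. \<Sum>j\<in>{..<n} - {i}. \<bar>c i j\<bar> * (x j)\<^sup>2 / 2)
      = (\<Sum>i<n. \<Sum>j<n. if i = j then 0 else \<bar>c i j\<bar> * (x j)\<^sup>2 / 2)"
      by (intro sum.cong refl sum.mono_neutral_cong_left) auto
    also have "\<dots> = (\<Sum>j<n. \<Sum>i<n. if i = j then 0 else \<bar>c i j\<bar> * (x j)\<^sup>2 / 2)"
      by (rule sum.swap)
    also have "\<dots> = (\<Sum>i<n. \<Sum>j\<in>{..<n} - {i}. \<bar>c i j\<bar> * (x i)\<^sup>2 / 2)"
      by (intro sum.cong refl sum.mono_neutral_cong_right) (auto simp: sym)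
    finally show ?thesis .
  qed
  moreover have "(\<Sum>i<n. (\<Sum>j\<in>{..<n} - {i}. \<bar>c i j\<bar>) * (x i)\<^sup>2) \<le> (\<Sum>i<n. c i i * (x i)\<^sup>2)"
    by (intro sum_mono mult_right_mono dom) auto
  moreover have "(\<Sum>i<n. (\<Sum>j\<in>{..<n} - {i}. \<bar>c i j\<bar>) * (x i)\<^sup>2)
      = 2 * (\<Sum>i<n. \<Sum>j\<in>{..<n} - {i}. \<bar>c i j\<bar> * (x i)\<^sup>2 / 2)"
    by (simp add: sum_distrib_left sum_distrib_right)
  ultimately show ?thesis by (simp add: sum_subtractf sum_negf)
qed

lemma bf_CS: "(bf x y)\<^sup>2 \<le> bf x x * bf y y"
proof (rule discriminant_le)
  fix t
  have "bf (\<lambda>i. x i + t * y i) (\<lambda>i. x i + t * y i) = bf x x + t * bf x y + t * bf y x + t\<^sup>2 * bf y y"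
    unfolding bf_def by (simp add: algebra_simps sum.distrib sum_distrib_left power2_eq_square)
  then show "0 \<le> bf x x + 2 * bf x y * t + bf y y * t\<^sup>2"
    using bf_nonneg[of "\<lambda>i. x i + t * y i"] bf_sym[of x y] by (simp add: algebra_simps)
qed (rule bf_nonneg)

lemma ip_sym: "ip p x y = ip p y x"
  by (simp add: ip_def mult_ac)

context
  fixes p :: "nat \<Rightarrow> real"
  assumes p_pos: "\<And>i. i < n \<Longrightarrow> p i > 0"
begin

lemma ip_nonneg: "ip p x x \<ge> 0"
  unfolding ip_def by (intro sum_nonneg) (simp add: p_pos less_imp_le mult.assoc)

lemma ip_CS: "(ip p x y)\<^sup>2 \<le> ip p x x * ip p y y"
proof (rule discriminant_le)
  fix t
  have "ip p (\<lambda>i. x i + t * y i) (\<lambda>i. x i + t * y i) = ip p x x + 2 * t * ip p x y + t\<^sup>2 * ip p y y"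
    unfolding ip_def by (simp add: algebra_simps sum.distrib sum_distrib_left power2_eq_square)
  then show "0 \<le> ip p x x + 2 * ip p x y * t + ip p y y * t\<^sup>2"
    using ip_nonneg[of "\<lambda>i. x i + t * y i"] by (simp add: algebra_simps)
qed (rule ip_nonneg)

lemma ip_scaled_mult: "ip p x (scaled_mult p y) = bf x y"
  unfolding ip_def bf_def scaled_mult_def
proof (intro sum.cong refl)
  fix i assume "i \<in> {..<n}"
  then have "p i \<noteq> 0" using p_pos[of i] by simp
  then have "p i * x i * ((\<Sum>j<n. c i j * y j) / p i) = x i * (\<Sum>j<n. c i j * y j)" by simp
  then show "p i * x i * ((\<Sum>j<n. c i j * y j) / p i) = (\<Sum>j<n. c i j * x i * y j)"
    by (simp add: sum_distrib_left mult_ac)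
qed

text \<open>Self-adjointness of \<open>scaled_mult p\<close>, moved across one factor at a time; it
  rests on the symmetry of \<open>bf\<close>.\<close>

lemma ip_pow: "ip p ((scaled_mult p ^^ k) x) y = ip p x ((scaled_mult p ^^ k) y)"
proof (induction k arbitrary: y)
  case (Suc k)
  have "ip p ((scaled_mult p ^^ Suc k) x) y = bf ((scaled_mult p ^^ k) x) y"
    by (simp add: ip_sym[of _ _ y] ip_scaled_mult bf_sym[of y])
  also have "\<dots> = ip p ((scaled_mult p ^^ k) x) (scaled_mult p y)" by (simp add: ip_scaled_mult)
  also have "\<dots> = ip p x ((scaled_mult p ^^ k) (scaled_mult p y))" by (rule Suc.IH)
  finally show ?case by (simp add: funpow_swap1)
qed simp

text \<open>The \<open>k\<close>-th moment of the spectral measure of \<open>x\<close>. Even moments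
  are squared norms of iterates and odd ones are values of the form, so the quotient of the moments
  \<open>2 * q + 1\<close> and \<open>2 * q\<close> is the Rayleigh quotient of the
  \<open>q\<close>-th iterate.\<close>

abbreviation moment :: "(nat \<Rightarrow> real) \<Rightarrow> nat \<Rightarrow> real" where
  "moment x k \<equiv> ip p x ((scaled_mult p ^^ k) x)"

lemma moment_even: "moment x (2 * k) = ip p ((scaled_mult p ^^ k) x) ((scaled_mult p ^^ k) x)"
  by (simp add: ip_pow mult_2 funpow_add)

lemma moment_odd: "moment x (Suc (2 * k)) = bf ((scaled_mult p ^^ k) x) ((scaled_mult p ^^ k) x)"
proof -
  have "bf ((scaled_mult p ^^ k) x) ((scaled_mult p ^^ k) x)
      = ip p ((scaled_mult p ^^ k) x) ((scaled_mult p ^^ Suc k) x)"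
    by (simp add: ip_scaled_mult)
  also have "\<dots> = ip p x ((scaled_mult p ^^ k) ((scaled_mult p ^^ Suc k) x))" by (rule ip_pow)
  also have "(scaled_mult p ^^ k) ((scaled_mult p ^^ Suc k) x) = (scaled_mult p ^^ (k + Suc k)) x"
    by (simp only: funpow_add o_apply)
  finally show ?thesis by (simp add: mult_2)
qed

text \<open>Cauchy-Schwarz for neighbouring iterates: in the inner product \<open>ip p\<close> for
  even \<open>k\<close>, in the semidefinite form \<open>bf\<close> for odd
  \<open>k\<close>.\<close>

lemma moment_log_convex: "(moment x (Suc k))\<^sup>2 \<le> moment x k * moment x (Suc (Suc k))"
proof (cases "even k")
  case True
  then obtain l where k: "k = 2 * l" by blast
  have "moment x (Suc k) = ip p ((scaled_mult p ^^ l) x) ((scaled_mult p ^^ Suc l) x)"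
    unfolding k moment_odd by (simp add: ip_scaled_mult)
  then have "(moment x (Suc k))\<^sup>2 \<le> moment x (2 * l) * moment x (2 * Suc l)"
    unfolding moment_even using ip_CS by simp
  then show ?thesis by (simp add: k)
next
  case False
  then obtain l where k: "k = Suc (2 * l)" using oddE by fastforce
  have "moment x (Suc k) = moment x (2 * Suc l)" by (simp add: k)
  also have "\<dots> = ip p ((scaled_mult p ^^ Suc l) x) (scaled_mult p ((scaled_mult p ^^ l) x))"
    unfolding moment_even by simp
  also have "\<dots> = bf ((scaled_mult p ^^ Suc l) x) ((scaled_mult p ^^ l) x)"
    by (rule ip_scaled_mult)
  finally have "(moment x (Suc k))\<^sup>2 \<le> moment x (Suc (2 * Suc l)) * moment x (Suc (2 * l))"
    unfolding moment_odd using bf_CS by simp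
  then show ?thesis by (simp add: k mult.commute)
qed

lemma ip_unit: "i < n \<Longrightarrow> ip p x (unit_at p i) = x i * sqrt (p i)"
proof -
  assume i: "i < n"
  have "ip p x (unit_at p i) = (\<Sum>k<n. if k = i then p i * x i / sqrt (p i) else 0)"
    unfolding ip_def by (intro sum.cong) (auto simp: unit_at_def)
  also have "\<dots> = p i * x i / sqrt (p i)" using i by simp
  also have "\<dots> = x i * sqrt (p i)"
    using real_sqrt_mult_self[of "p i"] p_pos[OF i] by (simp add: field_simps)
  finally show ?thesis .
qed

lemma ip_unit_self: "i < n \<Longrightarrow> ip p (unit_at p i) (unit_at p i) = 1"
  by (simp add: ip_unit) (use p_pos[of i] in \<open>simp add: unit_at_def\<close>)

lemma bf_unit_self: "i < n \<Longrightarrow> bf (unit_at p i) (unit_at p i) = c i i / p i"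
proof -
  assume i: "i < n"
  have "bf (unit_at p i) (unit_at p i) = (\<Sum>k<n. if k = i then \<Sum>j<n. if j = i then c i i / p i else 0 else 0)"
    unfolding bf_def
    by (intro sum.cong refl)
       (use p_pos[of i] i in \<open>auto simp: unit_at_def if_distrib cong: if_cong intro!: sum.cong\<close>)
  also have "\<dots> = c i i / p i" using i by simp
  finally show ?thesis .
qed

lemma parseval: "ip p x x = (\<Sum>k<n. (ip p x (unit_at p k))\<^sup>2)"
  unfolding ip_def[of p x x]
  by (intro sum.cong refl) (use p_pos in \<open>auto simp: ip_unit power_mult_distrib power2_eq_square less_imp_le\<close>)

text \<open>The Hilbert--Schmidt norm of the power dominates its operator norm.\<close>

lemma moment_le_sum_units:
  "moment u (2 * q) \<le> ip p u u * (\<Sum>k<n. moment (unit_at p k) (2 * q))"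
proof -
  have "moment u (2 * q) = (\<Sum>k<n. (ip p u ((scaled_mult p ^^ q) (unit_at p k)))\<^sup>2)"
    unfolding moment_even by (subst parseval) (simp only: ip_pow)
  also have "\<dots> \<le> (\<Sum>k<n. ip p u u * moment (unit_at p k) (2 * q))"
    unfolding moment_even by (intro sum_mono ip_CS)
  finally show ?thesis by (simp add: sum_distrib_left)
qed

text \<open>The cross terms cancel by symmetry, so one power iteration compares two moments without storing
  either.\<close>

lemma tournament_test:
  fixes k assumes "b < n" "j < n"
  defines "x \<equiv> (scaled_mult p ^^ k) (\<lambda>i. unit_at p b i - unit_at p j i)"
  shows "x b * sqrt (p b) + x j * sqrt (p j) = moment (unit_at p b) k - moment (unit_at p j) k"
proof -
  have lin: "ip p (\<lambda>i. y i - z i) w = ip p y w - ip p z w" for y z w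
    by (simp add: ip_def algebra_simps sum_subtractf)
  \<comment> \<open>A coordinate times the root of its weight is the inner product with a basis
    vector, so two cells of one iterate suffice for the test.\<close>
  have "x b * sqrt (p b) + x j * sqrt (p j) = ip p x (unit_at p b) + ip p x (unit_at p j)"
    using assms by (simp add: ip_unit)
  also have "\<dots> = ip p (unit_at p b) ((scaled_mult p ^^ k) (unit_at p b)) - ip p (unit_at p j) ((scaled_mult p ^^ k) (unit_at p b))
     + (ip p (unit_at p b) ((scaled_mult p ^^ k) (unit_at p j)) - ip p (unit_at p j) ((scaled_mult p ^^ k) (unit_at p j)))"
    unfolding x_def by (simp only: ip_pow lin)
  also have "ip p (unit_at p b) ((scaled_mult p ^^ k) (unit_at p j))
      = ip p (unit_at p j) ((scaled_mult p ^^ k) (unit_at p b))"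
    by (subst ip_sym) (rule ip_pow)
  finally show ?thesis by simp
qed

text \<open>Let \<open>r\<close> be the Rayleigh quotient of \<open>y\<close>. Log-convexity bounds
  the moment of order \<open>2 * q\<close> by \<open>r ^ (2 * q)\<close> from above for the best
  start, and by a power of the Rayleigh quotient of \<open>u\<close> from below for the competitor.
  The unit moments sum to at most \<open>n\<close> times the best one, so the quotients differ at
  most by the factor n^(1/(2q)), which the condition on \<open>q\<close> keeps below 1/(1 -
  \<delta>).\<close>

lemma power_method:
  assumes b: "b < n" and best: "\<And>j. j < n \<Longrightarrow> moment (unit_at p j) (2 * q) \<le> moment (unit_at p b) (2 * q)"
    and \<delta>: "0 < \<delta>" "\<delta> < 1" and q: "q \<ge> 1" "ln (real n) \<le> 2 * real q * \<delta>"
    and u: "bf u u > 0" "ip p u u > 0"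
  defines "y \<equiv> (scaled_mult p ^^ q) (unit_at p b)"
  shows "ip p y y > 0" "bf y y \<ge> (1 - \<delta>) * (bf u u / ip p u u) * ip p y y"
proof -
  let ?m = "moment (unit_at p b)" and ?\<mu> = "bf u u / ip p u u"
  have m0: "?m 0 = 1" and m1: "?m 1 > 0"
    using moment_odd[of "unit_at p b" 0] diag_pos[OF b] p_pos[OF b] b
    by (auto simp: ip_unit_self bf_unit_self)
  note b_facts = log_convex_pos[of ?m, OF _ m1 moment_log_convex]
    log_convex_upper[of ?m, OF _ m1 moment_log_convex]
  have pos: "?m (2 * q) > 0" using b_facts(1)[of "2 * q"] m0 by simp
  have yy: "ip p y y = ?m (2 * q)" "bf y y = ?m (Suc (2 * q))"
    unfolding y_def moment_even moment_odd by auto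
  show "ip p y y > 0" using pos yy by simp
  have mu: "?\<mu> > 0" using u by simp
  define r where "r = ?m (Suc (2 * q)) / ?m (2 * q)"
  have "?\<mu> ^ (2 * q) * ip p u u \<le> moment u (2 * q)"
    using log_convex_lower[of "moment u" "2 * q", OF _ _ moment_log_convex] u moment_odd[of u 0]
    by simp
  also have "\<dots> \<le> ip p u u * (\<Sum>k<n. moment (unit_at p k) (2 * q))" by (rule moment_le_sum_units)
  also have "(\<Sum>k<n. moment (unit_at p k) (2 * q)) \<le> real n * ?m (2 * q)"
    using sum_bounded_above[of "{..<n}" "\<lambda>k. moment (unit_at p k) (2 * q)"] best by simp
  finally have "?\<mu> ^ (2 * q) \<le> real n * ?m (2 * q)" using u by (simp add: mult.commute)
  also have "?m (2 * q) \<le> r ^ (2 * q)" unfolding r_def using b_facts(2)[of "2 * q"] m0 by simp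
  finally have mun: "?\<mu> ^ (2 * q) \<le> real n * r ^ (2 * q)" using n_pos by simp
  have r0: "r \<ge> 0" unfolding r_def using yy bf_nonneg[of y] pos by simp
  have "(1 - \<delta>) * ?\<mu> \<le> r"
  proof (rule ccontr)
    assume *: "\<not> (1 - \<delta>) * ?\<mu> \<le> r"
    have "real n * r ^ (2 * q) < real n * ((1 - \<delta>) * ?\<mu>) ^ (2 * q)"
      using * r0 q n_pos by (intro mult_strict_left_mono power_strict_mono) auto
    also have "\<dots> = (real n * (1 - \<delta>) ^ (2 * q)) * ?\<mu> ^ (2 * q)"
      by (simp only: power_mult_distrib mult.assoc)
    also have "\<dots> \<le> 1 * ?\<mu> ^ (2 * q)"
    proof (intro mult_right_mono)
      have "(1 - \<delta>) ^ (2 * q) \<le> exp (- \<delta>) ^ (2 * q)"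
        using \<delta> exp_ge_add_one_self[of "- \<delta>"] by (intro power_mono) auto
      also have "\<dots> = exp (- (2 * real q * \<delta>))" by (simp add: exp_of_nat_mult[symmetric] algebra_simps)
      also have "\<dots> \<le> exp (- ln (real n))" using q by simp
      also have "\<dots> = 1 / real n" using n_pos by (simp add: exp_minus field_simps)
      finally show "real n * (1 - \<delta>) ^ (2 * q) \<le> 1" using n_pos by (simp add: field_simps)
    qed (use mu in auto)
    finally show False using mun by simp
  qed
  then show "bf y y \<ge> (1 - \<delta>) * ?\<mu> * ip p y y"
    unfolding yy r_def using pos by (simp add: pos_le_divide_eq)
qed

end

section \<open>Multiplicative weights for the packing problem\<close>

lemma argmax_less: "argmax_upto f n < n"
  using argmax_upto_less[of f n] n_pos by auto

definition weight :: "real \<Rightarrow> (nat \<Rightarrow> real) \<Rightarrow> nat \<Rightarrow> real" where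
  "weight \<eta> v i = exp (\<eta> * v i)"

definition best_start :: "(nat \<Rightarrow> real) \<Rightarrow> nat \<Rightarrow> nat" where
  "best_start p q = argmax_upto (\<lambda>j. ip p (unit_at p j) ((scaled_mult p ^^ (2 * q)) (unit_at p j))) n"

definition power_vec :: "(nat \<Rightarrow> real) \<Rightarrow> nat \<Rightarrow> nat \<Rightarrow> real" where
  "power_vec p q = (scaled_mult p ^^ q) (unit_at p (best_start p q))"

text \<open>Squares replace absolute values, so that the program compares entries with one
  multiplication each.\<close>

definition pivot :: "(nat \<Rightarrow> real) \<Rightarrow> nat \<Rightarrow> nat" where
  "pivot p q = argmax_upto (\<lambda>i. (power_vec p q i)\<^sup>2) n"

text \<open>The pivot entry is the literal 1 and not a quotient, in line with the program, which
  must not overwrite the pivot cell while other coordinates are still to be divided by it.\<close>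

definition direction :: "(nat \<Rightarrow> real) \<Rightarrow> nat \<Rightarrow> nat \<Rightarrow> real" where
  "direction p q i = (if i = pivot p q then 1 else power_vec p q i / power_vec p q (pivot p q))"

text \<open>A direction depends on earlier rounds only through the current diagonal, so the
  recursion closes on \<open>n\<close> numbers although a whole matrix is being accumulated.\<close>

primrec diagonal :: "real \<Rightarrow> nat \<Rightarrow> nat \<Rightarrow> nat \<Rightarrow> real" where
  "diagonal \<eta> q 0 = (\<lambda>i. 0)"
| "diagonal \<eta> q (Suc t) =
     (\<lambda>i. diagonal \<eta> q t i + (direction (weight \<eta> (diagonal \<eta> q t)) q i)\<^sup>2)"

definition update_vec :: "real \<Rightarrow> nat \<Rightarrow> nat \<Rightarrow> nat \<Rightarrow> real" where
  "update_vec \<eta> q t = direction (weight \<eta> (diagonal \<eta> q t)) q"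

lemma diagonal_eq_sum: "diagonal \<eta> q t i = (\<Sum>s<t. (update_vec \<eta> q s i)\<^sup>2)"
  by (induction t) (auto simp: update_vec_def)

lemma weight_pos: "weight \<eta> v i > 0"
  by (simp add: weight_def)

context
  fixes \<delta> :: real and q :: nat
  assumes \<delta>: "0 < \<delta>" "\<delta> < 1" and q: "q \<ge> 1" "ln (real n) \<le> 2 * real q * \<delta>"
begin

text \<open>The power method is compared with a sign vector \<open>u\<close>, for which
  \<open>ip p u u\<close> is the sum of the weights. Both sides of the resulting inequality are
  quadratic in the direction, so dividing by the pivot entry preserves it.\<close>

lemma direction_good:
  assumes p: "\<And>i. i < n \<Longrightarrow> p i > 0" and u: "bf u u > 0" "\<And>i. i < n \<Longrightarrow> (u i)\<^sup>2 = 1"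
  defines "y \<equiv> direction p q"
  shows "bf y y \<ge> (1 - \<delta>) * (bf u u / (\<Sum>i<n. p i)) * (\<Sum>i<n. p i * (y i)\<^sup>2)"
    and "\<And>i. i < n \<Longrightarrow> (y i)\<^sup>2 \<le> 1" and "y (pivot p q) = 1"
proof -
  define x where "x = power_vec p q"
  have uu: "ip p u u = (\<Sum>i<n. p i)"
    unfolding ip_def by (intro sum.cong refl) (use u(2) in \<open>simp add: power2_eq_square mult.assoc\<close>)
  have "(\<Sum>i<n. p i) > 0" using p n_pos by (intro sum_pos) (auto simp: lessThan_empty_iff)
  then have uu_pos: "ip p u u > 0" using uu by simp
  have best: "ip p (unit_at p j) ((scaled_mult p ^^ (2 * q)) (unit_at p j))
      \<le> ip p (unit_at p (best_start p q)) ((scaled_mult p ^^ (2 * q)) (unit_at p (best_start p q)))"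
    if "j < n" for j
    unfolding best_start_def
    by (rule argmax_upto_max[OF that, of "\<lambda>j. ip p (unit_at p j) ((scaled_mult p ^^ (2 * q)) (unit_at p j))"])
  have b: "best_start p q < n" unfolding best_start_def by (rule argmax_less)
  have x: "ip p x x > 0" "bf x x \<ge> (1 - \<delta>) * (bf u u / ip p u u) * ip p x x"
    using power_method[OF p b best \<delta> q u(1) uu_pos] unfolding x_def power_vec_def by auto
  define j where "j = pivot p q"
  have max: "(x i)\<^sup>2 \<le> (x j)\<^sup>2" if "i < n" for i
    unfolding j_def pivot_def x_def by (rule argmax_upto_max[OF that, of "\<lambda>i. (power_vec p q i)\<^sup>2"])
  have xj: "x j \<noteq> 0"
  proof
    assume "x j = 0"
    then have "\<forall>i<n. x i = 0" using max by fastforce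
    then have "ip p x x = 0" by (simp add: ip_def)
    with x show False by simp
  qed
  have y: "y = (\<lambda>i. x i / x j)"
    using xj by (auto simp: y_def direction_def x_def j_def)
  show "(y i)\<^sup>2 \<le> 1" if "i < n" for i
    using max[OF that] xj by (simp add: y power_divide)
  show "y (pivot p q) = 1" using xj by (simp add: y j_def)
  have "bf y y = bf x x / (x j)\<^sup>2"
    unfolding bf_def y by (simp add: sum_divide_distrib power2_eq_square)
  moreover have "(\<Sum>i<n. p i * (y i)\<^sup>2) = ip p x x / (x j)\<^sup>2"
    unfolding ip_def y by (simp add: sum_divide_distrib power2_eq_square mult.assoc)
  ultimately show "bf y y \<ge> (1 - \<delta>) * (bf u u / (\<Sum>i<n. p i)) * (\<Sum>i<n. p i * (y i)\<^sup>2)"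
    using divide_right_mono[OF x(2), of "(x j)\<^sup>2"] uu by simp
qed

text \<open>In each round the exponential is bounded by a quadratic polynomial, the weighted sum of
  squares is bounded through \<open>bf y y\<close> by the choice of the direction, and
  \<open>1 + x \<le> exp x\<close> turns the growth factor back into an exponential, so that all
  rounds collect in one exponent.\<close>

lemma potential_bound:
  assumes \<eta>: "0 < \<eta>" "\<eta> \<le> 1" and u: "bf u u > 0" "\<And>i. i < n \<Longrightarrow> (u i)\<^sup>2 = 1"
  shows "(\<Sum>i<n. weight \<eta> (diagonal \<eta> q t) i)
    \<le> real n * exp ((\<eta> + \<eta>\<^sup>2) / ((1 - \<delta>) * bf u u) * (\<Sum>s<t. bf (update_vec \<eta> q s) (update_vec \<eta> q s)))"
proof (induction t)
  case (Suc t)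
  define p where "p = weight \<eta> (diagonal \<eta> q t)"
  define y where "y = update_vec \<eta> q t"
  define \<Phi> where "\<Phi> = (\<Sum>i<n. p i)"
  define \<kappa> where "\<kappa> = (\<eta> + \<eta>\<^sup>2) / ((1 - \<delta>) * bf u u)"
  have p: "p i > 0" for i by (simp add: p_def weight_pos)
  have \<Phi>: "\<Phi> > 0" unfolding \<Phi>_def using p n_pos by (intro sum_pos) (auto simp: lessThan_empty_iff)
  have y1: "(1 - \<delta>) * (bf u u / \<Phi>) * (\<Sum>i<n. p i * (y i)\<^sup>2) \<le> bf y y"
    and y2: "\<And>i. i < n \<Longrightarrow> (y i)\<^sup>2 \<le> 1"
    using direction_good(1,2)[OF p u] unfolding y_def p_def update_vec_def \<Phi>_def by auto
  have "(\<Sum>i<n. weight \<eta> (diagonal \<eta> q (Suc t)) i) = (\<Sum>i<n. p i * exp (\<eta> * (y i)\<^sup>2))"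
    by (simp add: weight_def p_def y_def update_vec_def algebra_simps exp_add)
  also have "\<dots> \<le> (\<Sum>i<n. p i * (1 + (\<eta> + \<eta>\<^sup>2) * (y i)\<^sup>2))"
  proof (intro sum_mono mult_left_mono)
    fix i assume "i \<in> {..<n}"
    then have *: "(y i)\<^sup>2 \<le> 1" using y2 by simp
    have "exp (\<eta> * (y i)\<^sup>2) \<le> 1 + \<eta> * (y i)\<^sup>2 + (\<eta> * (y i)\<^sup>2)\<^sup>2"
      using \<eta> * by (intro exp_le_quadratic) (auto intro: mult_le_one)
    \<comment> \<open>The fourth power drops to a square because the direction is scaled to maximal
      entry 1.\<close>
    also have "(\<eta> * (y i)\<^sup>2)\<^sup>2 \<le> \<eta>\<^sup>2 * (y i)\<^sup>2"
      using * \<eta> mult_left_le[of "(y i)\<^sup>2" "(y i)\<^sup>2"]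
      by (simp add: power_mult_distrib power2_eq_square[of "(y i)\<^sup>2"])
    finally show "exp (\<eta> * (y i)\<^sup>2) \<le> 1 + (\<eta> + \<eta>\<^sup>2) * (y i)\<^sup>2" by (simp add: algebra_simps)
  qed (use p in \<open>auto intro: less_imp_le\<close>)
  also have "\<dots> = \<Phi> + (\<eta> + \<eta>\<^sup>2) * (\<Sum>i<n. p i * (y i)\<^sup>2)"
    by (simp add: \<Phi>_def algebra_simps sum.distrib sum_distrib_left)
  also have "\<dots> \<le> \<Phi> + (\<eta> + \<eta>\<^sup>2) * (\<Phi> * (bf y y / ((1 - \<delta>) * bf u u)))"
    using y1 \<Phi> u(1) \<delta> \<eta> by (intro add_left_mono mult_left_mono) (auto simp: field_simps)
  also have "\<dots> = \<Phi> * (1 + \<kappa> * bf y y)"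
    by (simp add: \<kappa>_def algebra_simps)
  also have "\<dots> \<le> \<Phi> * exp (\<kappa> * bf y y)"
    using \<Phi> exp_ge_add_one_self by (intro mult_left_mono) auto
  also have "\<dots> \<le> real n * exp (\<kappa> * (\<Sum>s<t. bf (update_vec \<eta> q s) (update_vec \<eta> q s))) * exp (\<kappa> * bf y y)"
    using Suc.IH unfolding \<Phi>_def p_def \<kappa>_def by (intro mult_right_mono) auto
  also have "\<dots> = real n * exp (\<kappa> * (\<Sum>s<Suc t. bf (update_vec \<eta> q s) (update_vec \<eta> q s)))"
    by (simp add: y_def algebra_simps exp_add)
  finally show ?case by (simp only: \<kappa>_def)
qed (simp add: weight_def)

text \<open>Every direction has a pivot entry 1, so each round raises the trace by at least 1, and
  the largest of \<open>n\<close> entries is at least the average.\<close>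

lemma diagonal_max_lower:
  assumes u: "bf u u > 0" "\<And>i. i < n \<Longrightarrow> (u i)\<^sup>2 = 1"
  shows "real t \<le> real n * diagonal \<eta> q t (argmax_upto (diagonal \<eta> q t) n)"
proof -
  have "real t \<le> (\<Sum>i<n. diagonal \<eta> q t i)"
  proof (induction t)
    case (Suc t)
    let ?p = "weight \<eta> (diagonal \<eta> q t)"
    have "pivot ?p q < n" unfolding pivot_def by (rule argmax_less)
    then have "(direction ?p q (pivot ?p q))\<^sup>2 \<le> (\<Sum>i<n. (direction ?p q i)\<^sup>2)"
      by (intro member_le_sum) auto
    then have "1 \<le> (\<Sum>i<n. (direction ?p q i)\<^sup>2)"
      using direction_good(3)[OF weight_pos u] by simp
    then show ?case using Suc by (simp add: sum.distrib)
  qed simp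
  also have "\<dots> \<le> real n * diagonal \<eta> q t (argmax_upto (diagonal \<eta> q t) n)"
    using sum_bounded_above[of "{..<n}" "diagonal \<eta> q t"] argmax_upto_max by simp
  finally show ?thesis .
qed

end

text \<open>The width-independent analysis of Garg and Koenemann, with the sum of the weights as potential.\<close>

lemma approximate_solution:
  assumes \<epsilon>: "0 < \<epsilon>" "\<epsilon> < 1" and \<eta>: "\<eta> = \<epsilon> / 4"
    and q: "real q \<ge> ln (2 * real n) / \<eta>" and T: "real T \<ge> real n * ln (2 * real n) / \<eta>\<^sup>2"
    and u: "bf u u > 0" "\<And>i. i < n \<Longrightarrow> (u i)\<^sup>2 = 1"
  defines "vmax \<equiv> diagonal \<eta> q T (argmax_upto (diagonal \<eta> q T) n)"
  shows "vmax > 0" and "(\<Sum>t<T. bf (update_vec \<eta> q t) (update_vec \<eta> q t)) \<ge> (1 - \<epsilon>) * bf u u * vmax"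
proof -
  have eta: "0 < \<eta>" "\<eta> < 1" using \<epsilon> \<eta> by auto
  have ln: "ln (2 * real n) > 0" "ln (real n) \<le> ln (2 * real n)" "ln (real n) \<ge> 0" using n_pos by auto
  have "0 < ln (2 * real n) / \<eta>" using ln eta by simp
  then have q1: "q \<ge> 1" using q by (cases q) auto
  have "ln (2 * real n) \<le> real q * \<eta>" using q eta by (simp add: field_simps)
  moreover have "real q * \<eta> \<ge> 0" using eta by simp
  ultimately have q2: "ln (real n) \<le> 2 * real q * \<eta>" using ln by linarith
  have "real T \<le> real n * vmax"
    unfolding vmax_def by (rule diagonal_max_lower[OF eta q1 q2 u])
  with T have "real n * (ln (2 * real n) / \<eta>\<^sup>2) \<le> real n * vmax" by simp
  then have v: "ln (2 * real n) / \<eta>\<^sup>2 \<le> vmax"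
    using n_pos by (simp only: mult_le_cancel_left_pos of_nat_0_less_iff)
  moreover have "0 < ln (2 * real n) / \<eta>\<^sup>2" using ln eta by simp
  ultimately show v0: "vmax > 0" by linarith
  define S where "S = (\<Sum>t<T. bf (update_vec \<eta> q t) (update_vec \<eta> q t))"
  define \<kappa> where "\<kappa> = (\<eta> + \<eta>\<^sup>2) / ((1 - \<eta>) * bf u u)"
  define m where "m = argmax_upto (diagonal \<eta> q T) n"
  have "exp (\<eta> * vmax) = weight \<eta> (diagonal \<eta> q T) m"
    by (simp add: weight_def vmax_def m_def)
  also have "\<dots> \<le> (\<Sum>i<n. weight \<eta> (diagonal \<eta> q T) i)"
    using argmax_less weight_pos by (intro member_le_sum) (auto simp: m_def intro: less_imp_le)
  also have "\<dots> \<le> real n * exp (\<kappa> * S)"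
    unfolding \<kappa>_def S_def using eta by (intro potential_bound[OF eta q1 q2 _ _ u]) auto
  also have "\<dots> = exp (ln (real n) + \<kappa> * S)" using n_pos by (simp add: exp_add)
  \<comment> \<open>Logarithms are taken of the fact that the largest single weight is at most the
    whole potential.\<close>
  finally have "\<eta> * vmax \<le> ln (real n) + \<kappa> * S" by simp
  \<comment> \<open>The number of rounds is chosen for this: the initial \<open>ln (real n)\<close>
    becomes an error of relative size \<eta> compared with \<open>\<eta> * vmax\<close>.\<close>
  moreover have "ln (2 * real n) \<le> \<eta>\<^sup>2 * vmax" using v eta by (simp add: field_simps)
  ultimately have "\<eta> * vmax - \<eta>\<^sup>2 * vmax \<le> \<kappa> * S" using ln by linarith
  then have "\<eta> * ((1 - \<eta>) * vmax) \<le> \<eta> * ((1 + \<eta>) / ((1 - \<eta>) * bf u u) * S)"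
    by (simp add: \<kappa>_def power2_eq_square algebra_simps add_divide_distrib)
  then have "(1 - \<eta>) * vmax \<le> (1 + \<eta>) / ((1 - \<eta>) * bf u u) * S"
    using eta by (simp only: mult_le_cancel_left_pos)
  then have *: "(1 - \<eta>) * (1 - \<eta>) * bf u u * vmax \<le> (1 + \<eta>) * S"
    using eta u(1) by (simp add: field_simps)
  \<comment> \<open>With \<epsilon> = 4\<eta> the left side is 1 - 3\<eta> - 4\<eta>^2 and the right
    side 1 - 2\<eta> + \<eta>^2.\<close>
  have "(1 - \<epsilon>) * (1 + \<eta>) \<le> (1 - \<eta>) * (1 - \<eta>)"
    unfolding \<eta> using \<epsilon> by (simp add: field_simps)
  then have "(1 - \<epsilon>) * (1 + \<eta>) * (bf u u * vmax) \<le> (1 - \<eta>) * (1 - \<eta>) * (bf u u * vmax)"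
    using u(1) v0 by (intro mult_right_mono) auto
  with * have "(1 + \<eta>) * ((1 - \<epsilon>) * bf u u * vmax) \<le> (1 + \<eta>) * S" by (simp add: mult_ac)
  then show "(1 - \<epsilon>) * bf u u * vmax \<le> S" using eta by simp
qed

end

section \<open>Signs of linear forms in Gaussian variables\<close>

interpretation std_normal: prob_space std_normal_distribution
  by (rule prob_space_normal_density) simp

interpretation gauss_seq: sequence_space std_normal_distribution
  by unfold_locales

lemma gaussians_eq: "gaussians = gauss_seq.S"
  by (simp add: gaussians_def)

interpretation gaussians: prob_space gaussians
  unfolding gaussians_eq by unfold_locales

lemma measurable_gaussians_component [measurable]: "(\<lambda>\<omega>. \<omega> i) \<in> borel_measurable gaussians"
proof -
  have "(\<lambda>\<omega>. \<omega> i) \<in> measurable gaussians std_normal_distribution"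
    unfolding gaussians_def by measurable
  then show ?thesis by (simp cong: measurable_cong_sets)
qed

section \<open>Rotation invariance of a pair of independent normals\<close>

lemma nn_integral_lborel_shear:
  fixes f :: "real \<times> real \<Rightarrow> ennreal"
  assumes [measurable]: "f \<in> borel_measurable (borel \<Otimes>\<^sub>M borel)"
  shows "(\<integral>\<^sup>+x. \<integral>\<^sup>+y. f (x, y + t * x) \<partial>lborel \<partial>lborel) = (\<integral>\<^sup>+x. \<integral>\<^sup>+y. f (x, y) \<partial>lborel \<partial>lborel)"
    and "(\<integral>\<^sup>+x. \<integral>\<^sup>+y. f (x + t * y, y) \<partial>lborel \<partial>lborel) = (\<integral>\<^sup>+x. \<integral>\<^sup>+y. f (x, y) \<partial>lborel \<partial>lborel)"
proof -
  \<comment> \<open>With the other coordinate frozen, a shear is a translation of the line; in the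
    second case Fubini first brings the sheared variable inside.\<close>
  have transl: "(\<integral>\<^sup>+y. g (y + a) \<partial>lborel) = (\<integral>\<^sup>+y. g y \<partial>lborel)"
    if "g \<in> borel_measurable borel" for g :: "real \<Rightarrow> ennreal" and a
    using nn_integral_real_affine[OF that, of 1 a] by (simp add: add.commute)
  show "(\<integral>\<^sup>+x. \<integral>\<^sup>+y. f (x, y + t * x) \<partial>lborel \<partial>lborel) = (\<integral>\<^sup>+x. \<integral>\<^sup>+y. f (x, y) \<partial>lborel \<partial>lborel)"
    by (intro nn_integral_cong transl) measurable
  have "(\<integral>\<^sup>+x. \<integral>\<^sup>+y. f (x + t * y, y) \<partial>lborel \<partial>lborel) = (\<integral>\<^sup>+y. \<integral>\<^sup>+x. f (x + t * y, y) \<partial>lborel \<partial>lborel)"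
    by (rule lborel_pair.Fubini') measurable
  also have "\<dots> = (\<integral>\<^sup>+y. \<integral>\<^sup>+x. f (x, y) \<partial>lborel \<partial>lborel)"
    by (intro nn_integral_cong transl) measurable
  also have "\<dots> = (\<integral>\<^sup>+x. \<integral>\<^sup>+y. f (x, y) \<partial>lborel \<partial>lborel)"
    by (rule lborel_pair.Fubini') measurable
  finally show "(\<integral>\<^sup>+x. \<integral>\<^sup>+y. f (x + t * y, y) \<partial>lborel \<partial>lborel) = (\<integral>\<^sup>+x. \<integral>\<^sup>+y. f (x, y) \<partial>lborel \<partial>lborel)" .
qed

text \<open>A rotation other than the half turn is a product of three shears.\<close>

lemma nn_integral_lborel_rotate:
  fixes f :: "real \<times> real \<Rightarrow> ennreal"
  assumes [measurable]: "f \<in> borel_measurable (borel \<Otimes>\<^sub>M borel)" and cs: "c\<^sup>2 + s\<^sup>2 = 1" "c \<ge> 0"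
  shows "(\<integral>\<^sup>+x. \<integral>\<^sup>+y. f (c * x - s * y, s * x + c * y) \<partial>lborel \<partial>lborel)
    = (\<integral>\<^sup>+x. \<integral>\<^sup>+y. f (x, y) \<partial>lborel \<partial>lborel)"
proof (cases "s = 0")
  case True
  then have "c = 1" using cs by (simp add: power2_eq_1_iff)
  with True show ?thesis by simp
next
  case False
  \<comment> \<open>Minus the tangent of half the rotation angle: the shears with parameters
    \<open>t\<close>, \<open>s\<close> and \<open>t\<close> compose to the rotation.\<close>
  define t where "t = (c - 1) / s"
  have st: "1 + t * s = c" using False by (simp add: t_def)
  have "t * (1 + c) * s = (c - 1) * (1 + c)" using False by (simp add: t_def)
  also have "\<dots> = - s * s" using cs by (simp add: algebra_simps power2_eq_square)
  finally have "t * (1 + c) * s = - s * s" .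
  then have tc: "t * (1 + c) = - s" using False by (simp only: mult_cancel_right simp_thms)
  have e1: "s * (x + t * y) + y = s * x + c * y" for x y
    by (simp add: st[symmetric] algebra_simps)
  have e2: "x + t * y + t * (s * x + c * y) = c * x - s * y" for x y
  proof -
    have "x + t * y + t * (s * x + c * y) = (1 + t * s) * x + (t * (1 + c)) * y"
      by (simp add: algebra_simps)
    then show ?thesis by (simp only: st tc)
  qed
  have "(\<integral>\<^sup>+x. \<integral>\<^sup>+y. f (x, y) \<partial>lborel \<partial>lborel) = (\<integral>\<^sup>+x. \<integral>\<^sup>+y. f (x + t * y, y) \<partial>lborel \<partial>lborel)"
    by (rule nn_integral_lborel_shear(2)[symmetric]) measurable
  also have "\<dots> = (\<integral>\<^sup>+x. \<integral>\<^sup>+y. f (x + t * (y + s * x), y + s * x) \<partial>lborel \<partial>lborel)"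
    by (rule nn_integral_lborel_shear(1)[symmetric, where f = "\<lambda>(x, y). f (x + t * y, y)", simplified]) measurable
  also have "\<dots> = (\<integral>\<^sup>+x. \<integral>\<^sup>+y. f (x + t * y + t * (y + s * (x + t * y)), y + s * (x + t * y)) \<partial>lborel \<partial>lborel)"
    by (rule nn_integral_lborel_shear(2)[symmetric, where f = "\<lambda>(x, y). f (x + t * (y + s * x), y + s * x)", simplified]) measurable
  finally show ?thesis by (simp add: add.commute[of _ "s * _"] e1 e2)
qed

abbreviation N\<^sub>0 :: "real measure" where "N\<^sub>0 \<equiv> std_normal_distribution"

lemma nn_integral_std_normal_pair:
  fixes f :: "real \<times> real \<Rightarrow> ennreal"
  assumes [measurable]: "f \<in> borel_measurable (borel \<Otimes>\<^sub>M borel)"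
  shows "(\<integral>\<^sup>+x. \<integral>\<^sup>+y. f (x, y) \<partial>N\<^sub>0 \<partial>N\<^sub>0)
    = (\<integral>\<^sup>+x. \<integral>\<^sup>+y. ennreal (std_normal_density x * std_normal_density y) * f (x, y) \<partial>lborel \<partial>lborel)"
proof -
  have m: "(\<lambda>y. f (x, y)) \<in> borel_measurable borel" for x by measurable
  have "(\<integral>\<^sup>+x. \<integral>\<^sup>+y. f (x, y) \<partial>N\<^sub>0 \<partial>N\<^sub>0)
      = (\<integral>\<^sup>+x. ennreal (std_normal_density x) * (\<integral>\<^sup>+y. ennreal (std_normal_density y) * f (x, y) \<partial>lborel) \<partial>lborel)"
    by (subst nn_integral_density) (auto simp: nn_integral_density intro!: nn_integral_cong)
  also have "\<dots> = (\<integral>\<^sup>+x. \<integral>\<^sup>+y. ennreal (std_normal_density x * std_normal_density y) * f (x, y) \<partial>lborel \<partial>lborel)"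
    by (intro nn_integral_cong) (simp add: nn_integral_cmult[symmetric] ennreal_mult' mult.assoc)
  finally show ?thesis .
qed

text \<open>The joint density depends on \<open>x\<^sup>2 + y\<^sup>2\<close> only, so the
  invariance of Lebesgue measure carries over.\<close>

lemma nn_integral_std_normal_rotate:
  fixes f :: "real \<times> real \<Rightarrow> ennreal"
  assumes [measurable]: "f \<in> borel_measurable (borel \<Otimes>\<^sub>M borel)" and cs: "c\<^sup>2 + s\<^sup>2 = 1" "c \<ge> 0"
  shows "(\<integral>\<^sup>+x. \<integral>\<^sup>+y. f (c * x - s * y, s * x + c * y) \<partial>N\<^sub>0 \<partial>N\<^sub>0) = (\<integral>\<^sup>+x. \<integral>\<^sup>+y. f (x, y) \<partial>N\<^sub>0 \<partial>N\<^sub>0)"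
proof -
  have "(c * x - s * y)\<^sup>2 + (s * x + c * y)\<^sup>2 = (c\<^sup>2 + s\<^sup>2) * (x\<^sup>2 + y\<^sup>2)" for x y
    by (simp add: power2_eq_square algebra_simps)
  then have norm: "(c * x - s * y)\<^sup>2 + (s * x + c * y)\<^sup>2 = x\<^sup>2 + y\<^sup>2" for x y
    by (simp add: cs)
  have "std_normal_density x * std_normal_density y = exp (- (x\<^sup>2 + y\<^sup>2) / 2) / (2 * pi)" for x y
    by (simp add: std_normal_density_def exp_add[symmetric] diff_divide_distrib)
  then have dens: "std_normal_density (c * x - s * y) * std_normal_density (s * x + c * y)
      = std_normal_density x * std_normal_density y" for x y
    by (simp only: norm)
  have "(\<integral>\<^sup>+x. \<integral>\<^sup>+y. f (c * x - s * y, s * x + c * y) \<partial>N\<^sub>0 \<partial>N\<^sub>0)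
    = (\<integral>\<^sup>+x. \<integral>\<^sup>+y. ennreal (std_normal_density x * std_normal_density y) * f (c * x - s * y, s * x + c * y) \<partial>lborel \<partial>lborel)"
    by (rule nn_integral_std_normal_pair[where f = "\<lambda>(x, y). f (c * x - s * y, s * x + c * y)", simplified]) measurable
  also have "\<dots> = (\<integral>\<^sup>+x. \<integral>\<^sup>+y. (\<lambda>(x, y). ennreal (std_normal_density x * std_normal_density y) * f (x, y))
      (c * x - s * y, s * x + c * y) \<partial>lborel \<partial>lborel)"
    by (simp only: dens prod.case)
  also have "\<dots> = (\<integral>\<^sup>+x. \<integral>\<^sup>+y. (\<lambda>(x, y). ennreal (std_normal_density x * std_normal_density y) * f (x, y)) (x, y) \<partial>lborel \<partial>lborel)"
    by (rule nn_integral_lborel_rotate[OF _ cs]) measurable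
  finally show ?thesis by (simp add: nn_integral_std_normal_pair)
qed

section \<open>Joint law of two linear forms\<close>

lemma unit_vector_towards:
  fixes a b :: real
  assumes "a \<ge> 0"
  obtains c s where "c\<^sup>2 + s\<^sup>2 = 1" "c \<ge> 0" "a = sqrt (a\<^sup>2 + b\<^sup>2) * c" "b = sqrt (a\<^sup>2 + b\<^sup>2) * s"
proof (cases "sqrt (a\<^sup>2 + b\<^sup>2) = 0")
  case True
  then have "a = 0" "b = 0" by (auto simp: sum_power2_eq_zero_iff)
  \<comment> \<open>The zero vector has no direction; any unit vector with \<open>c \<ge> 0\<close>
    serves.\<close>
  then show ?thesis using that[of 1 0] by simp
next
  case False
  then have "a\<^sup>2 + b\<^sup>2 \<noteq> 0" by simp
  then have "(a / sqrt (a\<^sup>2 + b\<^sup>2))\<^sup>2 + (b / sqrt (a\<^sup>2 + b\<^sup>2))\<^sup>2 = 1"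
    by (simp add: power_divide add_divide_distrib[symmetric])
  then show ?thesis
    using that[of "a / sqrt (a\<^sup>2 + b\<^sup>2)" "b / sqrt (a\<^sup>2 + b\<^sup>2)"] False assms by simp
qed

text \<open>A sequence of independent identically distributed variables is a first term followed by
  an independent copy of the whole sequence.\<close>

lemma nn_integral_gaussians_peel:
  assumes [measurable]: "f \<in> borel_measurable gaussians"
  shows "(\<integral>\<^sup>+\<omega>. f \<omega> \<partial>gaussians) = (\<integral>\<^sup>+s. \<integral>\<^sup>+\<omega>. f (case_nat s \<omega>) \<partial>gaussians \<partial>N\<^sub>0)"
proof -
  have [measurable]: "f \<in> borel_measurable gauss_seq.S" using assms by (simp add: gaussians_eq)
  have "(\<integral>\<^sup>+\<omega>. f \<omega> \<partial>gauss_seq.S) = (\<integral>\<^sup>+X. f ((\<lambda>(s, \<omega>). case_nat s \<omega>) X) \<partial>(N\<^sub>0 \<Otimes>\<^sub>M gauss_seq.S))"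
    by (subst gauss_seq.PiM_iter[symmetric]) (simp add: nn_integral_distr)
  also have "\<dots> = (\<integral>\<^sup>+x. \<integral>\<^sup>+X. f ((\<lambda>(s, \<omega>). case_nat s \<omega>) (x, X)) \<partial>gauss_seq.S \<partial>N\<^sub>0)"
    by (subst gauss_seq.nn_integral_fst) simp_all
  finally show ?thesis by (simp add: gaussians_eq)
qed

text \<open>Cholesky factorisation of the covariance matrix of two linear forms; a Givens rotation
  absorbs one more Gaussian variable at each step.\<close>

lemma gaussians_two_linear_forms:
  fixes a b :: "nat \<Rightarrow> real"
  shows "\<exists>p q r. p \<ge> 0 \<and> r \<ge> 0 \<and> p\<^sup>2 = (\<Sum>k<m. (a k)\<^sup>2) \<and> p * q = (\<Sum>k<m. a k * b k) \<and>
    q\<^sup>2 + r\<^sup>2 = (\<Sum>k<m. (b k)\<^sup>2) \<and>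
    (\<forall>f :: real \<times> real \<Rightarrow> ennreal. f \<in> borel_measurable (borel \<Otimes>\<^sub>M borel) \<longrightarrow>
      (\<integral>\<^sup>+\<omega>. f (\<Sum>k<m. a k * \<omega> k, \<Sum>k<m. b k * \<omega> k) \<partial>gaussians)
        = (\<integral>\<^sup>+x. \<integral>\<^sup>+y. f (p * x, q * x + r * y) \<partial>N\<^sub>0 \<partial>N\<^sub>0))"
proof (induction m arbitrary: a b)
  case 0
  have "(\<integral>\<^sup>+\<omega>. c \<partial>gaussians) = (\<integral>\<^sup>+x. \<integral>\<^sup>+y. c \<partial>N\<^sub>0 \<partial>N\<^sub>0)" for c :: ennreal
    by (simp add: gaussians.emeasure_space_1 std_normal.emeasure_space_1[simplified])
  then show ?case by (intro exI[of _ 0]) simp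
next
  case (Suc m)
  obtain p q r where pr: "p \<ge> 0" "r \<ge> 0" and gram: "p\<^sup>2 = (\<Sum>k<m. (a (Suc k))\<^sup>2)"
      "p * q = (\<Sum>k<m. a (Suc k) * b (Suc k))" "q\<^sup>2 + r\<^sup>2 = (\<Sum>k<m. (b (Suc k))\<^sup>2)"
    and IH: "\<And>f :: real \<times> real \<Rightarrow> ennreal. f \<in> borel_measurable (borel \<Otimes>\<^sub>M borel) \<Longrightarrow>
      (\<integral>\<^sup>+\<omega>. f (\<Sum>k<m. a (Suc k) * \<omega> k, \<Sum>k<m. b (Suc k) * \<omega> k) \<partial>gaussians)
        = (\<integral>\<^sup>+x. \<integral>\<^sup>+y. f (p * x, q * x + r * y) \<partial>N\<^sub>0 \<partial>N\<^sub>0)"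
    using Suc.IH[of "\<lambda>k. a (Suc k)" "\<lambda>k. b (Suc k)"] by blast
  \<comment> \<open>The first rotation merges the new variable with \<open>x\<close>, so that the
    first form depends on \<open>x\<close> alone; \<open>q'\<close> and \<open>e\<close> are the
    coordinates of \<open>(q, b 0)\<close> in the rotated frame.\<close>
  define p' where "p' = sqrt (p\<^sup>2 + (a 0)\<^sup>2)"
  obtain c s where cs: "c\<^sup>2 + s\<^sup>2 = 1" "c \<ge> 0" and pa: "p = p' * c" "a 0 = p' * s"
    using unit_vector_towards[OF pr(1), of "a 0"] unfolding p'_def by metis
  define q' where "q' = q * c + b 0 * s"
  define e where "e = b 0 * c - q * s"
  \<comment> \<open>The leftover \<open>e\<close> is merged with \<open>r\<close> by a second
    rotation; the minus sign fits its orientation and makes the coefficient of \<open>z\<close>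
    cancel.\<close>
  define r' where "r' = sqrt (r\<^sup>2 + (- e)\<^sup>2)"
  obtain c2 s2 where cs2: "c2\<^sup>2 + s2\<^sup>2 = 1" "c2 \<ge> 0" and re: "r = r' * c2" "- e = r' * s2"
    using unit_vector_towards[OF pr(2), of "- e"] unfolding r'_def by metis
  have g1: "p'\<^sup>2 = p\<^sup>2 + (a 0)\<^sup>2" by (simp add: p'_def)
  have g2: "p' * q' = p * q + a 0 * b 0" by (simp add: q'_def pa algebra_simps)
  have "q'\<^sup>2 + e\<^sup>2 = (q\<^sup>2 + (b 0)\<^sup>2) * (c\<^sup>2 + s\<^sup>2)"
    by (simp add: q'_def e_def power2_eq_square algebra_simps)
  then have g3: "q'\<^sup>2 + r'\<^sup>2 = q\<^sup>2 + r\<^sup>2 + (b 0)\<^sup>2" by (simp add: cs r'_def)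
  have main: "(\<integral>\<^sup>+\<omega>. f (\<Sum>k<Suc m. a k * \<omega> k, \<Sum>k<Suc m. b k * \<omega> k) \<partial>gaussians)
        = (\<integral>\<^sup>+x. \<integral>\<^sup>+y. f (p' * x, q' * x + r' * y) \<partial>N\<^sub>0 \<partial>N\<^sub>0)"
    if [measurable]: "f \<in> borel_measurable (borel \<Otimes>\<^sub>M borel)" for f :: "real \<times> real \<Rightarrow> ennreal"
  proof -
    have "(\<integral>\<^sup>+\<omega>. f (\<Sum>k<Suc m. a k * \<omega> k, \<Sum>k<Suc m. b k * \<omega> k) \<partial>gaussians)
      = (\<integral>\<^sup>+z. \<integral>\<^sup>+\<omega>. f (a 0 * z + (\<Sum>k<m. a (Suc k) * \<omega> k), b 0 * z + (\<Sum>k<m. b (Suc k) * \<omega> k)) \<partial>gaussians \<partial>N\<^sub>0)"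
    proof -
      have "(\<lambda>\<omega>. f (\<Sum>k<Suc m. a k * \<omega> k, \<Sum>k<Suc m. b k * \<omega> k)) \<in> borel_measurable gaussians"
        by measurable
      from nn_integral_gaussians_peel[OF this] show ?thesis
        by (simp only: sum.lessThan_Suc_shift nat.case)
    qed
    also have "\<dots> = (\<integral>\<^sup>+z. \<integral>\<^sup>+x. \<integral>\<^sup>+y. f (a 0 * z + p * x, b 0 * z + (q * x + r * y)) \<partial>N\<^sub>0 \<partial>N\<^sub>0 \<partial>N\<^sub>0)"
      by (intro nn_integral_cong IH[where f = "\<lambda>(u, v). f (a 0 * _ + u, b 0 * _ + v)", simplified]) measurable
    also have "\<dots> = (\<integral>\<^sup>+z. \<integral>\<^sup>+x. (\<lambda>(z, x). \<integral>\<^sup>+y. f (a 0 * z + p * x, b 0 * z + (q * x + r * y)) \<partial>N\<^sub>0) (z, x) \<partial>N\<^sub>0 \<partial>N\<^sub>0)"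
      by simp
    also have "\<dots> = (\<integral>\<^sup>+x. \<integral>\<^sup>+z. (\<lambda>(z, x). \<integral>\<^sup>+y. f (a 0 * z + p * x, b 0 * z + (q * x + r * y)) \<partial>N\<^sub>0) (z, x) \<partial>N\<^sub>0 \<partial>N\<^sub>0)"
      by (rule pair_sigma_finite.Fubini'[symmetric])
         (unfold_locales, measurable)
    also have "\<dots> = (\<integral>\<^sup>+x. \<integral>\<^sup>+z. (\<lambda>(x, z). \<integral>\<^sup>+y. f (a 0 * z + p * x, b 0 * z + (q * x + r * y)) \<partial>N\<^sub>0) (x, z) \<partial>N\<^sub>0 \<partial>N\<^sub>0)"
      by simp
    also have "\<dots> = (\<integral>\<^sup>+x. \<integral>\<^sup>+z. (\<lambda>(x, z). \<integral>\<^sup>+y. f (a 0 * z + p * x, b 0 * z + (q * x + r * y)) \<partial>N\<^sub>0)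
        (c * x - s * z, s * x + c * z) \<partial>N\<^sub>0 \<partial>N\<^sub>0)"
      by (rule nn_integral_std_normal_rotate[symmetric, OF _ cs]) measurable
    also have "\<dots> = (\<integral>\<^sup>+x. \<integral>\<^sup>+z. \<integral>\<^sup>+y. f (p' * x, q' * x + (e * z + r * y)) \<partial>N\<^sub>0 \<partial>N\<^sub>0 \<partial>N\<^sub>0)"
    proof -
      have "a 0 * (s * x + c * z) + p * (c * x - s * z) = p' * x" for x z
      proof -
        have "a 0 * (s * x + c * z) + p * (c * x - s * z) = p' * (c\<^sup>2 + s\<^sup>2) * x"
          unfolding pa by (simp add: algebra_simps power2_eq_square)
        then show ?thesis by (simp add: cs)
      qed
      moreover have "b 0 * (s * x + c * z) + (q * (c * x - s * z) + r * y) = q' * x + (e * z + r * y)" for x y z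
        by (simp add: q'_def e_def algebra_simps)
      ultimately show ?thesis by (simp only: prod.case)
    qed
    also have "\<dots> = (\<integral>\<^sup>+x. \<integral>\<^sup>+z. \<integral>\<^sup>+y. f (p' * x, q' * x + (e * (c2 * z - s2 * y) + r * (s2 * z + c2 * y))) \<partial>N\<^sub>0 \<partial>N\<^sub>0 \<partial>N\<^sub>0)"
      by (intro nn_integral_cong nn_integral_std_normal_rotate[symmetric, OF _ cs2,
            where f = "\<lambda>(z, y). f (p' * _, q' * _ + (e * z + r * y))", simplified]) measurable
    also have "\<dots> = (\<integral>\<^sup>+x. \<integral>\<^sup>+z. \<integral>\<^sup>+y. f (p' * x, q' * x + r' * y) \<partial>N\<^sub>0 \<partial>N\<^sub>0 \<partial>N\<^sub>0)"
    proof -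
      have "e * (c2 * z - s2 * y) + r * (s2 * z + c2 * y) = r' * y" for z y
      proof -
        have "e = - r' * s2" using re(2) by simp
        then have "e * (c2 * z - s2 * y) + r * (s2 * z + c2 * y) = r' * (c2\<^sup>2 + s2\<^sup>2) * y"
          using re(1) by (simp add: algebra_simps power2_eq_square)
        then show ?thesis by (simp add: cs2)
      qed
      then show ?thesis by simp
    qed
    also have "\<dots> = (\<integral>\<^sup>+x. \<integral>\<^sup>+y. f (p' * x, q' * x + r' * y) \<partial>N\<^sub>0 \<partial>N\<^sub>0)"
      by (simp add: std_normal.emeasure_space_1[simplified])
    finally show ?thesis .
  qed
  show ?case
  proof (intro exI conjI allI impI)
    show "0 \<le> p'" "0 \<le> r'" by (simp_all add: p'_def r'_def)
    show "p'\<^sup>2 = (\<Sum>k<Suc m. (a k)\<^sup>2)"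
      unfolding sum.lessThan_Suc_shift g1 gram(1) by simp
    show "p' * q' = (\<Sum>k<Suc m. a k * b k)"
      unfolding sum.lessThan_Suc_shift g2 gram(2) by simp
    show "q'\<^sup>2 + r'\<^sup>2 = (\<Sum>k<Suc m. (b k)\<^sup>2)"
      unfolding sum.lessThan_Suc_shift g3 gram(3) by simp
  qed (rule main)
qed

section \<open>Sign agreement of two correlated normals\<close>

definition sgn1 :: "real \<Rightarrow> real" where
  "sgn1 z = (if z < 0 then -1 else 1)"

lemma measurable_sgn1 [measurable]: "sgn1 \<in> borel_measurable borel"
  unfolding sgn1_def[abs_def] by measurable

definition agree :: "(real \<times> real) set" where
  "agree = {z. sgn1 (fst z) = sgn1 (snd z)}"

lemma agree_iff: "(u, v) \<in> agree \<longleftrightarrow> sgn1 u = sgn1 v"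
  by (simp add: agree_def)

lemma sets_agree [measurable]: "agree \<in> sets (borel \<Otimes>\<^sub>M borel)"
proof -
  have "{z \<in> space (borel \<Otimes>\<^sub>M borel). sgn1 (fst z) = sgn1 (snd z)} \<in> sets (borel \<Otimes>\<^sub>M borel)"
    by measurable
  then show ?thesis by (simp add: agree_def space_pair_measure)
qed

text \<open>The right side is the Cauchy density, the density of the ratio of two independent
  standard normals. The exponents combine to \<open>(h * x)\<^sup>2\<close>, and the substitution
  \<open>u = h * x\<close> leaves the first absolute moment sqrt(2/pi) of the normal law.\<close>

lemma nn_integral_cauchy_density:
  "(\<integral>\<^sup>+x. ennreal (\<bar>x\<bar> * std_normal_density x * std_normal_density (x * t)) \<partial>lborel)
    = ennreal (1 / (pi * (1 + t\<^sup>2)))"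
proof -
  define h where "h = sqrt (1 + t\<^sup>2)"
  have h: "h > 0" "h\<^sup>2 = 1 + t\<^sup>2" by (auto simp: h_def add_pos_nonneg)
  have "(\<integral>\<^sup>+u. ennreal (std_normal_density u * \<bar>u\<bar>) \<partial>lborel) = ennreal (sqrt (2 / pi))"
    using std_normal_moment_abs_odd[of 0]
    by (subst nn_integral_eq_integral) (auto simp: has_bochner_integral_iff)
  moreover have "(\<integral>\<^sup>+u. ennreal (std_normal_density u * \<bar>u\<bar>) \<partial>lborel)
      = ennreal h * (\<integral>\<^sup>+x. ennreal (std_normal_density (h * x) * \<bar>h * x\<bar>) \<partial>lborel)"
    using nn_integral_real_affine[of "\<lambda>u. ennreal (std_normal_density u * \<bar>u\<bar>)" h 0] h by simp
  moreover have "ennreal (\<bar>x\<bar> * std_normal_density x * std_normal_density (x * t))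
      = ennreal (1 / (sqrt (2 * pi) * h)) * ennreal (std_normal_density (h * x) * \<bar>h * x\<bar>)" for x
  proof -
    have "exp (- x\<^sup>2 / 2) * exp (- (x * t)\<^sup>2 / 2) = exp (- (h * x)\<^sup>2 / 2)"
      by (simp add: exp_add[symmetric] power_mult_distrib h algebra_simps add_divide_distrib diff_divide_distrib)
    then have "\<bar>x\<bar> * std_normal_density x * std_normal_density (x * t)
        = 1 / (sqrt (2 * pi) * h) * (std_normal_density (h * x) * \<bar>h * x\<bar>)"
      using h by (simp add: std_normal_density_def abs_mult)
    then show ?thesis using h by (simp only: ennreal_mult'[symmetric]) (subst ennreal_mult'[symmetric]; simp)
  qed
  ultimately have "ennreal h * (\<integral>\<^sup>+x. ennreal (\<bar>x\<bar> * std_normal_density x * std_normal_density (x * t)) \<partial>lborel)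
      = ennreal (1 / (sqrt (2 * pi) * h)) * ennreal (sqrt (2 / pi))"
    by (simp add: nn_integral_cmult mult_ac)
  then have "ennreal (1 / h) * (ennreal h * (\<integral>\<^sup>+x. ennreal (\<bar>x\<bar> * std_normal_density x * std_normal_density (x * t)) \<partial>lborel))
      = ennreal (1 / h * (1 / (sqrt (2 * pi) * h) * sqrt (2 / pi)))"
    using h by (simp add: ennreal_mult'[symmetric] mult.assoc)
  moreover have "ennreal (1 / h) * (ennreal h * z) = z" for z
    using h by (simp add: mult.assoc[symmetric] ennreal_mult'[symmetric])
  moreover have "1 / h * (1 / (sqrt (2 * pi) * h) * sqrt (2 / pi)) = 1 / (pi * (1 + t\<^sup>2))"
    using h(1) by (subst h(2)[symmetric]) (simp add: real_sqrt_mult real_sqrt_divide power2_eq_square field_simps)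
  ultimately show ?thesis by simp
qed

text \<open>After \<open>y = x * t\<close> the second form is \<open>x * (q + r * t)\<close>, so up
  to null sets the signs agree iff \<open>t \<ge> - q / r\<close>, whatever \<open>x\<close> is. The
  probability is a tail of the Cauchy law, with arctan as antiderivative.\<close>

lemma sgn1_agree_prob:
  assumes p: "p > 0" and r: "r > 0"
  shows "(\<integral>\<^sup>+x. \<integral>\<^sup>+y. indicator agree (p * x, q * x + r * y) \<partial>N\<^sub>0 \<partial>N\<^sub>0)
    = ennreal (1 / 2 + arctan (q / r) / pi)"
proof -
  define \<tau> where "\<tau> = - q / r"
  have "(\<integral>\<^sup>+x. \<integral>\<^sup>+y. indicator agree (p * x, q * x + r * y) \<partial>N\<^sub>0 \<partial>N\<^sub>0)
      = (\<integral>\<^sup>+x. \<integral>\<^sup>+y. ennreal (std_normal_density x * std_normal_density y) *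
          indicator agree (p * x, q * x + r * y) \<partial>lborel \<partial>lborel)"
    by (rule nn_integral_std_normal_pair[where f = "\<lambda>(x, y). indicator agree (p * x, q * x + r * y)", simplified])
       measurable
  also have "\<dots> = (\<integral>\<^sup>+x. \<integral>\<^sup>+t. ennreal (\<bar>x\<bar> * std_normal_density x * std_normal_density (x * t)) *
          indicator {\<tau>..} t \<partial>lborel \<partial>lborel)"
  proof (rule nn_integral_cong_AE, rule AE_mp[OF AE_lborel_singleton[of 0]], rule AE_I2, rule impI)
    fix x :: real assume x: "x \<noteq> 0"
    let ?g = "\<lambda>y. ennreal (std_normal_density x * std_normal_density y) *
          indicator agree (p * x, q * x + r * y)"
    have "(\<integral>\<^sup>+y. ?g y \<partial>lborel) = ennreal \<bar>x\<bar> * (\<integral>\<^sup>+t. ?g (0 + x * t) \<partial>lborel)"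
      by (rule nn_integral_real_affine[OF _ x]) measurable
    also have "\<dots> = (\<integral>\<^sup>+t. ennreal \<bar>x\<bar> * ?g (x * t) \<partial>lborel)"
    proof -
      have "(\<lambda>t. ?g (x * t)) \<in> borel_measurable borel" by measurable
      then show ?thesis by (simp add: nn_integral_cmult)
    qed
    also have "\<dots> = (\<integral>\<^sup>+t. ennreal (\<bar>x\<bar> * std_normal_density x * std_normal_density (x * t)) *
          indicator {\<tau>..} t \<partial>lborel)"
    \<comment> \<open>At \<open>t = \<tau>\<close> the second form vanishes and its sign is mere
      convention; the point is null, like \<open>x = 0\<close> above.\<close>
    proof (rule nn_integral_cong_AE, rule AE_mp[OF AE_lborel_singleton[of \<tau>]], rule AE_I2, rule impI)
      fix t assume t: "t \<noteq> \<tau>"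
      have "q + r * t \<noteq> 0" using t r by (auto simp: \<tau>_def field_simps)
      moreover have "\<tau> \<le> t \<longleftrightarrow> q + r * t \<ge> 0" using r by (auto simp: \<tau>_def field_simps)
      moreover have "q * x + r * (x * t) = x * (q + r * t)" by (simp add: algebra_simps)
      ultimately have "sgn1 (p * x) = sgn1 (q * x + r * (x * t)) \<longleftrightarrow> \<tau> \<le> t"
        using x p by (auto simp: sgn1_def mult_less_0_iff)
      then show "ennreal \<bar>x\<bar> * ?g (x * t)
          = ennreal (\<bar>x\<bar> * std_normal_density x * std_normal_density (x * t)) * indicator {\<tau>..} t"
        by (simp add: ennreal_mult'[symmetric] mult.assoc indicator_def agree_iff)
    qed
    finally show "(\<integral>\<^sup>+y. ?g y \<partial>lborel) = (\<integral>\<^sup>+t. ennreal (\<bar>x\<bar> * std_normal_density x * std_normal_density (x * t)) *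
          indicator {\<tau>..} t \<partial>lborel)" .
  qed
  also have "\<dots> = (\<integral>\<^sup>+t. \<integral>\<^sup>+x. ennreal (\<bar>x\<bar> * std_normal_density x * std_normal_density (x * t)) *
          indicator {\<tau>..} t \<partial>lborel \<partial>lborel)"
    by (rule lborel_pair.Fubini') measurable
  also have "\<dots> = (\<integral>\<^sup>+t. ennreal (1 / (pi * (1 + t\<^sup>2))) * indicator {\<tau>..} t \<partial>lborel)"
  proof (intro nn_integral_cong)
    fix t :: real
    have "(\<lambda>x. ennreal (\<bar>x\<bar> * std_normal_density x * std_normal_density (x * t))) \<in> borel_measurable borel"
      by measurable
    then show "(\<integral>\<^sup>+x. ennreal (\<bar>x\<bar> * std_normal_density x * std_normal_density (x * t)) * indicator {\<tau>..} t \<partial>lborel)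
        = ennreal (1 / (pi * (1 + t\<^sup>2))) * indicator {\<tau>..} t"
      by (simp add: nn_integral_multc nn_integral_cauchy_density)
  qed
  also have "\<dots> = ennreal (1 / 2 - arctan \<tau> / pi)"
  proof (rule nn_integral_FTC_atLeast)
    fix t :: real
    show "((\<lambda>t. arctan t / pi) has_real_derivative 1 / (pi * (1 + t\<^sup>2))) (at t)"
      using DERIV_cdivide[OF DERIV_arctan, of pi t] by (simp add: inverse_eq_divide mult.commute)
    show "0 \<le> 1 / (pi * (1 + t\<^sup>2))" by simp
  next
    show "((\<lambda>t. arctan t / pi) \<longlongrightarrow> 1 / 2) at_top"
      using tendsto_divide[OF tendsto_arctan_at_top tendsto_const[of pi]] by simp
  qed measurable
  finally show ?thesis by (simp add: \<tau>_def arctan_minus)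
qed

text \<open>With \<theta> = arccos (q / v) the vector \<open>(q, r)\<close> is
  \<open>v * (cos \<theta>, sin \<theta>)\<close>, so \<open>q / r\<close> is the tangent of pi/2 -
  \<theta>. For \<open>r = 0\<close> the second form is a positive or negative multiple of the same
  variable, and the signs agree always or almost never.\<close>

lemma sgn1_agree_prob_arccos:
  assumes p: "p > 0" and r: "r \<ge> 0" and v: "v > 0" "q\<^sup>2 + r\<^sup>2 = v\<^sup>2"
  shows "(\<integral>\<^sup>+x. \<integral>\<^sup>+y. indicator agree (p * x, q * x + r * y) \<partial>N\<^sub>0 \<partial>N\<^sub>0)
    = ennreal (1 - arccos (q / v) / pi)"
proof (cases "r = 0")
  case False
  with r have r: "r > 0" by simp
  have "q\<^sup>2 < v\<^sup>2" using v(2) zero_less_power[OF r, of 2] by linarith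
  then have "\<bar>q\<bar> < v" using v(1) power2_less_imp_less[of "\<bar>q\<bar>" v] by simp
  then have qv: "-1 < q / v" "q / v < 1" using v(1) by (auto simp: field_simps)
  define \<theta> where "\<theta> = arccos (q / v)"
  have th: "0 < \<theta>" "\<theta> < pi" "cos \<theta> = q / v"
    using arccos_lt_bounded[OF qv] qv by (auto simp: \<theta>_def)
  have "(sin \<theta>)\<^sup>2 = (r / v)\<^sup>2"
    using v by (simp add: sin_squared_eq th(3) power_divide field_simps)
  then have "sin \<theta> = r / v"
    using sin_gt_zero[OF th(1,2)] r v(1) by (simp add: power2_eq_iff_nonneg)
  then have "tan (pi / 2 - \<theta>) = q / r"
    using v(1) by (simp add: tan_def sin_diff cos_diff th(3))
  moreover have "arctan (tan (pi / 2 - \<theta>)) = pi / 2 - \<theta>"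
    using th by (intro arctan_tan) auto
  ultimately have "arctan (q / r) = pi / 2 - \<theta>" by simp
  then have "1 / 2 + arctan (q / r) / pi = 1 - \<theta> / pi" by (simp add: diff_divide_distrib)
  then show ?thesis using sgn1_agree_prob[OF p r] by (simp add: \<theta>_def)
next
  case True
  have "AE x in lborel. x \<noteq> (0::real)" by (rule AE_lborel_singleton)
  then have ae: "AE x in N\<^sub>0. x \<noteq> 0"
    by (subst AE_density) (auto elim: eventually_mono)
  have "q\<^sup>2 = v\<^sup>2" using v(2) True by simp
  then consider "q = v" | "q = - v" unfolding power2_eq_iff by blast
  then show ?thesis
  proof cases
    case 1
    have "sgn1 (p * x) = sgn1 (q * x + r * y)" for x y
      unfolding 1 True using p v(1) by (simp add: sgn1_def mult_less_0_iff)
    then have "indicator agree (p * x, q * x + r * y) = (1 :: ennreal)" for x y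
      by (simp add: indicator_def agree_iff)
    then have "(\<integral>\<^sup>+x. \<integral>\<^sup>+y. indicator agree (p * x, q * x + r * y) \<partial>N\<^sub>0 \<partial>N\<^sub>0)
        = (\<integral>\<^sup>+x. \<integral>\<^sup>+y. 1 \<partial>N\<^sub>0 \<partial>N\<^sub>0)"
      by (simp only:)
    then show ?thesis using 1 v by (simp add: std_normal.emeasure_space_1[simplified])
  next
    case 2
    have "sgn1 (p * x) \<noteq> sgn1 (q * x + r * y)" if "x \<noteq> 0" for x y
      unfolding 2 True using p v(1) that by (simp add: sgn1_def mult_less_0_iff zero_less_mult_iff)
    then have "indicator agree (p * x, q * x + r * y) = (0 :: ennreal)" if "x \<noteq> 0" for x y
      using that by (simp add: indicator_def agree_iff)
    then have "(\<integral>\<^sup>+x. \<integral>\<^sup>+y. indicator agree (p * x, q * x + r * y) \<partial>N\<^sub>0 \<partial>N\<^sub>0)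
        = (\<integral>\<^sup>+x. 0 \<partial>N\<^sub>0)"
      by (intro nn_integral_cong_AE eventually_mono[OF ae]) simp
    then show ?thesis using 2 v by simp
  qed
qed

text \<open>Grothendieck's identity, with arccos instead of arcsin: the product of the signs is
  twice the indicator of agreement minus 1. The bound on the correlation is recorded because it
  keeps arccos within its range.\<close>

lemma expectation_sgn1_product:
  fixes a b :: "nat \<Rightarrow> real"
  assumes va: "(\<Sum>k<m. (a k)\<^sup>2) = v" and vb: "(\<Sum>k<m. (b k)\<^sup>2) = v" and v: "v > 0"
  shows "(\<integral>\<omega>. sgn1 (\<Sum>k<m. a k * \<omega> k) * sgn1 (\<Sum>k<m. b k * \<omega> k) \<partial>gaussians)
      = 1 - 2 * arccos ((\<Sum>k<m. a k * b k) / v) / pi"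
    and "\<bar>(\<Sum>k<m. a k * b k) / v\<bar> \<le> 1"
proof -
  define X where "X \<omega> = (\<Sum>k<m. a k * \<omega> k)" for \<omega> :: "nat \<Rightarrow> real"
  define Y where "Y \<omega> = (\<Sum>k<m. b k * \<omega> k)" for \<omega> :: "nat \<Rightarrow> real"
  have [measurable]: "X \<in> borel_measurable gaussians" "Y \<in> borel_measurable gaussians"
    unfolding X_def[abs_def] Y_def[abs_def] by measurable
  obtain p q r where pr: "p \<ge> 0" "r \<ge> 0" and gram: "p\<^sup>2 = v" "p * q = (\<Sum>k<m. a k * b k)" "q\<^sup>2 + r\<^sup>2 = v"
    and law: "\<And>f :: real \<times> real \<Rightarrow> ennreal. f \<in> borel_measurable (borel \<Otimes>\<^sub>M borel) \<Longrightarrow>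
      (\<integral>\<^sup>+\<omega>. f (X \<omega>, Y \<omega>) \<partial>gaussians) = (\<integral>\<^sup>+x. \<integral>\<^sup>+y. f (p * x, q * x + r * y) \<partial>N\<^sub>0 \<partial>N\<^sub>0)"
    using gaussians_two_linear_forms[of a m b] unfolding va vb X_def Y_def by blast
  have p: "p > 0" using pr(1) gram(1) v by (cases "p = 0") auto
  have qp: "(\<Sum>k<m. a k * b k) / v = q / p"
    using p by (simp add: gram(1)[symmetric] gram(2)[symmetric] power2_eq_square)
  have "q\<^sup>2 \<le> p\<^sup>2" using gram(1,3) zero_le_power2[of r] by linarith
  then have "\<bar>q\<bar> \<le> p" using p abs_le_square_iff[of q p] by simp
  then have qp1: "\<bar>q / p\<bar> \<le> 1" using p by (simp add: abs_divide)
  then show "\<bar>(\<Sum>k<m. a k * b k) / v\<bar> \<le> 1" by (simp add: qp)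
  let ?A = "{\<omega> \<in> space gaussians. sgn1 (X \<omega>) = sgn1 (Y \<omega>)}"
  have [measurable]: "?A \<in> sets gaussians" by measurable
  have "emeasure gaussians ?A = (\<integral>\<^sup>+\<omega>. indicator ?A \<omega> \<partial>gaussians)" by simp
  also have "\<dots> = (\<integral>\<^sup>+\<omega>. indicator agree (X \<omega>, Y \<omega>) \<partial>gaussians)"
    by (intro nn_integral_cong) (simp add: indicator_def agree_iff)
  also have "\<dots> = (\<integral>\<^sup>+x. \<integral>\<^sup>+y. indicator agree (p * x, q * x + r * y) \<partial>N\<^sub>0 \<partial>N\<^sub>0)"
    by (rule law) measurable
  also have "\<dots> = ennreal (1 - arccos (q / p) / pi)"
    by (rule sgn1_agree_prob_arccos[OF p pr(2) p]) (simp add: gram)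
  finally have "ennreal (measure gaussians ?A) = ennreal (1 - arccos (q / p) / pi)"
    by (simp only: gaussians.emeasure_eq_measure)
  moreover have "arccos (q / p) / pi \<le> 1"
    using qp1 arccos_ubound[of "q / p"] unfolding abs_le_iff by simp
  ultimately have A: "measure gaussians ?A = 1 - arccos (q / p) / pi"
    by (subst (asm) ennreal_inj) auto
  have "(\<integral>\<omega>. sgn1 (X \<omega>) * sgn1 (Y \<omega>) \<partial>gaussians) = (\<integral>\<omega>. 2 * indicator ?A \<omega> - 1 \<partial>gaussians)"
    by (intro Bochner_Integration.integral_cong) (auto simp: sgn1_def indicator_def agree_iff)
  also have "\<dots> = 2 * measure gaussians ?A - 1"
    by (subst Bochner_Integration.integral_diff) (simp_all add: gaussians.prob_space gaussians.emeasure_eq_measure)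
  also have "\<dots> = 1 - 2 * arccos (q / p) / pi" by (simp add: A)
  finally show "(\<integral>\<omega>. sgn1 (\<Sum>k<m. a k * \<omega> k) * sgn1 (\<Sum>k<m. b k * \<omega> k) \<partial>gaussians)
      = 1 - 2 * arccos ((\<Sum>k<m. a k * b k) / v) / pi"
    unfolding qp X_def Y_def .
qed

section \<open>Goemans-Williamson rounding\<close>

lemma alpha_GW_le:
  assumes "0 \<le> \<theta>" "\<theta> \<le> pi"
  shows "alpha_GW * (1 - cos \<theta>) \<le> 2 * \<theta> / pi"
proof (cases "\<theta> = 0")
  case False
  with assms have \<theta>: "\<theta> \<in> {0<..pi}" by simp
  then have pos: "1 - cos \<theta> > 0" using cos_monotone_0_pi[of 0 \<theta>] by simp
  have "alpha_GW \<le> 2 / pi * (\<theta> / (1 - cos \<theta>))" using alpha_GW_is_min \<theta> by force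
  then show ?thesis using pos by (simp add: pos_le_divide_eq mult_ac)
qed simp

lemma alpha_GW_bounds: "0 \<le> alpha_GW" "alpha_GW \<le> 1"
proof -
  obtain \<theta> where \<theta>: "\<theta> \<in> {0<..pi}" "alpha_GW = 2 / pi * (\<theta> / (1 - cos \<theta>))"
    using alpha_GW_is_min by blast
  have "1 - cos \<theta> \<ge> 0" by simp
  then show "0 \<le> alpha_GW"
    unfolding \<theta>(2) using \<theta>(1) by (intro mult_nonneg_nonneg divide_nonneg_nonneg) auto
  show "alpha_GW \<le> 1" using alpha_GW_le[of pi] by simp
qed

text \<open>The first bound is the minimality of \<open>alpha_GW\<close> at the angle arccos \<rho>,
  the second at the supplementary angle, which negates both \<rho> and \<open>e\<close>.\<close>

lemma sgn_expectation_bounds: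
  assumes "\<bar>\<rho>\<bar> \<le> 1"
  defines "e \<equiv> 1 - 2 * arccos \<rho> / pi"
  shows "alpha_GW * (1 - \<rho>) \<le> 1 - e" "alpha_GW * (1 + \<rho>) \<le> 1 + e"
proof -
  have \<rho>: "-1 \<le> \<rho>" "\<rho> \<le> 1" using assms by auto
  note b = arccos_lbound[OF \<rho>] arccos_ubound[OF \<rho>]
  show "alpha_GW * (1 - \<rho>) \<le> 1 - e"
    using alpha_GW_le[OF b] \<rho> by (simp add: e_def)
  have "alpha_GW * (1 + \<rho>) \<le> 2 * (pi - arccos \<rho>) / pi"
    using alpha_GW_le[of "pi - arccos \<rho>"] b \<rho> by simp
  also have "\<dots> = 1 + e" by (simp add: e_def diff_divide_distrib right_diff_distrib)
  finally show "alpha_GW * (1 + \<rho>) \<le> 1 + e" .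
qed

context dd_matrix
begin

text \<open>Diagonal dominance writes the form as a nonnegative combination of the diagonal terms and of
  the terms \<open>(x\<^sub>i \<plusminus> x\<^sub>j)\<^sup>2\<close>, each of which loses at most a factor \<^const>\<open>alpha_GW\<close>.\<close>

lemma rounding_bound:
  assumes \<rho>: "\<And>i j. i < n \<Longrightarrow> j < n \<Longrightarrow> \<bar>\<rho> i j\<bar> \<le> 1"
    and e: "\<And>i j. i < n \<Longrightarrow> j < n \<Longrightarrow> e i j = 1 - 2 * arccos (\<rho> i j) / pi"
    and diag: "\<And>i. i < n \<Longrightarrow> \<rho> i i = 1"
  shows "alpha_GW * (\<Sum>i<n. \<Sum>j<n. c i j * \<rho> i j) \<le> (\<Sum>i<n. \<Sum>j<n. c i j * e i j)"
proof -
  \<comment> \<open>\<open>e i j - alpha_GW * \<rho> i j\<close> lies between -(1 -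
    \<open>alpha_GW\<close>) and 1 - \<open>alpha_GW\<close>, and equals the upper end on the
    diagonal; dominance therefore makes every row sum nonnegative, whatever the signs of its
    entries.\<close>
  have row: "0 \<le> (\<Sum>j<n. c i j * (e i j - alpha_GW * \<rho> i j))" if i: "i < n" for i
  proof -
    have "(1 - alpha_GW) * (\<Sum>j\<in>{..<n} - {i}. \<bar>c i j\<bar>) \<le> (1 - alpha_GW) * c i i"
      using alpha_GW_bounds dom[OF i] by (intro mult_left_mono) auto
    moreover have "(\<Sum>j\<in>{..<n} - {i}. - (1 - alpha_GW) * \<bar>c i j\<bar>)
        \<le> (\<Sum>j\<in>{..<n} - {i}. c i j * (e i j - alpha_GW * \<rho> i j))"
    proof (intro sum_mono)
      fix j assume "j \<in> {..<n} - {i}"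
      then have j: "j < n" by simp
      note b = sgn_expectation_bounds[OF \<rho>[OF i j], folded e[OF i j]]
      show "- (1 - alpha_GW) * \<bar>c i j\<bar> \<le> c i j * (e i j - alpha_GW * \<rho> i j)"
      proof (cases "c i j \<ge> 0")
        case True
        have "c i j * - (1 - alpha_GW) \<le> c i j * (e i j - alpha_GW * \<rho> i j)"
          using b(2) True by (intro mult_left_mono) (auto simp: algebra_simps)
        then show ?thesis using True by (simp add: mult.commute)
      next
        case False
        have "- c i j * - (1 - alpha_GW) \<le> - c i j * - (e i j - alpha_GW * \<rho> i j)"
          using b(1) False by (intro mult_left_mono) (auto simp: algebra_simps)
        then show ?thesis using False by (simp add: algebra_simps)
      qed
    qed
    moreover have "(\<Sum>j<n. c i j * (e i j - alpha_GW * \<rho> i j))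
        = (1 - alpha_GW) * c i i + (\<Sum>j\<in>{..<n} - {i}. c i j * (e i j - alpha_GW * \<rho> i j))"
      using i by (simp add: sum.remove[of "{..<n}" i] e diag mult.commute)
    moreover have "(\<Sum>j\<in>{..<n} - {i}. - (1 - alpha_GW) * \<bar>c i j\<bar>)
        = - ((1 - alpha_GW) * (\<Sum>j\<in>{..<n} - {i}. \<bar>c i j\<bar>))"
      unfolding sum_distrib_left sum_negf[symmetric] by (intro sum.cong) (auto simp: algebra_simps)
    ultimately show ?thesis by linarith
  qed
  have "0 \<le> (\<Sum>i<n. \<Sum>j<n. c i j * (e i j - alpha_GW * \<rho> i j))"
    by (rule sum_nonneg) (simp add: row)
  also have "\<dots> = (\<Sum>i<n. \<Sum>j<n. c i j * e i j) - alpha_GW * (\<Sum>i<n. \<Sum>j<n. c i j * \<rho> i j)"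
    by (simp add: right_diff_distrib sum_subtractf sum_distrib_left mult_ac)
  finally show ?thesis by simp
qed

end

section \<open>The program\<close>

abbreviation eta :: rexp where
  "eta \<equiv> RDiv REps (RNat (NConst 4))"

text \<open>Recomputed from block 1 at each use; an array of weights would be a fourth
  vector.\<close>

abbreviation weight_at :: "nat \<Rightarrow> rexp" where
  "weight_at r \<equiv> RExp (RMul eta (RCell 1 (NReg r)))"

abbreviation log_dim :: rexp where
  "log_dim \<equiv> RLn (RMul (RNat (NConst 2)) (RNat NDim))"

abbreviation same_reg :: "nat \<Rightarrow> nat \<Rightarrow> cond" where
  "same_reg r s \<equiv> CAnd (CNot (NLess (NReg r) (NReg s))) (CNot (NLess (NReg s) (NReg r)))"

definition count_loop :: "nat \<Rightarrow> cond \<Rightarrow> com \<Rightarrow> com" where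
  "count_loop r b P = Seq (Copy r (NConst 0)) (While b (Seq P (Incr r)))"

abbreviation for_dim :: "nat \<Rightarrow> com \<Rightarrow> com" where
  "for_dim r P \<equiv> count_loop r (NLess (NReg r) NDim) P"

text \<open>As long as the value of \<open>a\<close> stays fixed, comparing the counter with it runs
  the body \<open>nat \<lceil>a\<rceil>\<close> times, so no conversion to a natural number is
  performed.\<close>

abbreviation for_real :: "nat \<Rightarrow> rexp \<Rightarrow> com \<Rightarrow> com" where
  "for_real r a P \<equiv> count_loop r (RLess (RNat (NReg r)) a) P"

text \<open>Block 0 holds the Gaussian sample, block 1 the diagonal of the accumulated matrix and block 2
  the power iteration.  Register 0 counts rounds, 1 is the best start vector, 2 is the candidate
  and later the pivot, 3 counts power steps, 4 is a coordinate.\<close>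

definition power_com :: com where
  "power_com = for_real 3 (RDiv log_dim eta)
     (Seq (MatVec 2 2) (for_dim 4 (Store 2 (NReg 4) (RDiv (RCell 2 (NReg 4)) (weight_at 4)))))"

definition clear_com :: com where
  "clear_com = for_dim 4 (Store 2 (NReg 4) (RNat (NConst 0)))"

text \<open>Two runs of \<open>power_com\<close> give the moment of order twice the number of steps.
  The second unit vector is subtracted from its cell rather than stored, so the vector is correct,
  namely zero, also when the candidate is the current best.\<close>

definition compare_com :: com where
  "compare_com =
     Seq clear_com
    (Seq (Store 2 (NReg 1) (RDiv (RNat (NConst 1)) (RSqrt (weight_at 1))))
    (Seq (Store 2 (NReg 2) (RSub (RCell 2 (NReg 2)) (RDiv (RNat (NConst 1)) (RSqrt (weight_at 2)))))
    (Seq power_com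
    (Seq power_com
    (If (RLess (RAdd (RMul (RCell 2 (NReg 1)) (RSqrt (weight_at 1)))
                     (RMul (RCell 2 (NReg 2)) (RSqrt (weight_at 2)))) (RNat (NConst 0)))
       (Copy 1 (NReg 2)) Skip)))))"

definition tournament_com :: com where
  "tournament_com = Seq (Copy 1 (NConst 0)) (for_dim 2 compare_com)"

definition argmax_com :: "(nat \<Rightarrow> rexp) \<Rightarrow> com" where
  "argmax_com a = Seq (Copy 2 (NConst 0))
     (for_dim 4 (If (RLess (a 2) (a 4)) (Copy 2 (NReg 4)) Skip))"

definition normalise_com :: com where
  "normalise_com = for_dim 4 (If (same_reg 4 2)
     (Store 1 (NReg 4) (RAdd (RCell 1 (NReg 4)) (RNat (NConst 1))))
     (Seq (Store 2 (NReg 4) (RDiv (RCell 2 (NReg 4)) (RCell 2 (NReg 2))))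
          (Store 1 (NReg 4) (RAdd (RCell 1 (NReg 4)) (RMul (RCell 2 (NReg 4)) (RCell 2 (NReg 4)))))))"

text \<open>After normalisation the pivot entry is 1, so its cell is free for the Gaussian multiplier.\<close>

definition sample_com :: com where
  "sample_com = Seq (Gauss 2 (NReg 2)) (for_dim 4 (If (same_reg 4 2)
     (Store 0 (NReg 4) (RAdd (RCell 0 (NReg 4)) (RCell 2 (NReg 2))))
     (Store 0 (NReg 4) (RAdd (RCell 0 (NReg 4)) (RMul (RCell 2 (NReg 4)) (RCell 2 (NReg 2)))))))"

definition round_com :: com where
  "round_com =
     Seq tournament_com
    (Seq clear_com
    (Seq (Store 2 (NReg 1) (RDiv (RNat (NConst 1)) (RSqrt (weight_at 1))))
    (Seq power_com
    (Seq (argmax_com (\<lambda>r. RMul (RCell 2 (NReg r)) (RCell 2 (NReg r))))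
    (Seq normalise_com sample_com)))))"

text \<open>Each padding is a fresh Gaussian times the root of the missing variance; register 2
  holds the index of the largest diagonal entry in place of its value. The strict test sends 0 to 1,
  as \<open>sgn1\<close> does, and -1 is formed by subtraction because constants are
  naturals.\<close>

definition output_com :: com where
  "output_com = Seq (argmax_com (\<lambda>r. RCell 1 (NReg r))) (for_dim 4
    (Seq (Gauss 2 (NReg 4))
    (Seq (Store 0 (NReg 4) (RAdd (RCell 0 (NReg 4))
            (RMul (RSqrt (RSub (RCell 1 (NReg 2)) (RCell 1 (NReg 4)))) (RCell 2 (NReg 4)))))
    (If (RLess (RCell 0 (NReg 4)) (RNat (NConst 0)))
       (Store 0 (NReg 4) (RSub (RNat (NConst 0)) (RNat (NConst 1))))
       (Store 0 (NReg 4) (RNat (NConst 1)))))))"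

definition maxcut_com :: com where
  "maxcut_com = Seq
     (for_real 0 (RDiv (RMul (RNat NDim) log_dim) (RMul eta eta)) round_com) output_com"

section \<open>Total correctness with time and space bounds\<close>

fun wregs :: "com \<Rightarrow> nat set" where
  "wregs (Seq P Q) = wregs P \<union> wregs Q"
| "wregs (If b P Q) = wregs P \<union> wregs Q"
| "wregs (While b P) = wregs P"
| "wregs (Copy r e) = {r}"
| "wregs (Incr r) = {r}"
| "wregs _ = {}"

lemma exec_regs_unchanged: "exec I \<omega> P s t A s' \<Longrightarrow> r \<notin> wregs P \<Longrightarrow> regs s' r = regs s r"
  by (induction rule: exec.induct) (auto simp: write_vec_def)

lemma real_less_iff_nat_ceiling: "real k < x \<longleftrightarrow> k < nat \<lceil>x\<rceil>"
  by (simp add: zless_nat_eq_int_zless less_ceiling_iff)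

locale exec_context =
  fixes I :: inst and \<omega> :: "nat \<Rightarrow> real" and n :: nat
  assumes dim_I: "dim I = n"
begin

text \<open>Total correctness with a time bound. Space is tracked as inclusion in one fixed set of
  cells, which is stable under composition and loops, whereas cardinalities would add up.\<close>

definition triple :: "(state \<Rightarrow> bool) \<Rightarrow> com \<Rightarrow> real \<Rightarrow> (state \<Rightarrow> bool) \<Rightarrow> bool" where
  "triple Q P \<tau> R \<longleftrightarrow> (\<forall>s. Q s \<longrightarrow>
     (\<exists>t A s'. exec I \<omega> P s t A s' \<and> t \<le> \<tau> \<and> A \<subseteq> {..<3 * n} \<and> R s'))"

lemma tripleI:
  assumes "\<And>s. Q s \<Longrightarrow> \<exists>t A s'. exec I \<omega> P s t A s' \<and> t \<le> \<tau> \<and> A \<subseteq> {..<3 * n} \<and> R s'"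
  shows "triple Q P \<tau> R"
  using assms by (simp add: triple_def)

lemma tripleD:
  assumes "triple Q P \<tau> R" "Q s"
  obtains t A s' where "exec I \<omega> P s t A s'" "t \<le> \<tau>" "A \<subseteq> {..<3 * n}" "R s'"
  using assms unfolding triple_def by blast

lemma triple_exI: "(\<And>x. triple (Q x) P \<tau> R) \<Longrightarrow> triple (\<lambda>s. \<exists>x. Q x s) P \<tau> R"
  unfolding triple_def by blast

lemma triple_conseq:
  assumes "triple Q P \<tau> R" "\<And>s. Q' s \<Longrightarrow> Q s" "\<tau> \<le> \<tau>'" "\<And>s. R s \<Longrightarrow> R' s"
  shows "triple Q' P \<tau>' R'"
  using assms unfolding triple_def by (meson order_trans)

lemma triple_Seq:
  assumes "triple Q P \<tau> R" "triple R P' \<tau>' S"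
  shows "triple Q (Seq P P') (\<tau> + \<tau>') S"
proof (rule tripleI)
  fix s assume "Q s"
  then obtain t A s' where 1: "exec I \<omega> P s t A s'" "t \<le> \<tau>" "A \<subseteq> {..<3 * n}" "R s'"
    using assms(1) unfolding triple_def by blast
  then obtain t' A' s'' where 2: "exec I \<omega> P' s' t' A' s''" "t' \<le> \<tau>'" "A' \<subseteq> {..<3 * n}" "S s''"
    using assms(2) unfolding triple_def by blast
  show "\<exists>t A s'. exec I \<omega> (Seq P P') s t A s' \<and> t \<le> \<tau> + \<tau>' \<and> A \<subseteq> {..<3 * n} \<and> S s'"
    using exec.Seq[OF 1(1) 2(1)] 1 2 by (intro exI conjI) (assumption | auto)+
qed

lemma triple_If:
  assumes cells: "\<And>s. Q s \<Longrightarrow> ccells I s b \<subseteq> {..<3 * n}"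
    and "triple (\<lambda>s. Q s \<and> cval I s b) P \<tau> R" "triple (\<lambda>s. Q s \<and> \<not> cval I s b) P' \<tau> R"
  shows "triple Q (If b P P') (ccost b + \<tau>) R"
proof (rule tripleI)
  fix s assume Q: "Q s"
  show "\<exists>t A s'. exec I \<omega> (If b P P') s t A s' \<and> t \<le> ccost b + \<tau> \<and> A \<subseteq> {..<3 * n} \<and> R s'"
  proof (cases "cval I s b")
    case True
    then obtain t A s' where 1: "exec I \<omega> P s t A s'" "t \<le> \<tau>" "A \<subseteq> {..<3 * n}" "R s'"
      using assms(2) Q unfolding triple_def by blast
    show ?thesis
      using exec.IfTrue[OF True 1(1)] 1 cells[OF Q] by (intro exI conjI) (assumption | auto)+
  next
    case False
    then obtain t A s' where 1: "exec I \<omega> P' s t A s'" "t \<le> \<tau>" "A \<subseteq> {..<3 * n}" "R s'"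
      using assms(3) Q unfolding triple_def by blast
    show ?thesis
      using exec.IfFalse[OF False 1(1)] 1 cells[OF Q] by (intro exI conjI) (assumption | auto)+
  qed
qed

text \<open>Induction on the remaining iterations, each paying for test, body and increment; one
  reset and one failing test come on top. The invariant must ignore the counter, because the
  increment happens after the body has established it for the next index.\<close>

lemma triple_count_loop:
  assumes body: "\<And>i. i < N \<Longrightarrow> triple (\<lambda>s. Inv i s \<and> regs s r = i) P \<tau> (Inv (Suc i))"
    and r: "r \<notin> wregs P"
    and insens: "\<And>i s v. Inv i s \<Longrightarrow> Inv i (s\<lparr>regs := (regs s)(r := v)\<rparr>)"
    and cond: "\<And>i s. Inv i s \<Longrightarrow> regs s r = i \<Longrightarrow> cval I s b \<longleftrightarrow> i < N"
    and cells: "\<And>s. ccells I s b = {}"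
  shows "triple (Inv 0) (count_loop r b P) (1 + ccost b + real N * (ccost b + \<tau> + 1)) (Inv N)"
  unfolding count_loop_def
proof (rule tripleI)
  have loop: "\<exists>t A s'. exec I \<omega> (While b (Seq P (Incr r))) s t A s' \<and>
      t \<le> ccost b + real (N - i) * (ccost b + \<tau> + 1) \<and> A \<subseteq> {..<3 * n} \<and> Inv N s'"
    if "Inv i s" "regs s r = i" "i \<le> N" for i s
    using that
  proof (induction "N - i" arbitrary: i s)
    case 0
    then have "i = N" by simp
    with 0 cond[of i s] have "\<not> cval I s b" by simp
    from exec.WhileFalse[OF this] 0 \<open>i = N\<close> cells show ?case by (intro exI conjI) (assumption | auto)+
  next
    case (Suc k)
    then have i: "i < N" by simp
    then have b: "cval I s b" using cond Suc.prems by blast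
    obtain t A s1 where 1: "exec I \<omega> P s t A s1" "t \<le> \<tau>" "A \<subseteq> {..<3 * n}" "Inv (Suc i) s1"
      using body[OF i] Suc.prems unfolding triple_def by blast
    let ?s2 = "s1\<lparr>regs := (regs s1)(r := Suc (regs s1 r))\<rparr>"
    have "regs s1 r = i" using exec_regs_unchanged[OF 1(1) r] Suc.prems by simp
    then have "regs ?s2 r = Suc i" by simp
    moreover have "Inv (Suc i) ?s2" using insens[OF 1(4)] .
    moreover have "k = N - Suc i" using Suc.hyps by simp
    ultimately obtain t' A' s3 where 3: "exec I \<omega> (While b (Seq P (Incr r))) ?s2 t' A' s3"
        "t' \<le> ccost b + real (N - Suc i) * (ccost b + \<tau> + 1)" "A' \<subseteq> {..<3 * n}" "Inv N s3"
      using Suc.hyps(1)[of "Suc i" ?s2] i by auto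
    note ex = exec.WhileTrue[OF b exec.Seq[OF 1(1) exec.Incr] 3(1)]
    have "real (N - i) = real (N - Suc i) + 1" using i by (simp add: Suc_diff_Suc[symmetric])
    then have "ccost b + (t + 1) + t' \<le> ccost b + real (N - i) * (ccost b + \<tau> + 1)"
      using 1(2) 3(2) by (simp add: algebra_simps)
    then show ?case using ex 1 3 cells by (intro exI conjI) (assumption | auto)+
  qed
  fix s assume "Inv 0 s"
  let ?s = "s\<lparr>regs := (regs s)(r := 0)\<rparr>"
  have "Inv 0 ?s" using insens[OF \<open>Inv 0 s\<close>] .
  then obtain t A s' where 1: "exec I \<omega> (While b (Seq P (Incr r))) ?s t A s'"
      "t \<le> ccost b + real N * (ccost b + \<tau> + 1)" "A \<subseteq> {..<3 * n}" "Inv N s'"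
    using loop[of 0 ?s] by auto
  have "exec I \<omega> (Copy r (NConst 0)) s 1 {} ?s" using exec.Copy[of I \<omega> r "NConst 0" s] by simp
  from exec.Seq[OF this 1(1)] 1
  show "\<exists>t A s'. exec I \<omega> (Seq (Copy r (NConst 0)) (While b (Seq P (Incr r)))) s t A s' \<and>
      t \<le> 1 + ccost b + real N * (ccost b + \<tau> + 1) \<and> A \<subseteq> {..<3 * n} \<and> Inv N s'"
    by (intro exI conjI) (assumption | auto)+
qed

lemma triple_for_dim:
  assumes "\<And>i. i < n \<Longrightarrow> triple (\<lambda>s. Inv i s \<and> regs s r = i) P \<tau> (Inv (Suc i))"
    and "r \<notin> wregs P"
    and "\<And>i s v. Inv i s \<Longrightarrow> Inv i (s\<lparr>regs := (regs s)(r := v)\<rparr>)"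
  shows "triple (Inv 0) (for_dim r P) (2 + real n * (\<tau> + 2)) (Inv n)"
  using triple_count_loop[of n Inv r P \<tau> "NLess (NReg r) NDim", OF assms]
  by (simp add: dim_I algebra_simps)

lemma triple_for_real:
  assumes val: "\<And>s. rval I s a = B" "\<And>s. rcells I s a = {}"
    and "\<And>i. i < nat \<lceil>B\<rceil> \<Longrightarrow> triple (\<lambda>s. Inv i s \<and> regs s r = i) P \<tau> (Inv (Suc i))"
    and "r \<notin> wregs P"
    and "\<And>i s v. Inv i s \<Longrightarrow> Inv i (s\<lparr>regs := (regs s)(r := v)\<rparr>)"
  shows "triple (Inv 0) (for_real r a P) (3 + rcost a + real (nat \<lceil>B\<rceil>) * (rcost a + \<tau> + 3)) (Inv (nat \<lceil>B\<rceil>))"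
  using triple_count_loop[of "nat \<lceil>B\<rceil>" Inv r P \<tau> "RLess (RNat (NReg r)) a", OF assms(3-5)]
  by (simp add: val real_less_iff_nat_ceiling algebra_simps)

section \<open>Three-vector states and rules for the elementary commands\<close>

definition st ::
  "(nat \<Rightarrow> real) \<Rightarrow> (nat \<Rightarrow> real) \<Rightarrow> (nat \<Rightarrow> real) \<Rightarrow> nat \<Rightarrow> nat \<Rightarrow> nat \<Rightarrow> nat \<Rightarrow> nat \<Rightarrow> state \<Rightarrow> bool" where
  "st Z V X d t b j l s \<longleftrightarrow>
     (\<forall>i<n. mem s i = Z i \<and> mem s (n + i) = V i \<and> mem s (2 * n + i) = X i) \<and>
     draws s = d \<and> regs s 0 = t \<and> regs s 1 = b \<and> regs s 2 = j \<and> regs s 4 = l"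

text \<open>The coordinate counter, register 4, is hidden, and the counter of power steps, register
  3, is not recorded by \<open>st\<close> at all, so these loops leave the description
  intact.\<close>

abbreviation stx ::
  "(nat \<Rightarrow> real) \<Rightarrow> (nat \<Rightarrow> real) \<Rightarrow> (nat \<Rightarrow> real) \<Rightarrow> nat \<Rightarrow> nat \<Rightarrow> nat \<Rightarrow> nat \<Rightarrow> state \<Rightarrow> bool" where
  "stx Z V X d t b j s \<equiv> (\<exists>l. st Z V X d t b j l s)"

lemma st_cong:
  assumes "\<And>i. i < n \<Longrightarrow> Z i = Z' i" "\<And>i. i < n \<Longrightarrow> V i = V' i" "\<And>i. i < n \<Longrightarrow> X i = X' i"
  shows "st Z V X d t b j l s \<longleftrightarrow> st Z' V' X' d t b j l s"
  using assms by (simp add: st_def)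

lemma st_eval:
  assumes "st Z V X d t b j l s"
  shows "regs s 0 = t" "regs s 1 = b" "regs s 2 = j" "regs s 4 = l" "draws s = d"
    "regs s r < n \<Longrightarrow> mem s (addr I s 0 (NReg r)) = Z (regs s r)"
    "regs s r < n \<Longrightarrow> mem s (addr I s 1 (NReg r)) = V (regs s r)"
    "regs s r < n \<Longrightarrow> mem s (addr I s 2 (NReg r)) = X (regs s r)"
    "regs s (Suc 0) = b" "regs s r < n \<Longrightarrow> mem s (addr I s (Suc 0) (NReg r)) = V (regs s r)"
    "k \<le> 2 \<Longrightarrow> regs s r < n \<Longrightarrow> addr I s k (NReg r) < 3 * n"
proof -
  show "addr I s k (NReg r) < 3 * n" if "k \<le> 2" "regs s r < n"
  proof -
    have "k * n \<le> 2 * n" using that by simp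
    then show ?thesis using that(2) unfolding addr_def dim_I nval.simps by linarith
  qed
qed (use assms in \<open>auto simp: st_def addr_def dim_I\<close>)

lemma triple_Store0:
  assumes "\<And>s. st Z V X d t b j l s \<Longrightarrow> regs s r = i \<and> rval I s a = x \<and> rcells I s a \<subseteq> {..<3 * n}"
    and "i < n"
  shows "triple (st Z V X d t b j l) (Store 0 (NReg r) a) (1 + rcost a) (st (Z(i := x)) V X d t b j l)"
proof (rule tripleI)
  fix s assume s: "st Z V X d t b j l s"
  note a = assms(1)[OF s]
  have "st (Z(i := x)) V X d t b j l (s\<lparr>mem := (mem s)(addr I s 0 (NReg r) := rval I s a)\<rparr>)"
    using s a assms(2) by (auto simp: st_def addr_def dim_I)
  then show "\<exists>t' A s'. exec I \<omega> (Store 0 (NReg r) a) s t' A s' \<and> t' \<le> 1 + rcost a \<and> A \<subseteq> {..<3 * n} \<and>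
      st (Z(i := x)) V X d t b j l s'"
    using exec.Store[of I \<omega> 0 "NReg r" a s] a assms(2)
    by (intro exI conjI) (assumption | auto simp: addr_def)+
qed

lemma triple_Store1:
  assumes "\<And>s. st Z V X d t b j l s \<Longrightarrow> regs s r = i \<and> rval I s a = x \<and> rcells I s a \<subseteq> {..<3 * n}"
    and "i < n"
  shows "triple (st Z V X d t b j l) (Store 1 (NReg r) a) (1 + rcost a) (st Z (V(i := x)) X d t b j l)"
proof (rule tripleI)
  fix s assume s: "st Z V X d t b j l s"
  note a = assms(1)[OF s]
  have "st Z (V(i := x)) X d t b j l (s\<lparr>mem := (mem s)(addr I s 1 (NReg r) := rval I s a)\<rparr>)"
    using s a assms(2) by (auto simp: st_def addr_def dim_I)
  then show "\<exists>t' A s'. exec I \<omega> (Store 1 (NReg r) a) s t' A s' \<and> t' \<le> 1 + rcost a \<and> A \<subseteq> {..<3 * n} \<and>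
      st Z (V(i := x)) X d t b j l s'"
    using exec.Store[of I \<omega> 1 "NReg r" a s] a assms(2)
    by (intro exI conjI) (assumption | auto simp: addr_def dim_I)+
qed

lemma triple_Store2:
  assumes "\<And>s. st Z V X d t b j l s \<Longrightarrow> regs s r = i \<and> rval I s a = x \<and> rcells I s a \<subseteq> {..<3 * n}"
    and "i < n"
  shows "triple (st Z V X d t b j l) (Store 2 (NReg r) a) (1 + rcost a) (st Z V (X(i := x)) d t b j l)"
proof (rule tripleI)
  fix s assume s: "st Z V X d t b j l s"
  note a = assms(1)[OF s]
  have "st Z V (X(i := x)) d t b j l (s\<lparr>mem := (mem s)(addr I s 2 (NReg r) := rval I s a)\<rparr>)"
    using s a assms(2) by (auto simp: st_def addr_def dim_I)
  then show "\<exists>t' A s'. exec I \<omega> (Store 2 (NReg r) a) s t' A s' \<and> t' \<le> 1 + rcost a \<and> A \<subseteq> {..<3 * n} \<and>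
      st Z V (X(i := x)) d t b j l s'"
    using exec.Store[of I \<omega> 2 "NReg r" a s] a assms(2)
    by (intro exI conjI) (assumption | auto simp: addr_def dim_I)+
qed

lemma triple_Gauss2:
  assumes "\<And>s. st Z V X d t b j l s \<Longrightarrow> regs s r = i" and "i < n"
  shows "triple (st Z V X d t b j l) (Gauss 2 (NReg r)) 1 (st Z V (X(i := \<omega> d)) (Suc d) t b j l)"
proof (rule tripleI)
  fix s assume s: "st Z V X d t b j l s"
  note a = assms(1)[OF s]
  have "st Z V (X(i := \<omega> d)) (Suc d) t b j l
      (s\<lparr>mem := (mem s)(addr I s 2 (NReg r) := \<omega> (draws s)), draws := Suc (draws s)\<rparr>)"
    using s a assms(2) by (auto simp: st_def addr_def dim_I)
  then show "\<exists>t' A s'. exec I \<omega> (Gauss 2 (NReg r)) s t' A s' \<and> t' \<le> 1 \<and> A \<subseteq> {..<3 * n} \<and>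
      st Z V (X(i := \<omega> d)) (Suc d) t b j l s'"
    using exec.Gauss[of I \<omega> 2 "NReg r" s] a assms(2)
    by (intro exI conjI) (assumption | auto simp: addr_def dim_I)+
qed

lemma triple_Copy:
  assumes "\<And>s. Q s \<Longrightarrow> R (s\<lparr>regs := (regs s)(r := nval I s e)\<rparr>)"
  shows "triple Q (Copy r e) 1 R"
proof (rule tripleI)
  fix s assume "Q s"
  then show "\<exists>t A s'. exec I \<omega> (Copy r e) s t A s' \<and> t \<le> 1 \<and> A \<subseteq> {..<3 * n} \<and> R s'"
    using exec.Copy[of I \<omega> r e s] assms by (intro exI conjI) (assumption | auto)+
qed

lemma triple_Skip:
  assumes "\<And>s. Q s \<Longrightarrow> R s"
  shows "triple Q Skip 1 R"
proof (rule tripleI)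
  fix s assume "Q s"
  then show "\<exists>t A s'. exec I \<omega> Skip s t A s' \<and> t \<le> 1 \<and> A \<subseteq> {..<3 * n} \<and> R s'"
    using exec.Skip[of I \<omega> s] assms by (intro exI conjI) (assumption | auto)+
qed

lemma triple_MatVec:
  assumes "cost_mat I \<in> carrier_mat n n"
  shows "triple (st Z V X d t b j l) (MatVec 2 2) (mvc I)
    (st Z V (\<lambda>i. \<Sum>k<n. cost_mat I $$ (i, k) * X k) d t b j l)"
proof (rule tripleI)
  fix s assume s: "st Z V X d t b j l s"
  let ?v = "cost_mat I *\<^sub>v read_vec I s 2"
  have v: "?v $ i = (\<Sum>k<n. cost_mat I $$ (i, k) * X k)" if "i < n" for i
    using that assms s by (auto simp: read_vec_def scalar_prod_def dim_I st_def atLeast0LessThan intro!: sum.cong)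
  have "st Z V (\<lambda>i. \<Sum>k<n. cost_mat I $$ (i, k) * X k) d t b j l (write_vec I 2 ?v s)"
    using s v by (auto simp: st_def write_vec_def block_def dim_I)
  moreover have "block I 2 \<union> block I 2 \<subseteq> {..<3 * n}" by (auto simp: block_def dim_I)
  ultimately show "\<exists>t' A s'. exec I \<omega> (MatVec 2 2) s t' A s' \<and> t' \<le> mvc I \<and> A \<subseteq> {..<3 * n} \<and>
      st Z V (\<lambda>i. \<Sum>k<n. cost_mat I $$ (i, k) * X k) d t b j l s'"
    using exec.MatVec[of I \<omega> 2 2 s] by (intro exI conjI) (assumption | auto)+
qed

end

section \<open>Approximation ratio of the rounded vector\<close>

lemma sum_lessThan_add: "(\<Sum>k<a + b. f k) = (\<Sum>k<a. f k) + (\<Sum>k<b. f (a + k))"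
  for a b :: nat and f :: "nat \<Rightarrow> real"
  by (induction b) simp_all

locale maxcut_params = dd_matrix n c for n :: nat and c :: "nat \<Rightarrow> nat \<Rightarrow> real" +
  fixes \<epsilon> :: real
  assumes eps: "0 < \<epsilon>" "\<epsilon> < 1"
begin

abbreviation \<eta> :: real where "\<eta> \<equiv> \<epsilon> / 4"

definition steps :: nat where "steps = nat \<lceil>ln (2 * real n) / \<eta>\<rceil>"

definition rounds :: nat where "rounds = nat \<lceil>real n * ln (2 * real n) / (\<eta> * \<eta>)\<rceil>"

definition final_diag :: "nat \<Rightarrow> real" where "final_diag = diagonal \<eta> steps rounds"

definition final_max :: real where "final_max = final_diag (argmax_upto final_diag n)"

text \<open>Coefficients of the output as linear forms in the random numbers; the padding by independent
  noise makes all variances equal to \<open>final_max\<close>.\<close>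

definition coef :: "nat \<Rightarrow> nat \<Rightarrow> real" where
  "coef i k = (if k < rounds then update_vec \<eta> steps k i
     else if k = rounds + i then sqrt (final_max - final_diag i) else 0)"

definition rounded :: "(nat \<Rightarrow> real) \<Rightarrow> nat \<Rightarrow> real" where
  "rounded \<omega> i = sgn1 (\<Sum>k<rounds + n. coef i k * \<omega> k)"

lemma final_diag_le: "i < n \<Longrightarrow> final_diag i \<le> final_max"
  unfolding final_max_def by (rule argmax_upto_max)

text \<open>The sequence \<open>f\<close> is a row of coefficients in the covariance computations
  and the random sequence in the correctness proof.\<close>

lemma sum_coef:
  assumes "i < n"
  shows "(\<Sum>k<rounds + n. coef i k * f k)
    = (\<Sum>k<rounds. update_vec \<eta> steps k i * f k) + sqrt (final_max - final_diag i) * f (rounds + i)"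
proof -
  have "(\<Sum>k<n. coef i (rounds + k) * f (rounds + k))
      = (\<Sum>k<n. if k = i then sqrt (final_max - final_diag i) * f (rounds + i) else 0)"
    by (intro sum.cong) (auto simp: coef_def)
  then show ?thesis using assms by (simp add: sum_lessThan_add coef_def)
qed

text \<open>Entries of the accumulated matrix, of which the program stores only the
  diagonal.\<close>

definition gram :: "nat \<Rightarrow> nat \<Rightarrow> real" where
  "gram i j = (\<Sum>k<rounds. update_vec \<eta> steps k i * update_vec \<eta> steps k j)"

lemma coef_norm: "i < n \<Longrightarrow> (\<Sum>k<rounds + n. (coef i k)\<^sup>2) = final_max"
proof -
  assume i: "i < n"
  have "(\<Sum>k<rounds + n. (coef i k)\<^sup>2) = (\<Sum>k<rounds + n. coef i k * coef i k)"
    by (simp add: power2_eq_square)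
  also have "\<dots> = gram i i + (final_max - final_diag i)"
    unfolding sum_coef[OF i] using final_diag_le[OF i] by (simp add: coef_def gram_def)
  also have "gram i i = final_diag i"
    by (simp add: gram_def final_diag_def diagonal_eq_sum power2_eq_square)
  finally show ?thesis by simp
qed

text \<open>Different coordinates are padded with different random numbers, so the noise enlarges
  variances without touching covariances.\<close>

lemma coef_cross:
  assumes "i < n" "j < n" "i \<noteq> j"
  shows "(\<Sum>k<rounds + n. coef i k * coef j k) = gram i j"
  unfolding sum_coef[OF assms(1)] using assms(3) by (simp add: coef_def gram_def)

lemma final_bounds:
  assumes u: "bf u u > 0" "\<And>i. i < n \<Longrightarrow> (u i)\<^sup>2 = 1"
  shows "final_max > 0" "(1 - \<epsilon>) * bf u u * final_max \<le> (\<Sum>i<n. \<Sum>j<n. c i j * gram i j)"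
proof -
  have s: "ln (2 * real n) / \<eta> \<le> real steps" unfolding steps_def by (rule real_nat_ceiling_ge)
  have r: "real n * ln (2 * real n) / \<eta>\<^sup>2 \<le> real rounds"
    unfolding rounds_def power2_eq_square by (rule real_nat_ceiling_ge)
  note sol = approximate_solution[OF eps refl s r u, folded final_diag_def, folded final_max_def]
  show "final_max > 0" by (rule sol(1))
  have "(\<Sum>t<rounds. bf (update_vec \<eta> steps t) (update_vec \<eta> steps t))
      = (\<Sum>i<n. \<Sum>t<rounds. \<Sum>j<n. c i j * update_vec \<eta> steps t i * update_vec \<eta> steps t j)"
    unfolding bf_def by (rule sum.swap)
  also have "\<dots> = (\<Sum>i<n. \<Sum>j<n. \<Sum>t<rounds. c i j * update_vec \<eta> steps t i * update_vec \<eta> steps t j)"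
    by (intro sum.cong refl sum.swap)
  also have "\<dots> = (\<Sum>i<n. \<Sum>j<n. c i j * gram i j)"
    by (simp add: gram_def sum_distrib_left mult.assoc)
  finally show "(1 - \<epsilon>) * bf u u * final_max \<le> (\<Sum>i<n. \<Sum>j<n. c i j * gram i j)"
    using sol(2) by simp
qed

lemma rounded_measurable [measurable]: "(\<lambda>\<omega>. rounded \<omega> i) \<in> borel_measurable gaussians"
  unfolding rounded_def by measurable

lemma rounded_sign: "rounded \<omega> i = 1 \<or> rounded \<omega> i = -1"
  by (simp add: rounded_def sgn1_def)

lemma rounded_integrable: "integrable gaussians (\<lambda>\<omega>. rounded \<omega> i * rounded \<omega> j)"
proof (rule gaussians.integrable_const_bound[where B = 1])
  show "AE \<omega> in gaussians. norm (rounded \<omega> i * rounded \<omega> j) \<le> 1"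
  proof (rule AE_I2)
    fix \<omega> show "norm (rounded \<omega> i * rounded \<omega> j) \<le> 1"
      using rounded_sign[of \<omega> i] rounded_sign[of \<omega> j] by auto
  qed
qed measurable

lemma expectation_rounded:
  "(\<integral>\<omega>. bf (rounded \<omega>) (rounded \<omega>) \<partial>gaussians)
    = (\<Sum>i<n. \<Sum>j<n. c i j * (\<integral>\<omega>. rounded \<omega> i * rounded \<omega> j \<partial>gaussians))"
  by (simp add: bf_def mult.assoc rounded_integrable)

text \<open>The padded matrix has constant diagonal \<open>final_max\<close>, and \<rho> is its
  correlation matrix. Since only the positively weighted diagonal has grown, \<rho> inherits the
  bound for \<open>gram\<close>, and rounding loses at most the factor
  \<open>alpha_GW\<close>.\<close>

lemma approximation_ratio:
  assumes u: "bf u u > 0" "\<And>i. i < n \<Longrightarrow> (u i)\<^sup>2 = 1"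
  shows "alpha_GW * (1 - \<epsilon>) * bf u u \<le> (\<integral>\<omega>. bf (rounded \<omega>) (rounded \<omega>) \<partial>gaussians)"
proof -
  note fm = final_bounds[OF u]
  define \<rho> where "\<rho> i j = (\<Sum>k<rounds + n. coef i k * coef j k) / final_max" for i j
  have e: "(\<integral>\<omega>. rounded \<omega> i * rounded \<omega> j \<partial>gaussians) = 1 - 2 * arccos (\<rho> i j) / pi"
    and \<rho>: "\<bar>\<rho> i j\<bar> \<le> 1" if "i < n" "j < n" for i j
    using expectation_sgn1_product[OF coef_norm[OF that(1)] coef_norm[OF that(2)] fm(1)]
    unfolding rounded_def \<rho>_def by auto
  have diag: "\<rho> i i = 1" if "i < n" for i
    unfolding \<rho>_def using coef_norm[OF that] fm(1) by (simp add: power2_eq_square)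
  have entry: "c i j * gram i j \<le> c i j * (\<rho> i j * final_max)" if "i < n" "j < n" for i j
  proof (cases "i = j")
    case True
    have "gram i i = final_diag i"
      by (simp add: gram_def final_diag_def diagonal_eq_sum power2_eq_square)
    then show ?thesis
      using True diag[OF that(1)] final_diag_le[OF that(1)] diag_pos[OF that(1)]
      by (auto intro!: mult_left_mono)
  next
    case False
    then show ?thesis using coef_cross[OF that] fm(1) by (simp add: \<rho>_def)
  qed
  have "(1 - \<epsilon>) * bf u u * final_max \<le> (\<Sum>i<n. \<Sum>j<n. c i j * gram i j)" by (rule fm(2))
  also have "\<dots> \<le> (\<Sum>i<n. \<Sum>j<n. c i j * (\<rho> i j * final_max))"
    by (intro sum_mono entry) auto
  also have "\<dots> = (\<Sum>i<n. \<Sum>j<n. c i j * \<rho> i j) * final_max"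
    by (simp add: sum_distrib_right mult.assoc)
  finally have "(1 - \<epsilon>) * bf u u \<le> (\<Sum>i<n. \<Sum>j<n. c i j * \<rho> i j)" using fm(1) by simp
  then have "alpha_GW * ((1 - \<epsilon>) * bf u u) \<le> alpha_GW * (\<Sum>i<n. \<Sum>j<n. c i j * \<rho> i j)"
    using alpha_GW_bounds(1) by (rule mult_left_mono)
  also have "\<dots> \<le> (\<Sum>i<n. \<Sum>j<n. c i j * (\<integral>\<omega>. rounded \<omega> i * rounded \<omega> j \<partial>gaussians))"
    by (rule rounding_bound[OF \<rho> e diag])
  finally show ?thesis by (simp add: expectation_rounded mult.assoc)
qed

end

section \<open>Correctness of the program\<close>

locale maxcut_run = maxcut_params n c \<epsilon> + exec_context I \<omega> n
  for n :: nat and c :: "nat \<Rightarrow> nat \<Rightarrow> real" and \<epsilon> :: real and I :: inst and \<omega> :: "nat \<Rightarrow> real" +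
  assumes acc_I: "acc I = \<epsilon>" and mvc_I: "mvc I \<ge> real n"
    and mat_I: "cost_mat I \<in> carrier_mat n n"
    and c_eq: "\<And>i j. i < n \<Longrightarrow> j < n \<Longrightarrow> c i j = cost_mat I $$ (i, j)"
begin

abbreviation pw :: "(nat \<Rightarrow> real) \<Rightarrow> nat \<Rightarrow> real" where "pw V \<equiv> weight \<eta> V"

abbreviation iter :: "(nat \<Rightarrow> real) \<Rightarrow> (nat \<Rightarrow> real) \<Rightarrow> nat \<Rightarrow> real" where
  "iter V X \<equiv> (scaled_mult (pw V) ^^ steps) X"

definition start_moment :: "(nat \<Rightarrow> real) \<Rightarrow> nat \<Rightarrow> real" where
  "start_moment V j = ip (pw V) (unit_at (pw V) j) ((scaled_mult (pw V) ^^ (2 * steps)) (unit_at (pw V) j))"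

lemma mvc_ge: "real n \<le> mvc I" "1 \<le> mvc I"
  using mvc_I n_pos by auto

lemma triple_stx:
  assumes "\<And>l. triple (st Z V X d t b j l) P \<tau> R"
  shows "triple (stx Z V X d t b j) P \<tau> R"
  using assms unfolding triple_def by blast

lemma triple_stx_stx:
  assumes "\<And>l. triple (st Z V X d t b j l) P \<tau> (st Z' V' X' d' t' b' j' l)" "\<tau> \<le> \<tau>'"
  shows "triple (stx Z V X d t b j) P \<tau>' (stx Z' V' X' d' t' b' j')"
  by (rule triple_stx, rule triple_conseq[OF assms(1) _ assms(2)]) auto

lemma triple_at:
  assumes "triple (st Z V X d t b j i) P \<tau> R" "\<tau> \<le> \<tau>'" "\<And>s. R s \<Longrightarrow> R' s"
  shows "triple (\<lambda>s. stx Z V X d t b j s \<and> regs s 4 = i) P \<tau>' R'"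
  by (rule triple_conseq[OF assms(1) _ assms(2)]) (auto simp: st_eval intro: assms(3))

lemma triple_at_stx:
  assumes "triple (st Z V X d t b j i) P \<tau> (st Z' V' X' d' t' b' j' i)" "\<tau> \<le> \<tau>'"
  shows "triple (\<lambda>s. stx Z V X d t b j s \<and> regs s 4 = i) P \<tau>' (stx Z' V' X' d' t' b' j')"
  by (rule triple_at[OF assms]) auto

lemma stx_cong:
  assumes "stx Z V X d t b j s"
    and "\<And>i. i < n \<Longrightarrow> Z i = Z' i" "\<And>i. i < n \<Longrightarrow> V i = V' i" "\<And>i. i < n \<Longrightarrow> X i = X' i"
  shows "stx Z' V' X' d t b j s"
  using assms st_cong[of Z Z' V V' X X'] by blast

lemma triple_post_cong:
  assumes "triple Q P \<tau> (stx Z V X d t b j)"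
    and "\<And>i. i < n \<Longrightarrow> Z i = Z' i" "\<And>i. i < n \<Longrightarrow> V i = V' i" "\<And>i. i < n \<Longrightarrow> X i = X' i"
  shows "triple Q P \<tau> (stx Z' V' X' d t b j)"
  by (rule triple_conseq[OF assms(1)]) (simp_all add: stx_cong[OF _ assms(2-4)])

lemma weight_at_eval:
  assumes "st Z V X d t b j l s" "regs s r < n"
  shows "rval I s (weight_at r) = pw V (regs s r)" "rcells I s (weight_at r) \<subseteq> {..<3 * n}"
  using st_eval[OF assms(1)] assms(2) by (simp_all add: weight_def acc_I)

text \<open>The pattern of the coordinate loops: the invariant describes a vector that is processed
  below the counter and untouched from there on, and the final vector is adjusted outside the first
  \<open>n\<close> entries.\<close>

lemma triple_scale:
  "triple (stx Z V X d t b j)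
     (for_dim 4 (Store 2 (NReg 4) (RDiv (RCell 2 (NReg 4)) (weight_at 4))))
     (2 + real n * 11) (stx Z V (\<lambda>i. X i / pw V i) d t b j)"
proof -
  define Inv where "Inv i = stx Z V (\<lambda>k. if k < i then X k / pw V k else X k) d t b j" for i
  have "triple (Inv 0) (for_dim 4 (Store 2 (NReg 4) (RDiv (RCell 2 (NReg 4)) (weight_at 4))))
     (2 + real n * (9 + 2)) (Inv n)"
  proof (rule triple_for_dim)
    fix i assume i: "i < n"
    let ?X = "\<lambda>k. if k < i then X k / pw V k else X k"
    have "triple (st Z V ?X d t b j i) (Store 2 (NReg 4) (RDiv (RCell 2 (NReg 4)) (weight_at 4)))
        (1 + rcost (RDiv (RCell 2 (NReg 4)) (weight_at 4))) (st Z V (?X(i := X i / pw V i)) d t b j i)"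
    proof (rule triple_Store2)
      fix s assume s: "st Z V ?X d t b j i s"
      then show "regs s 4 = i \<and> rval I s (RDiv (RCell 2 (NReg 4)) (weight_at 4)) = X i / pw V i \<and>
         rcells I s (RDiv (RCell 2 (NReg 4)) (weight_at 4)) \<subseteq> {..<3 * n}"
        using st_eval[OF s] weight_at_eval[OF s, of 4] i by simp
    qed (use i in auto)
    moreover have "?X(i := X i / pw V i) = (\<lambda>k. if k < Suc i then X k / pw V k else X k)"
      by (auto simp: less_Suc_eq fun_eq_iff)
    ultimately show "triple (\<lambda>s. Inv i s \<and> regs s 4 = i)
       (Store 2 (NReg 4) (RDiv (RCell 2 (NReg 4)) (weight_at 4))) 9 (Inv (Suc i))"
      unfolding Inv_def
      by (intro triple_at_stx[where \<tau> = "1 + rcost (RDiv (RCell 2 (NReg 4)) (weight_at 4))"]) simp_all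
  qed (auto simp: Inv_def st_def)
  then show ?thesis
    unfolding Inv_def by (simp, elim triple_post_cong) auto
qed

lemma triple_clear:
  "triple (stx Z V X d t b j) clear_com (2 + real n * 4) (stx Z V (\<lambda>i. 0) d t b j)"
proof -
  define Inv where "Inv i = stx Z V (\<lambda>k. if k < i then 0 else X k) d t b j" for i
  have "triple (Inv 0) clear_com (2 + real n * (2 + 2)) (Inv n)"
    unfolding clear_com_def
  proof (rule triple_for_dim)
    fix i assume i: "i < n"
    let ?X = "\<lambda>k. if k < i then 0 else X k"
    have "triple (st Z V ?X d t b j i) (Store 2 (NReg 4) (RNat (NConst 0)))
        (1 + rcost (RNat (NConst 0))) (st Z V (?X(i := 0)) d t b j i)"
      by (rule triple_Store2) (use i in \<open>auto simp: st_eval\<close>)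
    moreover have "?X(i := 0) = (\<lambda>k. if k < Suc i then 0 else X k)"
      by (auto simp: less_Suc_eq fun_eq_iff)
    ultimately show "triple (\<lambda>s. Inv i s \<and> regs s 4 = i) (Store 2 (NReg 4) (RNat (NConst 0))) 2 (Inv (Suc i))"
      unfolding Inv_def
      by (intro triple_at_stx[where \<tau> = "1 + rcost (RNat (NConst 0))"]) simp_all
  qed (auto simp: Inv_def st_def)
  then show ?thesis
    unfolding Inv_def by (simp, elim triple_post_cong) auto
qed

lemma triple_power:
  "triple (stx Z V X d t b j) power_com (25 * ((real steps + 1) * mvc I)) (stx Z V (iter V X) d t b j)"
proof -
  define Inv where "Inv k = stx Z V ((scaled_mult (pw V) ^^ k) X) d t b j" for k
  let ?body = "Seq (MatVec 2 2) (for_dim 4 (Store 2 (NReg 4) (RDiv (RCell 2 (NReg 4)) (weight_at 4))))"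
  have "triple (Inv 0) power_com
     (3 + rcost (RDiv log_dim eta) + real steps * (rcost (RDiv log_dim eta) + (mvc I + (2 + real n * 11)) + 3)) (Inv steps)"
    unfolding power_com_def steps_def
  proof (rule triple_for_real)
    fix k
    let ?X = "(scaled_mult (pw V) ^^ k) X"
    have "triple (stx Z V ?X d t b j) (MatVec 2 2) (mvc I)
        (stx Z V (\<lambda>i. \<Sum>k<n. cost_mat I $$ (i, k) * ?X k) d t b j)"
      by (rule triple_stx_stx[OF triple_MatVec[OF mat_I]]) simp
    from triple_Seq[OF this triple_scale]
    have "triple (stx Z V ?X d t b j) ?body (mvc I + (2 + real n * 11))
       (stx Z V (\<lambda>i. (\<Sum>k<n. cost_mat I $$ (i, k) * ?X k) / pw V i) d t b j)" .
    then show "triple (\<lambda>s. Inv k s \<and> regs s 3 = k) ?body (mvc I + (2 + real n * 11)) (Inv (Suc k))"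
      unfolding Inv_def
    proof (rule triple_conseq)
      fix s assume "stx Z V (\<lambda>i. (\<Sum>k<n. cost_mat I $$ (i, k) * ?X k) / pw V i) d t b j s"
      then show "stx Z V ((scaled_mult (pw V) ^^ Suc k) X) d t b j s"
        by (rule stx_cong) (auto simp: scaled_mult_def c_eq)
    qed auto
  qed (auto simp: Inv_def st_def count_loop_def acc_I dim_I)
  moreover have "3 + rcost (RDiv log_dim eta) + real steps * (rcost (RDiv log_dim eta) + (mvc I + (2 + real n * 11)) + 3)
      \<le> 25 * ((real steps + 1) * mvc I)"
  proof -
    \<comment> \<open>Evaluating the loop bound costs 8. As \<open>mvc I\<close> is at least 1 and
      at least \<open>n\<close>, a step costs at most 8 + 1 + 2 + 11 + 3 = 25 times
      \<open>mvc I\<close>.\<close>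
    have "real steps * (rcost (RDiv log_dim eta) + (mvc I + (2 + real n * 11)) + 3) \<le> real steps * (25 * mvc I)"
      using mvc_ge by (intro mult_left_mono) auto
    then show ?thesis using mvc_ge by (simp add: algebra_simps)
  qed
  ultimately show ?thesis by (elim triple_conseq) (auto simp: Inv_def)
qed

lemma triple_start:
  assumes "b < n"
  shows "triple (stx Z V (\<lambda>i. 0) d t b j) (Store 2 (NReg 1) (RDiv (RNat (NConst 1)) (RSqrt (weight_at 1)))) 10
    (stx Z V (unit_at (pw V) b) d t b j)"
proof -
  let ?a = "RDiv (RNat (NConst 1)) (RSqrt (weight_at 1))"
  have "triple (st Z V (\<lambda>i. 0) d t b j l) (Store 2 (NReg 1) ?a) (1 + rcost ?a)
     (st Z V ((\<lambda>i. 0)(b := 1 / sqrt (pw V b))) d t b j l)" for l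
  proof (rule triple_Store2)
    fix s assume s: "st Z V (\<lambda>i. 0) d t b j l s"
    show "regs s 1 = b \<and> rval I s ?a = 1 / sqrt (pw V b) \<and> rcells I s ?a \<subseteq> {..<3 * n}"
      using st_eval[OF s] weight_at_eval[OF s, of 1] assms by simp
  qed (rule assms)
  moreover have "(\<lambda>i. 0)(b := 1 / sqrt (pw V b)) = unit_at (pw V) b"
    by (auto simp: unit_at_def)
  ultimately show ?thesis by (intro triple_stx_stx[where \<tau> = "1 + rcost ?a"]) simp_all
qed

text \<open>The new best start is the recursion step of \<open>argmax_upto\<close>. Block 2 ends
  with an unspecified vector, which the next user clears.\<close>

lemma triple_compare:
  assumes b: "b < n" and j: "j < n"
  shows "triple (stx Z V X d t b j) compare_com (100 * ((real steps + 1) * mvc I))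
    (\<lambda>s. \<exists>X'. stx Z V X' d t (if start_moment V b < start_moment V j then j else b) j s)"
proof -
  let ?p = "pw V"
  let ?a = "RSub (RCell 2 (NReg 2)) (RDiv (RNat (NConst 1)) (RSqrt (weight_at 2)))"
  let ?b = "RLess (RAdd (RMul (RCell 2 (NReg 1)) (RSqrt (weight_at 1)))
                     (RMul (RCell 2 (NReg 2)) (RSqrt (weight_at 2)))) (RNat (NConst 0))"
  let ?u = "unit_at ?p b" and ?w = "\<lambda>i. unit_at ?p b i - unit_at ?p j i"
  let ?best = "if start_moment V b < start_moment V j then j else b"
  have sub: "triple (stx Z V ?u d t b j) (Store 2 (NReg 2) ?a) 12 (stx Z V ?w d t b j)"
  proof -
    have "triple (st Z V ?u d t b j l) (Store 2 (NReg 2) ?a) (1 + rcost ?a)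
       (st Z V (?u(j := ?u j - 1 / sqrt (?p j))) d t b j l)" for l
    proof (rule triple_Store2)
      fix s assume s: "st Z V ?u d t b j l s"
      show "regs s 2 = j \<and> rval I s ?a = ?u j - 1 / sqrt (?p j) \<and> rcells I s ?a \<subseteq> {..<3 * n}"
        using st_eval[OF s] weight_at_eval[OF s, of 2] j by simp
    qed (rule j)
    moreover have "?u(j := ?u j - 1 / sqrt (?p j)) = ?w"
      by (auto simp: unit_at_def)
    ultimately show ?thesis by (intro triple_stx_stx[where \<tau> = "1 + rcost ?a"]) simp_all
  qed
  let ?x = "iter V (iter V ?w)"
  have x: "?x = (scaled_mult ?p ^^ (2 * steps)) ?w" by (simp add: mult_2 funpow_add)
  have p: "\<And>i. i < n \<Longrightarrow> ?p i > 0" by (rule weight_pos)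
  have test: "?x b * sqrt (?p b) + ?x j * sqrt (?p j) = start_moment V b - start_moment V j"
    unfolding x start_moment_def by (rule tournament_test[OF p b j])
  have cond: "cval I s ?b \<longleftrightarrow> start_moment V b < start_moment V j" "ccells I s ?b \<subseteq> {..<3 * n}"
    if s: "st Z V ?x d t b j l s" for s l
    using st_eval[OF s] weight_at_eval[OF s, of 1] weight_at_eval[OF s, of 2] test b j by auto
  have fin: "triple (stx Z V ?x d t b j) (If ?b (Copy 1 (NReg 2)) Skip) (ccost ?b + 1)
     (\<lambda>s. \<exists>X'. stx Z V X' d t ?best j s)"
  proof (rule triple_If)
    show "triple (\<lambda>s. stx Z V ?x d t b j s \<and> cval I s ?b) (Copy 1 (NReg 2)) 1 (\<lambda>s. \<exists>X'. stx Z V X' d t ?best j s)"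
    proof (rule triple_Copy)
      fix s assume "stx Z V ?x d t b j s \<and> cval I s ?b"
      then obtain l where s: "st Z V ?x d t b j l s" and "cval I s ?b" by blast
      then have "?best = j" using cond by simp
      moreover have "st Z V ?x d t j j l (s\<lparr>regs := (regs s)(1 := nval I s (NReg 2))\<rparr>)"
        using s by (simp add: st_def)
      ultimately show "\<exists>X'. stx Z V X' d t ?best j (s\<lparr>regs := (regs s)(1 := nval I s (NReg 2))\<rparr>)" by auto
    qed
    show "triple (\<lambda>s. stx Z V ?x d t b j s \<and> \<not> cval I s ?b) Skip 1 (\<lambda>s. \<exists>X'. stx Z V X' d t ?best j s)"
    proof (rule triple_Skip)
      fix s assume "stx Z V ?x d t b j s \<and> \<not> cval I s ?b"
      then obtain l where s: "st Z V ?x d t b j l s" and "\<not> cval I s ?b" by blast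
      then have "?best = b" using cond by simp
      with s show "\<exists>X'. stx Z V X' d t ?best j s" by auto
    qed
  qed (use cond in blast)
  note seq = triple_Seq[OF triple_clear triple_Seq[OF triple_start[OF b]
      triple_Seq[OF sub triple_Seq[OF triple_power triple_Seq[OF triple_power fin]]]]]
  define W where "W = real steps * mvc I"
  have W: "0 \<le> W" using mvc_ge by (simp add: W_def)
  have U: "(real steps + 1) * mvc I = W + mvc I" by (simp add: W_def algebra_simps)
  show ?thesis
    unfolding compare_com_def using mvc_ge W unfolding U
    by (intro triple_conseq[OF seq[unfolded U]]) auto
qed

lemma argmax_upto_less_n: "k \<le> n \<Longrightarrow> argmax_upto f k < n"
  using argmax_upto_less[of f k] n_pos by auto

lemma triple_tournament:
  "triple (stx Z V X d t b j) tournament_com (105 * (real n * ((real steps + 1) * mvc I)))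
    (\<lambda>s. \<exists>X' j'. stx Z V X' d t (best_start (pw V) steps) j' s)"
proof -
  define Inv where "Inv k s \<longleftrightarrow> (\<exists>X' j'. stx Z V X' d t (argmax_upto (start_moment V) k) j' s)" for k s
  define U where "U = (real steps + 1) * mvc I"
  have init: "triple (stx Z V X d t b j) (Copy 1 (NConst 0)) 1 (Inv 0)"
    by (rule triple_Copy) (auto simp: Inv_def st_def)
  have "triple (Inv 0) (for_dim 2 compare_com) (2 + real n * (100 * U + 2)) (Inv n)"
  proof (rule triple_for_dim)
    fix k assume k: "k < n"
    have "triple (stx Z V X' d t (argmax_upto (start_moment V) k) k) compare_com (100 * U) (Inv (Suc k))" for X'
      unfolding Inv_def using k argmax_upto_less_n[of k "start_moment V"]
      by (intro triple_conseq[OF triple_compare]) (auto simp: U_def split: if_splits)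
    then show "triple (\<lambda>s. Inv k s \<and> regs s 2 = k) compare_com (100 * U) (Inv (Suc k))"
      unfolding triple_def Inv_def using st_eval(3) by metis
  next
    show "2 \<notin> wregs compare_com"
      by (simp add: compare_com_def clear_com_def power_com_def count_loop_def)
    show "Inv i (s\<lparr>regs := (regs s)(2 := v)\<rparr>)" if "Inv i s" for i s v
      using that unfolding Inv_def by (auto simp: st_def)
  qed
  note seq = triple_Seq[OF init this]
  have "1 * 1 \<le> (real steps + 1) * mvc I" using mvc_ge by (intro mult_mono) auto
  then have U: "1 \<le> U" by (simp add: U_def)
  have "1 * 1 \<le> real n * U" using U n_pos by (intro mult_mono) auto
  moreover have "real n * 1 \<le> real n * U" using U by (intro mult_left_mono) auto
  moreover have "real n * (100 * U + 2) = 100 * (real n * U) + 2 * real n" by (simp add: algebra_simps)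
  ultimately have cost: "1 + (2 + real n * (100 * U + 2)) \<le> 105 * (real n * U)" by linarith
  have "argmax_upto (start_moment V) n = best_start (pw V) steps"
    by (simp add: best_start_def start_moment_def[abs_def])
  then show ?thesis
    unfolding tournament_com_def using cost
    by (intro triple_conseq[OF seq]) (auto simp: Inv_def U_def)
qed

lemma triple_argmax:
  assumes a: "\<And>r s l j. st Z V X d t b j l s \<Longrightarrow> regs s r < n \<Longrightarrow>
      rval I s (a r) = f (regs s r) \<and> rcells I s (a r) \<subseteq> {..<3 * n}"
    and cost: "\<And>r. rcost (a r) \<le> 3"
  shows "triple (stx Z V X d t b j) (argmax_com a) (3 + real n * 10) (stx Z V X d t b (argmax_upto f n))"
proof -
  define Inv where "Inv k = stx Z V X d t b (argmax_upto f k)" for k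
  have init: "triple (stx Z V X d t b j) (Copy 2 (NConst 0)) 1 (Inv 0)"
    by (rule triple_Copy) (auto simp: Inv_def st_def)
  have "triple (Inv 0) (for_dim 4 (If (RLess (a 2) (a 4)) (Copy 2 (NReg 4)) Skip)) (2 + real n * (8 + 2)) (Inv n)"
  proof (rule triple_for_dim)
    fix k assume k: "k < n"
    let ?j = "argmax_upto f k"
    have j: "?j < n" using k by (intro argmax_upto_less_n) simp
    let ?b = "RLess (a 2) (a 4)"
    have cond: "cval I s ?b \<longleftrightarrow> f ?j < f k" "ccells I s ?b \<subseteq> {..<3 * n}" if s: "st Z V X d t b ?j k s" for s
      using st_eval[OF s] a[OF s, of 2] a[OF s, of 4] j k by auto
    have "triple (st Z V X d t b ?j k) (If ?b (Copy 2 (NReg 4)) Skip) (ccost ?b + 1) (Inv (Suc k))"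
    proof (rule triple_If)
      show "triple (\<lambda>s. st Z V X d t b ?j k s \<and> cval I s ?b) (Copy 2 (NReg 4)) 1 (Inv (Suc k))"
      proof (rule triple_Copy)
        fix s assume s: "st Z V X d t b ?j k s \<and> cval I s ?b"
        then have "f ?j < f k" using cond(1) by blast
        then have "argmax_upto f (Suc k) = k" by simp
        moreover have "st Z V X d t b k k (s\<lparr>regs := (regs s)(2 := nval I s (NReg 4))\<rparr>)"
          using s by (simp add: st_def)
        ultimately show "Inv (Suc k) (s\<lparr>regs := (regs s)(2 := nval I s (NReg 4))\<rparr>)"
          unfolding Inv_def by metis
      qed
      show "triple (\<lambda>s. st Z V X d t b ?j k s \<and> \<not> cval I s ?b) Skip 1 (Inv (Suc k))"
      proof (rule triple_Skip)
        fix s assume s: "st Z V X d t b ?j k s \<and> \<not> cval I s ?b"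
        then have "\<not> f ?j < f k" using cond(1) by blast
        then have "argmax_upto f (Suc k) = ?j" by simp
        with s show "Inv (Suc k) s" unfolding Inv_def by metis
      qed
    qed (use cond in blast)
    then show "triple (\<lambda>s. Inv k s \<and> regs s 4 = k) (If ?b (Copy 2 (NReg 4)) Skip) 8 (Inv (Suc k))"
      unfolding Inv_def[of k] using cost[of 2] cost[of 4] by (intro triple_at) auto
  qed (auto simp: Inv_def st_def)
  note seq = triple_Seq[OF init this]
  show ?thesis
    unfolding argmax_com_def by (intro triple_conseq[OF seq]) (auto simp: Inv_def)
qed

lemma same_reg_eval:
  assumes "st Z V X d t b j l s"
  shows "cval I s (same_reg 4 2) \<longleftrightarrow> l = j" "ccells I s (same_reg 4 2) = {}"
  using st_eval[OF assms] by auto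

lemma triple_normalise:
  fixes X :: "nat \<Rightarrow> real"
  assumes j: "j < n"
  defines "y \<equiv> \<lambda>i. if i = j then 1 else X i / X j"
  shows "triple (stx Z V X d t b j) normalise_com (2 + real n * 18)
    (stx Z (\<lambda>i. V i + (y i)\<^sup>2) (\<lambda>i. if i = j then X j else y i) d t b j)"
proof -
  let ?V = "\<lambda>i k. if k < i then V k + (y k)\<^sup>2 else V k"
  let ?X = "\<lambda>i k. if k < i then (if k = j then X j else y k) else X k"
  define Inv where "Inv i = stx Z (?V i) (?X i) d t b j" for i
  let ?P1 = "Store 1 (NReg 4) (RAdd (RCell 1 (NReg 4)) (RNat (NConst 1)))"
  let ?P2 = "Store 2 (NReg 4) (RDiv (RCell 2 (NReg 4)) (RCell 2 (NReg 2)))"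
  let ?P3 = "Store 1 (NReg 4) (RAdd (RCell 1 (NReg 4)) (RMul (RCell 2 (NReg 4)) (RCell 2 (NReg 4))))"
  have "triple (Inv 0) normalise_com (2 + real n * (16 + 2)) (Inv n)"
    unfolding normalise_com_def
  proof (rule triple_for_dim)
    fix i assume i: "i < n"
    have "triple (st Z (?V i) (?X i) d t b j i) (If (same_reg 4 2) ?P1 (Seq ?P2 ?P3)) (ccost (same_reg 4 2) + 10)
      (Inv (Suc i))"
    proof (rule triple_If)
      show "triple (\<lambda>s. st Z (?V i) (?X i) d t b j i s \<and> cval I s (same_reg 4 2)) ?P1 10 (Inv (Suc i))"
      proof (cases "i = j")
        case True
        have "triple (st Z (?V i) (?X i) d t b j i) ?P1 (1 + rcost (RAdd (RCell 1 (NReg 4)) (RNat (NConst 1))))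
            (st Z ((?V i)(i := V i + 1)) (?X i) d t b j i)"
          by (rule triple_Store1) (use i in \<open>auto simp: st_eval\<close>)
        moreover have "(?V i)(i := V i + 1) = ?V (Suc i)" "?X i = ?X (Suc i)"
          using True by (auto simp: less_Suc_eq fun_eq_iff y_def)
        ultimately have "triple (st Z (?V i) (?X i) d t b j i) ?P1 (1 + rcost (RAdd (RCell 1 (NReg 4)) (RNat (NConst 1))))
            (st Z (?V (Suc i)) (?X (Suc i)) d t b j i)" by (simp only:)
        then show ?thesis unfolding Inv_def by (elim triple_conseq) auto
      next
        case False
        \<comment> \<open>The guard contradicts the counter, so the triple holds vacuously.\<close>
        then show ?thesis unfolding triple_def using same_reg_eval(1) by blast
      qed
      show "triple (\<lambda>s. st Z (?V i) (?X i) d t b j i s \<and> \<not> cval I s (same_reg 4 2)) (Seq ?P2 ?P3) 10 (Inv (Suc i))"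
      proof (cases "i = j")
        case False
        have 1: "triple (st Z (?V i) (?X i) d t b j i) ?P2 (1 + rcost (RDiv (RCell 2 (NReg 4)) (RCell 2 (NReg 2))))
            (st Z (?V i) ((?X i)(i := y i)) d t b j i)"
          by (rule triple_Store2) (use i j False in \<open>auto simp: st_eval y_def\<close>)
        have 2: "triple (st Z (?V i) ((?X i)(i := y i)) d t b j i) ?P3
            (1 + rcost (RAdd (RCell 1 (NReg 4)) (RMul (RCell 2 (NReg 4)) (RCell 2 (NReg 4)))))
            (st Z ((?V i)(i := V i + (y i)\<^sup>2)) ((?X i)(i := y i)) d t b j i)"
          by (rule triple_Store1) (use i in \<open>auto simp: st_eval power2_eq_square\<close>)
        have "(?V i)(i := V i + (y i)\<^sup>2) = ?V (Suc i)" "(?X i)(i := y i) = ?X (Suc i)"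
          using False by (auto simp: less_Suc_eq fun_eq_iff)
        with triple_Seq[OF 1 2] show ?thesis unfolding Inv_def by (elim triple_conseq) auto
      next
        case True
        then show ?thesis unfolding triple_def using same_reg_eval(1) by blast
      qed
    qed (auto simp: same_reg_eval)
    then show "triple (\<lambda>s. Inv i s \<and> regs s 4 = i) (If (same_reg 4 2) ?P1 (Seq ?P2 ?P3)) 16 (Inv (Suc i))"
      unfolding Inv_def[of i] by (intro triple_at) auto
  qed (auto simp: Inv_def st_def)
  then show ?thesis
    unfolding Inv_def by (simp, elim triple_post_cong) auto
qed

lemma triple_sample:
  assumes j: "j < n"
  shows "triple (stx Z V X d t b j) sample_com (3 + real n * 14)
    (\<lambda>s. \<exists>X'. stx (\<lambda>i. Z i + \<omega> d * (if i = j then 1 else X i)) V X' (Suc d) t b j s)"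
proof -
  let ?X = "X(j := \<omega> d)"
  let ?Z = "\<lambda>i k. if k < i then Z k + \<omega> d * (if k = j then 1 else X k) else Z k"
  define Inv where "Inv i = stx (?Z i) V ?X (Suc d) t b j" for i
  let ?a1 = "RAdd (RCell 0 (NReg 4)) (RCell 2 (NReg 2))"
  let ?a2 = "RAdd (RCell 0 (NReg 4)) (RMul (RCell 2 (NReg 4)) (RCell 2 (NReg 2)))"
  have gauss: "triple (stx Z V X d t b j) (Gauss 2 (NReg 2)) 1 (Inv 0)"
  proof (rule triple_stx)
    fix l
    have "triple (st Z V X d t b j l) (Gauss 2 (NReg 2)) 1 (st Z V ?X (Suc d) t b j l)"
      by (rule triple_Gauss2) (use j in \<open>auto simp: st_eval\<close>)
    then show "triple (st Z V X d t b j l) (Gauss 2 (NReg 2)) 1 (Inv 0)"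
      by (rule triple_conseq) (auto simp: Inv_def)
  qed
  have "triple (Inv 0) (for_dim 4 (If (same_reg 4 2) (Store 0 (NReg 4) ?a1) (Store 0 (NReg 4) ?a2)))
     (2 + real n * (12 + 2)) (Inv n)"
  proof (rule triple_for_dim)
    fix i assume i: "i < n"
    have "triple (st (?Z i) V ?X (Suc d) t b j i) (If (same_reg 4 2) (Store 0 (NReg 4) ?a1) (Store 0 (NReg 4) ?a2))
      (ccost (same_reg 4 2) + 6) (Inv (Suc i))"
    proof (rule triple_If)
      show "triple (\<lambda>s. st (?Z i) V ?X (Suc d) t b j i s \<and> cval I s (same_reg 4 2)) (Store 0 (NReg 4) ?a1) 6 (Inv (Suc i))"
      proof (cases "i = j")
        case True
        have "triple (st (?Z i) V ?X (Suc d) t b j i) (Store 0 (NReg 4) ?a1) (1 + rcost ?a1)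
            (st ((?Z i)(i := Z i + \<omega> d)) V ?X (Suc d) t b j i)"
          by (rule triple_Store0) (use i j in \<open>auto simp: st_eval\<close>)
        moreover have "(?Z i)(i := Z i + \<omega> d) = ?Z (Suc i)"
          using True by (auto simp: less_Suc_eq fun_eq_iff)
        ultimately show ?thesis unfolding Inv_def by (elim triple_conseq) auto
      next
        case False
        then show ?thesis unfolding triple_def using same_reg_eval(1) by blast
      qed
      show "triple (\<lambda>s. st (?Z i) V ?X (Suc d) t b j i s \<and> \<not> cval I s (same_reg 4 2)) (Store 0 (NReg 4) ?a2) 6 (Inv (Suc i))"
      proof (cases "i = j")
        case False
        have "triple (st (?Z i) V ?X (Suc d) t b j i) (Store 0 (NReg 4) ?a2) (1 + rcost ?a2)
            (st ((?Z i)(i := Z i + \<omega> d * X i)) V ?X (Suc d) t b j i)"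
          by (rule triple_Store0) (use i j False in \<open>auto simp: st_eval\<close>)
        moreover have "(?Z i)(i := Z i + \<omega> d * X i) = ?Z (Suc i)"
          using False by (auto simp: less_Suc_eq fun_eq_iff)
        ultimately show ?thesis unfolding Inv_def by (elim triple_conseq) auto
      next
        case True
        then show ?thesis unfolding triple_def using same_reg_eval(1) by blast
      qed
    qed (auto simp: same_reg_eval)
    then show "triple (\<lambda>s. Inv i s \<and> regs s 4 = i)
       (If (same_reg 4 2) (Store 0 (NReg 4) ?a1) (Store 0 (NReg 4) ?a2)) 12 (Inv (Suc i))"
      unfolding Inv_def[of i] by (intro triple_at) auto
  qed (auto simp: Inv_def st_def)
  note seq = triple_Seq[OF gauss this]
  show ?thesis
    unfolding sample_com_def
  proof (rule triple_conseq[OF seq])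
    fix s assume "Inv n s"
    then have "stx (\<lambda>i. Z i + \<omega> d * (if i = j then 1 else X i)) V ?X (Suc d) t b j s"
      unfolding Inv_def by (rule stx_cong) auto
    then show "\<exists>X'. stx (\<lambda>i. Z i + \<omega> d * (if i = j then 1 else X i)) V X' (Suc d) t b j s" by blast
  qed auto
qed

end

section \<open>Rounds, output and the complete run\<close>

context maxcut_run
begin

text \<open>Cost of one tournament up to a constant: \<open>n\<close> candidates, each with a
  multiple of \<open>steps + 1\<close> products. It dominates the rest of a round.\<close>

definition unit_cost :: real where
  "unit_cost = real n * ((real steps + 1) * mvc I)"

lemma unit_cost_ge: "1 \<le> unit_cost" "real n \<le> unit_cost" "(real steps + 1) * mvc I \<le> unit_cost"
proof -
  have "1 * 1 \<le> (real steps + 1) * mvc I" using mvc_ge by (intro mult_mono) auto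
  then have U: "1 \<le> (real steps + 1) * mvc I" by simp
  have "real n * 1 \<le> unit_cost" unfolding unit_cost_def using U by (intro mult_left_mono) auto
  then show "real n \<le> unit_cost" by simp
  then show "1 \<le> unit_cost" using n_pos by simp
  have "1 * ((real steps + 1) * mvc I) \<le> unit_cost"
    unfolding unit_cost_def using U n_pos by (intro mult_right_mono) auto
  then show "(real steps + 1) * mvc I \<le> unit_cost" by simp
qed

lemma triple_round:
  defines "y \<equiv> \<lambda>V. direction (pw V) steps"
  shows "triple (stx Z V X d t b j) round_com (200 * unit_cost)
    (\<lambda>s. \<exists>X' b' j'. stx (\<lambda>i. Z i + y V i * \<omega> d) (\<lambda>i. V i + (y V i)\<^sup>2) X' (Suc d) t b' j' s)"
proof -
  let ?b = "best_start (pw V) steps" and ?x = "power_vec (pw V) steps" and ?j = "pivot (pw V) steps"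
  have b: "?b < n" unfolding best_start_def by (rule argmax_less)
  have j: "?j < n" unfolding pivot_def by (rule argmax_less)
  have x: "iter V (unit_at (pw V) ?b) = ?x" by (simp add: power_vec_def)
  have y: "(if i = ?j then 1 else ?x i / ?x ?j) = y V i" for i
    by (simp add: y_def direction_def)
  \<comment> \<open>The pivot cell still holds the unscaled value, but sampling uses 1 in its
    place.\<close>
  have yj: "(if i = ?j then 1 else if i = ?j then ?x ?j else y V i) = y V i" for i
    by (simp add: y_def direction_def)
  have argmax: "triple (stx Z V ?x d t ?b j') (argmax_com (\<lambda>r. RMul (RCell 2 (NReg r)) (RCell 2 (NReg r))))
      (3 + real n * 10) (stx Z V ?x d t ?b ?j)" for j'
    unfolding pivot_def by (rule triple_argmax) (auto simp: st_eval power2_eq_square)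
  note seq = triple_Seq[OF triple_clear triple_Seq[OF triple_start[OF b] triple_Seq[OF triple_power[of Z V "unit_at (pw V) ?b", unfolded x]
      triple_Seq[OF argmax triple_Seq[OF triple_normalise[OF j, of _ _ ?x, unfolded y] 
        triple_sample[OF j, of Z "\<lambda>i. V i + (y V i)\<^sup>2" "\<lambda>i. if i = ?j then ?x ?j else y V i", unfolded yj]]]]]]
  let ?R = "Seq clear_com
    (Seq (Store 2 (NReg 1) (RDiv (RNat (NConst 1)) (RSqrt (weight_at 1))))
    (Seq power_com
    (Seq (argmax_com (\<lambda>r. RMul (RCell 2 (NReg r)) (RCell 2 (NReg r))))
    (Seq normalise_com sample_com))))"
  let ?post = "\<lambda>s. \<exists>X' b' j'. stx (\<lambda>i. Z i + y V i * \<omega> d) (\<lambda>i. V i + (y V i)\<^sup>2) X' (Suc d) t b' j' s"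
  have step: "triple (stx Z V X' d t ?b j') ?R (95 * unit_cost) ?post" for X' j'
  proof (rule triple_conseq[OF seq])
    fix s
    assume "\<exists>X'. stx (\<lambda>i. Z i + \<omega> d * y V i) (\<lambda>i. V i + (y V i)\<^sup>2) X' (Suc d) t ?b ?j s"
    then obtain X' where "stx (\<lambda>i. Z i + \<omega> d * y V i) (\<lambda>i. V i + (y V i)\<^sup>2) X' (Suc d) t ?b ?j s"
      by blast
    then have "stx (\<lambda>i. Z i + y V i * \<omega> d) (\<lambda>i. V i + (y V i)\<^sup>2) X' (Suc d) t ?b ?j s"
      by (rule stx_cong) simp_all
    then show "?post s" by blast
  qed (use unit_cost_ge in simp_all)
  have "triple (\<lambda>s. \<exists>X' j'. stx Z V X' d t ?b j' s) ?R (95 * unit_cost) ?post"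
    by (rule triple_exI, rule triple_exI, rule step)
  from triple_Seq[OF triple_tournament this] show ?thesis
    unfolding round_com_def
    by (simp add: unit_cost_def[symmetric])
qed

text \<open>Round \<open>s\<close> consumes exactly one random number, the one with index
  \<open>s\<close>.\<close>

definition gauss_sum :: "nat \<Rightarrow> nat \<Rightarrow> real" where
  "gauss_sum k i = (\<Sum>s<k. update_vec \<eta> steps s i * \<omega> s)"

lemma triple_rounds:
  "triple (stx (\<lambda>i. 0) (\<lambda>i. 0) X 0 t b j) (for_real 0 (RDiv (RMul (RNat NDim) log_dim) (RMul eta eta)) round_com)
    (217 * ((real rounds + 1) * unit_cost))
    (\<lambda>s. \<exists>X t b j. stx (gauss_sum rounds) (diagonal \<eta> steps rounds) X rounds t b j s)"
proof -
  define Inv where "Inv k s \<longleftrightarrow> (\<exists>X t b j. stx (gauss_sum k) (diagonal \<eta> steps k) X k t b j s)" for k s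
  let ?a = "RDiv (RMul (RNat NDim) log_dim) (RMul eta eta)"
  have loop: "triple (Inv 0) (for_real 0 ?a round_com) (3 + rcost ?a + real rounds * (rcost ?a + 200 * unit_cost + 3)) (Inv rounds)"
    unfolding rounds_def
  proof (rule triple_for_real)
    fix k
    let ?y = "direction (pw (diagonal \<eta> steps k)) steps"
    have step: "triple (stx (gauss_sum k) (diagonal \<eta> steps k) X k t b j) round_com (200 * unit_cost) (Inv (Suc k))" for X t b j
    proof (rule triple_conseq[OF triple_round])
      fix s assume "\<exists>X' b' j'. stx (\<lambda>i. gauss_sum k i + ?y i * \<omega> k) (\<lambda>i. diagonal \<eta> steps k i + (?y i)\<^sup>2) X' (Suc k) t b' j' s"
      then obtain X' b' j' where "stx (\<lambda>i. gauss_sum k i + ?y i * \<omega> k) (\<lambda>i. diagonal \<eta> steps k i + (?y i)\<^sup>2) X' (Suc k) t b' j' s"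
        by blast
      then have "stx (gauss_sum (Suc k)) (diagonal \<eta> steps (Suc k)) X' (Suc k) t b' j' s"
        by (rule stx_cong) (simp_all add: gauss_sum_def update_vec_def)
      then show "Inv (Suc k) s" unfolding Inv_def by blast
    qed auto
    have "triple (\<lambda>s. \<exists>X t b j. stx (gauss_sum k) (diagonal \<eta> steps k) X k t b j s) round_com
        (200 * unit_cost) (Inv (Suc k))"
      by (rule triple_exI, rule triple_exI, rule triple_exI, rule triple_exI, rule step)
    then show "triple (\<lambda>s. Inv k s \<and> regs s 0 = k) round_com (200 * unit_cost) (Inv (Suc k))"
      by (rule triple_conseq) (simp_all add: Inv_def)
  next
    show "0 \<notin> wregs round_com"
      by (simp add: round_com_def tournament_com_def compare_com_def clear_com_def power_com_def argmax_com_def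
          normalise_com_def sample_com_def count_loop_def)
    show "Inv i (s\<lparr>regs := (regs s)(0 := v)\<rparr>)" if "Inv i s" for i s v
      using that unfolding Inv_def by (auto simp: st_def)
  qed (auto simp: acc_I dim_I)
  have cost: "3 + rcost ?a + real rounds * (rcost ?a + 200 * unit_cost + 3) \<le> 217 * ((real rounds + 1) * unit_cost)"
  proof -
    \<comment> \<open>217 = 14 + 200 + 3, where 14 is the cost of evaluating the loop bound.\<close>
    have "real rounds * (rcost ?a + 200 * unit_cost + 3) \<le> real rounds * (217 * unit_cost)"
      using unit_cost_ge by (intro mult_left_mono) auto
    moreover have "3 + rcost ?a \<le> 217 * unit_cost" using unit_cost_ge by simp
    ultimately show ?thesis by (simp add: algebra_simps)
  qed
  have init: "Inv 0 s" if "stx (\<lambda>i. 0) (\<lambda>i. 0) X 0 t b j s" for s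
  proof -
    have "gauss_sum 0 = (\<lambda>i. 0)" by (simp add: gauss_sum_def fun_eq_iff)
    with that have "stx (gauss_sum 0) (diagonal \<eta> steps 0) X 0 t b j s" by simp
    then show ?thesis unfolding Inv_def by blast
  qed
  show ?thesis
    by (rule triple_conseq[OF loop init cost]) (simp_all add: Inv_def)
qed

text \<open>Coordinate \<open>k\<close> is padded with draw \<open>d + k\<close>; for
  \<open>d = rounds\<close> this is the index where \<open>coef\<close> places the padding
  coefficient.\<close>

lemma triple_output:
  fixes V :: "nat \<Rightarrow> real"
  defines "jm \<equiv> argmax_upto V n"
  shows "triple (stx Z V X d t b j) output_com (34 * unit_cost)
    (\<lambda>s. \<exists>X'. stx (\<lambda>k. sgn1 (Z k + sqrt (V jm - V k) * \<omega> (d + k))) V X' (d + n) t b jm s)"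
proof -
  have jm: "jm < n" unfolding jm_def by (rule argmax_less)
  let ?z = "\<lambda>k. Z k + sqrt (V jm - V k) * \<omega> (d + k)"
  let ?Z = "\<lambda>i k. if k < i then sgn1 (?z k) else Z k"
  define Inv where "Inv i s \<longleftrightarrow> (\<exists>X'. stx (?Z i) V X' (d + i) t b jm s)" for i s
  let ?a = "RAdd (RCell 0 (NReg 4)) (RMul (RSqrt (RSub (RCell 1 (NReg 2)) (RCell 1 (NReg 4)))) (RCell 2 (NReg 4)))"
  let ?m1 = "RSub (RNat (NConst 0)) (RNat (NConst 1))" and ?p1 = "RNat (NConst 1)"
  let ?c = "RLess (RCell 0 (NReg 4)) (RNat (NConst 0))"
  let ?If = "If ?c (Store 0 (NReg 4) ?m1) (Store 0 (NReg 4) ?p1)"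
  let ?body = "Seq (Gauss 2 (NReg 4)) (Seq (Store 0 (NReg 4) ?a) ?If)"
  have argmax: "triple (stx Z V X d t b j) (argmax_com (\<lambda>r. RCell 1 (NReg r))) (3 + real n * 10) (stx Z V X d t b jm)"
    unfolding jm_def by (rule triple_argmax) (auto simp: st_eval)
  have "triple (Inv 0) (for_dim 4 ?body) (2 + real n * (17 + 2)) (Inv n)"
  proof (rule triple_for_dim)
    fix i assume i: "i < n"
    have "triple (st (?Z i) V X' (d + i) t b jm i) ?body 17 (Inv (Suc i))" for X'
    proof -
      let ?X = "X'(i := \<omega> (d + i))"
      have 1: "triple (st (?Z i) V X' (d + i) t b jm i) (Gauss 2 (NReg 4)) 1 (st (?Z i) V ?X (Suc (d + i)) t b jm i)"
        by (rule triple_Gauss2) (use i in \<open>auto simp: st_eval\<close>)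
      have 2: "triple (st (?Z i) V ?X (Suc (d + i)) t b jm i) (Store 0 (NReg 4) ?a) (1 + rcost ?a)
          (st ((?Z i)(i := ?z i)) V ?X (Suc (d + i)) t b jm i)"
        by (rule triple_Store0) (use i jm in \<open>auto simp: st_eval\<close>)
      have 3: "triple (st ((?Z i)(i := ?z i)) V ?X (Suc (d + i)) t b jm i) ?If (ccost ?c + 4) (Inv (Suc i))"
      proof (rule triple_If)
        have eq: "(?Z i)(i := sgn1 (?z i)) = ?Z (Suc i)" by (auto simp: less_Suc_eq fun_eq_iff)
        have m1: "triple (st ((?Z i)(i := ?z i)) V ?X (Suc (d + i)) t b jm i) (Store 0 (NReg 4) ?m1) (1 + rcost ?m1)
            (st ((?Z i)(i := ?z i, i := - 1)) V ?X (Suc (d + i)) t b jm i)"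
          by (rule triple_Store0) (use i in \<open>auto simp: st_eval\<close>)
        have p1: "triple (st ((?Z i)(i := ?z i)) V ?X (Suc (d + i)) t b jm i) (Store 0 (NReg 4) ?p1) (1 + rcost ?p1)
            (st ((?Z i)(i := ?z i, i := 1)) V ?X (Suc (d + i)) t b jm i)"
          by (rule triple_Store0) (use i in \<open>auto simp: st_eval\<close>)
        have c: "cval I s ?c \<longleftrightarrow> ?z i < 0" if "st ((?Z i)(i := ?z i)) V ?X (Suc (d + i)) t b jm i s" for s
          using st_eval[OF that] i by simp
        show "triple (\<lambda>s. st ((?Z i)(i := ?z i)) V ?X (Suc (d + i)) t b jm i s \<and> cval I s ?c)
            (Store 0 (NReg 4) ?m1) 4 (Inv (Suc i))"
        proof (cases "?z i < 0")
          case True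
          then have "(?Z i)(i := ?z i, i := - 1) = ?Z (Suc i)" unfolding eq[symmetric] by (simp add: sgn1_def)
          with m1 show ?thesis unfolding Inv_def by (elim triple_conseq) auto
        next
          case False
          then show ?thesis unfolding triple_def using c by blast
        qed
        show "triple (\<lambda>s. st ((?Z i)(i := ?z i)) V ?X (Suc (d + i)) t b jm i s \<and> \<not> cval I s ?c)
            (Store 0 (NReg 4) ?p1) 4 (Inv (Suc i))"
        proof (cases "?z i < 0")
          case False
          then have "(?Z i)(i := ?z i, i := 1) = ?Z (Suc i)" unfolding eq[symmetric] by (simp add: sgn1_def)
          with p1 show ?thesis unfolding Inv_def by (elim triple_conseq) auto
        next
          case True
          then show ?thesis unfolding triple_def using c by blast
        qed
        show "ccells I s ?c \<subseteq> {..<3 * n}" if "st ((?Z i)(i := ?z i)) V ?X (Suc (d + i)) t b jm i s" for s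
          using st_eval[OF that] i by simp
      qed
      show ?thesis by (rule triple_conseq[OF triple_Seq[OF 1 triple_Seq[OF 2 3]]]) auto
    qed
    then have "triple (\<lambda>s. \<exists>X'. st (?Z i) V X' (d + i) t b jm i s) ?body 17 (Inv (Suc i))"
      by (rule triple_exI)
    then show "triple (\<lambda>s. Inv i s \<and> regs s 4 = i) ?body 17 (Inv (Suc i))"
    proof (rule triple_conseq)
      fix s assume "Inv i s \<and> regs s 4 = i"
      then obtain X' l where "st (?Z i) V X' (d + i) t b jm l s" "regs s 4 = i" unfolding Inv_def by blast
      moreover from this have "l = i" using st_eval(4) by blast
      ultimately show "\<exists>X'. st (?Z i) V X' (d + i) t b jm i s" by blast
    qed simp_all
  next
    show "Inv i (s\<lparr>regs := (regs s)(4 := v)\<rparr>)" if "Inv i s" for i s v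
      using that unfolding Inv_def by (auto simp: st_def)
  qed simp
  moreover have "Inv 0 s" if "stx Z V X d t b jm s" for s
    unfolding Inv_def using that by auto
  ultimately have loop: "triple (stx Z V X d t b jm) (for_dim 4 ?body) (2 + real n * 19) (Inv n)"
    by (elim triple_conseq) auto
  show ?thesis
    unfolding output_com_def
  proof (rule triple_conseq[OF triple_Seq[OF argmax loop]])
    fix s assume "Inv n s"
    then obtain X' where "stx (?Z n) V X' (d + n) t b jm s" unfolding Inv_def by blast
    then have "stx (\<lambda>k. sgn1 (?z k)) V X' (d + n) t b jm s" by (rule stx_cong) auto
    then show "\<exists>X'. stx (\<lambda>k. sgn1 (?z k)) V X' (d + n) t b jm s" by blast
  qed (use unit_cost_ge in auto)
qed

lemma run_maxcut:
  "\<exists>t A. run maxcut_com I \<omega> t A (vec n (rounded \<omega>)) \<and> t \<le> 251 * ((real rounds + 1) * unit_cost) \<and> card A \<le> 3 * n"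
proof -
  let ?V = "diagonal \<eta> steps rounds"
  let ?Z = "\<lambda>k. sgn1 (gauss_sum rounds k + sqrt (?V (argmax_upto ?V n) - ?V k) * \<omega> (rounds + k))"
  let ?post = "\<lambda>s. \<exists>X t b j. stx ?Z ?V X (rounds + n) t b j s"
  have step: "triple (stx (gauss_sum rounds) ?V X rounds t b j) output_com (34 * unit_cost) ?post" for X t b j
  proof (rule triple_conseq[OF triple_output])
    fix s assume "\<exists>X'. stx ?Z ?V X' (rounds + n) t b (argmax_upto ?V n) s"
    then show "?post s" by blast
  qed simp_all
  have "triple (\<lambda>s. \<exists>X t b j. stx (gauss_sum rounds) ?V X rounds t b j s) output_com (34 * unit_cost) ?post"
    by (rule triple_exI, rule triple_exI, rule triple_exI, rule triple_exI, rule step)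
  from triple_Seq[OF triple_rounds this]
  have main: "triple (stx (\<lambda>i. 0) (\<lambda>i. 0) (\<lambda>i. 0) 0 0 0 0) maxcut_com
      (217 * ((real rounds + 1) * unit_cost) + 34 * unit_cost) ?post"
    unfolding maxcut_com_def .
  have "stx (\<lambda>i. 0) (\<lambda>i. 0) (\<lambda>i. 0) 0 0 0 0 init_state"
    by (simp add: st_def init_state_def)
  from main this obtain t A s where 1: "exec I \<omega> maxcut_com init_state t A s"
      "t \<le> 217 * ((real rounds + 1) * unit_cost) + 34 * unit_cost" "A \<subseteq> {..<3 * n}" "?post s"
    by (rule tripleD)
  have "?Z k = rounded \<omega> k" if "k < n" for k
    unfolding rounded_def sum_coef[OF that]
    by (simp add: gauss_sum_def final_max_def final_diag_def)
  then have "vec n (rounded \<omega>) = read_vec I s 0"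
    using 1(4) by (auto simp: read_vec_def dim_I st_def)
  then have "run maxcut_com I \<omega> t A (vec n (rounded \<omega>))"
    unfolding run_def using 1(1) by blast
  moreover have "card A \<le> 3 * n" using card_mono[OF _ 1(3)] by simp
  moreover have "0 \<le> real rounds * unit_cost" using unit_cost_ge by simp
  then have "t \<le> 251 * ((real rounds + 1) * unit_cost)" using 1(2) by (simp add: algebra_simps)
  ultimately show ?thesis by blast
qed

text \<open>Additive constants from rounding up are absorbed into the main terms, using ln(2n) \<ge>
  1/2 and ln(4n/\<epsilon>) \<ge> 1. This yields the factors 20 and 6, and 251 * 20 * 6 = 30120. The
  logarithm from the power steps is enlarged to ln(4n/\<epsilon>).\<close>

lemma cost_bound:
  "251 * ((real rounds + 1) * unit_cost)
    \<le> 40000 * (real n ^ 3 / \<epsilon> ^ 3 * ln (2 * real n) * ln (4 * real n / \<epsilon>) * mvc I)"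
proof -
  define l where "l = ln (2 * real n)"
  define L where "L = ln (4 * real n / \<epsilon>)"
  have "ln 2 \<le> l" unfolding l_def using n_pos by (intro ln_mono) auto
  moreover have "1 / 2 \<le> ln (2 :: real)" using ln2_ge_two_thirds by simp
  ultimately have l: "1 / 2 \<le> l" by linarith
  have "2 * real n \<le> 4 * real n / \<epsilon>" using eps n_pos by (simp add: field_simps)
  then have lL: "l \<le> L" unfolding l_def L_def using eps n_pos by (intro ln_mono) auto
  have "exp 1 \<le> (4 :: real)" using exp_le by simp
  also have "4 \<le> 4 * real n / \<epsilon>" using eps n_pos by (simp add: field_simps)
  finally have L: "1 \<le> L" unfolding L_def using eps n_pos by (subst ln_ge_iff) auto
  have n1: "real n \<ge> 1" using n_pos by simp
  have arith: "x + 1 \<le> 20 * w" if "x \<le> 16 * w + 1" "2 \<le> 4 * w" for x w :: real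
    using that by linarith
  have arith': "x + 1 \<le> 6 * w" if "x \<le> 4 * w + 1" "2 \<le> 2 * w" for x w :: real
    using that by linarith
  have r: "real rounds + 1 \<le> 20 * (real n * l / \<epsilon>\<^sup>2)"
  proof -
    have "real rounds \<le> real n * l / (\<eta> * \<eta>) + 1"
      unfolding rounds_def l_def[symmetric] using l n1 eps by simp
    also have "real n * l / (\<eta> * \<eta>) = 16 * (real n * l / \<epsilon>\<^sup>2)" by (simp add: power2_eq_square)
    finally have "real rounds \<le> 16 * (real n * l / \<epsilon>\<^sup>2) + 1" .
    moreover have "2 \<le> 4 * (real n * l / \<epsilon>\<^sup>2)"
    proof -
      have "1 * (1 / 2) \<le> real n * l" using n1 l by (intro mult_mono) auto
      moreover have "\<epsilon>\<^sup>2 \<le> 1" using eps by (simp add: power_le_one)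
      ultimately show ?thesis using eps by (simp add: field_simps)
    qed
    ultimately show ?thesis by (rule arith)
  qed
  have s: "real steps + 1 \<le> 6 * (L / \<epsilon>)"
  proof -
    have "real steps \<le> l / \<eta> + 1"
      unfolding steps_def l_def[symmetric] using l eps by simp
    also have "l / \<eta> = 4 * (l / \<epsilon>)" by simp
    also have "l / \<epsilon> \<le> L / \<epsilon>" using lL eps by (simp add: divide_right_mono)
    finally have "real steps \<le> 4 * (L / \<epsilon>) + 1" by simp
    moreover have "2 \<le> 2 * (L / \<epsilon>)" using L eps by (simp add: field_simps)
    ultimately show ?thesis by (rule arith')
  qed
  have "(real rounds + 1) * unit_cost = (real rounds + 1) * (real steps + 1) * (real n * mvc I)"
    by (simp add: unit_cost_def)
  also have "\<dots> \<le> (20 * (real n * l / \<epsilon>\<^sup>2)) * (6 * (L / \<epsilon>)) * (real n * mvc I)"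
    using r s L l eps n1 mvc_ge by (intro mult_right_mono mult_mono) auto
  also have "\<dots> = 120 * (real n ^ 2 / \<epsilon> ^ 3 * l * L * mvc I)"
    by (simp add: power2_eq_square power3_eq_cube)
  also have "\<dots> \<le> 120 * (real n ^ 3 / \<epsilon> ^ 3 * l * L * mvc I)"
    using n1 eps l L mvc_ge power_increasing[of 2 3 "real n"]
    by (intro mult_left_mono mult_right_mono divide_right_mono) auto
  finally have *: "(real rounds + 1) * unit_cost \<le> 120 * (real n ^ 3 / \<epsilon> ^ 3 * l * L * mvc I)" .
  have "0 \<le> real n ^ 3 / \<epsilon> ^ 3 * l * L * mvc I" using eps l L mvc_ge by simp
  with * show ?thesis unfolding l_def L_def by linarith
qed

end

section \<open>Sign vectors, the optimum and the final assembly\<close>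

lemma finite_sign_vecs: "finite (sign_vecs n)"
proof (rule finite_subset)
  show "sign_vecs n \<subseteq> (\<lambda>f. vec n f) ` ({..<n} \<rightarrow>\<^sub>E {-1, 1})"
  proof
    fix x assume x: "x \<in> sign_vecs n"
    then have "x = vec n (restrict (($) x) {..<n})" by (auto simp: sign_vecs_def)
    moreover have "restrict (($) x) {..<n} \<in> {..<n} \<rightarrow>\<^sub>E {-1, 1}"
      using x by (auto simp: sign_vecs_def)
    ultimately show "x \<in> (\<lambda>f. vec n f) ` ({..<n} \<rightarrow>\<^sub>E {-1, 1})" by blast
  qed
qed (intro finite_imageI finite_PiE; simp)

lemma sign_vecs_nonempty: "sign_vecs n \<noteq> {}"
proof -
  have "vec n (\<lambda>_. 1) \<in> sign_vecs n" by (simp add: sign_vecs_def)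
  then show ?thesis by blast
qed

lemma quad_form_le_opt: "x \<in> sign_vecs n \<Longrightarrow> quad_form C x \<le> opt n C"
  unfolding opt_def by (intro Max_ge finite_imageI finite_sign_vecs imageI)

lemma quad_form_sum:
  assumes "C \<in> carrier_mat n n" "x \<in> carrier_vec n"
  shows "quad_form C x = (\<Sum>i<n. \<Sum>j<n. C $$ (i, j) * x $ i * x $ j)"
  using assms
  by (auto simp: quad_form_def scalar_prod_def atLeast0LessThan sum_distrib_left mult_ac intro!: sum.cong)

theorem theorem1p1:
  shows "\<exists>(P :: com) (K :: real). K > 0 \<and>
    (\<forall>(n :: nat) (\<epsilon> :: real) (C :: real mat) (m :: real).
      n \<ge> 1 \<and> 0 < \<epsilon> \<and> \<epsilon> < 1 \<and>
      C \<in> carrier_mat n n \<and> transpose_mat C = C \<and> diagonally_dominant C \<and>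
      (\<forall>i<n. C $$ (i, i) > 0) \<and>
      m \<ge> real n \<longrightarrow>
      (\<exists>w :: (nat \<Rightarrow> real) \<Rightarrow> real vec.
        (\<forall>\<omega>. w \<omega> \<in> sign_vecs n) \<and>
        (\<forall>i<n. (\<lambda>\<omega>. w \<omega> $ i) \<in> borel_measurable gaussians) \<and>
        (\<forall>\<omega>. \<exists>t A.
          run P \<lparr>dim = n, acc = \<epsilon>, cost_mat = C, mvc = m\<rparr> \<omega> t A (w \<omega>) \<and>
          t \<le> K * (real n ^ 3 / \<epsilon> ^ 3 * ln (2 * real n) * ln (4 * real n / \<epsilon>) * m) \<and>
          card A \<le> 3 * n) \<and>
        alpha_GW * (1 - \<epsilon>) * opt n C \<le> (\<integral>\<omega>. quad_form C (w \<omega>) \<partial>gaussians) \<and>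
        (\<integral>\<omega>. quad_form C (w \<omega>) \<partial>gaussians) \<le> opt n C))"
proof (rule exI[of _ maxcut_com], rule exI[of _ 40000], intro conjI allI impI)
  fix n :: nat and \<epsilon> :: real and C :: "real mat" and m :: real
  assume A: "n \<ge> 1 \<and> 0 < \<epsilon> \<and> \<epsilon> < 1 \<and>
      C \<in> carrier_mat n n \<and> transpose_mat C = C \<and> diagonally_dominant C \<and>
      (\<forall>i<n. C $$ (i, i) > 0) \<and> m \<ge> real n"
  then have C: "C \<in> carrier_mat n n" and diag: "\<And>i. i < n \<Longrightarrow> C $$ (i, i) > 0" by auto
  define c where "c i j = C $$ (i, j)" for i j
  interpret maxcut_params n c \<epsilon>
  proof
    show "c i j = c j i" if "i < n" "j < n" for i j
    proof -
      have "C $$ (i, j) = transpose_mat C $$ (i, j)" using A by simp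
      then show ?thesis using that C by (simp add: c_def)
    qed
    show "(\<Sum>j\<in>{..<n} - {i}. \<bar>c i j\<bar>) \<le> c i i" if "i < n" for i
    proof -
      have "(\<Sum>j\<in>{..<n} - {i}. \<bar>c i j\<bar>) \<le> \<bar>c i i\<bar>"
        using A that by (auto simp: diagonally_dominant_def c_def)
      then show ?thesis using diag[OF that] by (simp add: c_def)
    qed
  qed (use A in \<open>auto simp: c_def\<close>)
  let ?I = "\<lparr>dim = n, acc = \<epsilon>, cost_mat = C, mvc = m\<rparr>"
  define w where "w \<omega> = vec n (rounded \<omega>)" for \<omega>
  have w_sign: "w \<omega> \<in> sign_vecs n" for \<omega>
    using rounded_sign[of \<omega>] by (auto simp: w_def sign_vecs_def)
  have w_form: "quad_form C (w \<omega>) = bf (rounded \<omega>) (rounded \<omega>)" for \<omega>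
    by (subst quad_form_sum[OF C]) (auto simp: w_def bf_def c_def intro!: sum.cong)
  have int: "integrable gaussians (\<lambda>\<omega>. quad_form C (w \<omega>))"
    unfolding w_form bf_def mult.assoc
    by (intro Bochner_Integration.integrable_sum integrable_mult_right rounded_integrable)
  have lower: "alpha_GW * (1 - \<epsilon>) * opt n C \<le> (\<integral>\<omega>. quad_form C (w \<omega>) \<partial>gaussians)"
  proof -
    have "opt n C \<in> quad_form C ` sign_vecs n"
      unfolding opt_def by (intro Max_in finite_imageI finite_sign_vecs) (simp add: sign_vecs_nonempty)
    then obtain x where x: "x \<in> sign_vecs n" "opt n C = quad_form C x" by blast
    define u where "u i = x $ i" for i
    have "x \<in> carrier_vec n" using x(1) by (simp add: sign_vecs_def)
    then have opt: "opt n C = bf u u"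
      unfolding x(2) by (simp add: quad_form_sum[OF C] bf_def c_def u_def)
    have u: "(u i)\<^sup>2 = 1" if "i < n" for i
      using x(1) that by (auto simp: sign_vecs_def u_def)
    show ?thesis
    \<comment> \<open>The optimum is nonnegative by semidefiniteness; if it is 0, the bound only
      says that the expectation is nonnegative.\<close>
    proof (cases "bf u u > 0")
      case True
      then show ?thesis unfolding opt w_form by (rule approximation_ratio[OF _ u])
    next
      case False
      then have "bf u u = 0" using bf_nonneg[of u] by simp
      moreover have "0 \<le> (\<integral>\<omega>. quad_form C (w \<omega>) \<partial>gaussians)"
        unfolding w_form by (rule Bochner_Integration.integral_nonneg) (rule bf_nonneg)
      ultimately show ?thesis by (simp add: opt)
    qed
  qed
  have upper: "(\<integral>\<omega>. quad_form C (w \<omega>) \<partial>gaussians) \<le> opt n C"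
    by (rule gaussians.integral_le_const[OF int]) (simp add: quad_form_le_opt w_sign)
  have runs: "\<exists>t A. run maxcut_com ?I \<omega> t A (w \<omega>) \<and>
      t \<le> 40000 * (real n ^ 3 / \<epsilon> ^ 3 * ln (2 * real n) * ln (4 * real n / \<epsilon>) * m) \<and> card A \<le> 3 * n" for \<omega>
  proof -
    \<comment> \<open>The function \<open>w\<close> comes from \<open>maxcut_params\<close> alone,
      so the execution locale is interpreted for one random sequence at a time.\<close>
    interpret maxcut_run n c \<epsilon> ?I \<omega>
      by unfold_locales (use A in \<open>auto simp: c_def\<close>)
    show ?thesis using run_maxcut cost_bound unfolding w_def by fastforce
  qed
  have meas: "(\<lambda>\<omega>. w \<omega> $ i) \<in> borel_measurable gaussians" if "i < n" for i
    using that rounded_measurable by (simp add: w_def)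
  show "\<exists>w :: (nat \<Rightarrow> real) \<Rightarrow> real vec.
        (\<forall>\<omega>. w \<omega> \<in> sign_vecs n) \<and>
        (\<forall>i<n. (\<lambda>\<omega>. w \<omega> $ i) \<in> borel_measurable gaussians) \<and>
        (\<forall>\<omega>. \<exists>t A.
          run maxcut_com ?I \<omega> t A (w \<omega>) \<and>
          t \<le> 40000 * (real n ^ 3 / \<epsilon> ^ 3 * ln (2 * real n) * ln (4 * real n / \<epsilon>) * m) \<and>
          card A \<le> 3 * n) \<and>
        alpha_GW * (1 - \<epsilon>) * opt n C \<le> (\<integral>\<omega>. quad_form C (w \<omega>) \<partial>gaussians) \<and>
        (\<integral>\<omega>. quad_form C (w \<omega>) \<partial>gaussians) \<le> opt n C"
    using w_sign meas runs lower upper by (intro exI[of _ w] conjI allI impI) auto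
qed simp

end
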